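(* Let $k\in\mathbb{N}^*$. Then there exists $C\ge0$ such that for all $U_0\in\mathrm{Dom}(\mathcal{A}_D^k)$ and all $t\ge1$, \[ \|e^{-it\mathcal{A}_D}U_0\|_{\mathscr{E}_D}\le C\,t^{-\frac k2}\|\mathcal{A}_D^kU_0\|_{\mathscr{E}_D}. \]
   Context: Let $d,n \in \mathbb{N}^*$, $\omega \subset \mathbb{R}^n$ bounded, open, smooth and connected, $\Omega = \mathbb{R}^d \times \omega$. The absorption index $a$ is a bounded non-negative function on $\Omega$ such that there exist a compact subset $K$ of $\bar\Omega$ and $c_0>0$ with $a(x,y)\ge c_0$ for all $(x,y)\in\Omega\setminus K$. $\mathscr{E}_D=H_0^1(\Omega)\times L^2(\Omega)$, and $\mathcal{A}_D=\begin{pmatrix}0&I\\-\Delta&-ia\end{pmatrix}$ on $\mathscr{E}_D$ with domain $\{(u,v)\in\mathscr{E}_D:\mathcal{A}_D(u,v)\in\mathscr{E}_D\}$; it is maximal dissipative so $-i\mathcal{A}_D$ generates a contraction semigroup $e^{-it\mathcal{A}_D}$, which describes the damped wave equation $\partial_t^2u-\Delta u+a\partial_tu=0$ with Dirichlet boundary condition. *)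

theory Defs
  imports "HOL-Analysis.Analysis"
begin

definition pd :: "('a::euclidean_space \<Rightarrow> 'b::real_normed_vector) \<Rightarrow> 'a \<Rightarrow> 'a \<Rightarrow> 'b" where
  "pd f b x = frechet_derivative f (at x) b"

fun Ck :: "nat \<Rightarrow> ('a::euclidean_space \<Rightarrow> 'b::real_normed_vector) \<Rightarrow> bool" where
  "Ck 0 f = continuous_on UNIV f"
| "Ck (Suc k) f = ((\<forall>x. f differentiable (at x)) \<and> (\<forall>b\<in>Basis. Ck k (\<lambda>x. pd f b x)))"

definition smooth_fun :: "('a::euclidean_space \<Rightarrow> 'b::real_normed_vector) \<Rightarrow> bool" where
  "smooth_fun f = (\<forall>k. Ck k f)"

definition test_fun :: "'a::euclidean_space set \<Rightarrow> ('a \<Rightarrow> complex) \<Rightarrow> bool" where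
  "test_fun \<Omega> \<phi> = (smooth_fun \<phi> \<and> compact (closure {x. \<phi> x \<noteq> 0})
                      \<and> closure {x. \<phi> x \<noteq> 0} \<subseteq> \<Omega>)"

definition smooth_boundary :: "'n::euclidean_space set \<Rightarrow> bool" where
  "smooth_boundary \<omega> = (\<exists>\<rho>::'n \<Rightarrow> real. smooth_fun \<rho> \<and> \<omega> = {x. \<rho> x < 0}
      \<and> (\<forall>x. \<rho> x = 0 \<longrightarrow> frechet_derivative \<rho> (at x) \<noteq> (\<lambda>_. 0)))"

definition L2 :: "'a::euclidean_space set \<Rightarrow> ('a \<Rightarrow> complex) \<Rightarrow> bool" where
  "L2 \<Omega> u = (u \<in> borel_measurable (lebesgue_on \<Omega>)
              \<and> integrable (lebesgue_on \<Omega>) (\<lambda>x. (cmod (u x))^2))"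

definition L2norm :: "'a::euclidean_space set \<Rightarrow> ('a \<Rightarrow> complex) \<Rightarrow> real" where
  "L2norm \<Omega> u = sqrt (\<integral>x. (cmod (u x))^2 \<partial>lebesgue_on \<Omega>)"

definition weak_grad :: "'a::euclidean_space set \<Rightarrow> ('a \<Rightarrow> complex) \<Rightarrow> ('a \<Rightarrow> 'a \<Rightarrow> complex) \<Rightarrow> bool" where
  "weak_grad \<Omega> u G = (\<forall>b\<in>Basis. \<forall>\<phi>. test_fun \<Omega> \<phi> \<longrightarrow>
      (\<integral>x. u x * pd \<phi> b x \<partial>lebesgue_on \<Omega>) = - (\<integral>x. G b x * \<phi> x \<partial>lebesgue_on \<Omega>))"

definition L2_grad :: "'a::euclidean_space set \<Rightarrow> ('a \<Rightarrow> complex) \<Rightarrow> ('a \<Rightarrow> 'a \<Rightarrow> complex) \<Rightarrow> bool" where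
  "L2_grad \<Omega> u G = ((\<forall>b\<in>Basis. L2 \<Omega> (G b)) \<and> weak_grad \<Omega> u G)"

definition grad :: "'a::euclidean_space set \<Rightarrow> ('a \<Rightarrow> complex) \<Rightarrow> 'a \<Rightarrow> 'a \<Rightarrow> complex" where
  "grad \<Omega> u = (SOME G. L2_grad \<Omega> u G)"

definition H01 :: "'a::euclidean_space set \<Rightarrow> ('a \<Rightarrow> complex) \<Rightarrow> bool" where
  "H01 \<Omega> u = (L2 \<Omega> u \<and> (\<exists>G \<phi>s. L2_grad \<Omega> u G \<and> (\<forall>m. test_fun \<Omega> (\<phi>s m))
      \<and> (\<lambda>m. L2norm \<Omega> (\<lambda>x. \<phi>s m x - u x)) \<longlonglongrightarrow> 0
      \<and> (\<forall>b\<in>Basis. (\<lambda>m. L2norm \<Omega> (\<lambda>x. pd (\<phi>s m) b x - G b x)) \<longlonglongrightarrow> 0)))"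

type_synonym 'a state = "('a \<Rightarrow> complex) \<times> ('a \<Rightarrow> complex)"

definition ED :: "'a::euclidean_space set \<Rightarrow> 'a state \<Rightarrow> bool" where
  "ED \<Omega> U = (H01 \<Omega> (fst U) \<and> L2 \<Omega> (snd U))"

definition EDnorm :: "'a::euclidean_space set \<Rightarrow> 'a state \<Rightarrow> real" where
  "EDnorm \<Omega> U = sqrt ((\<Sum>b\<in>Basis. (L2norm \<Omega> (grad \<Omega> (fst U) b))^2) + (L2norm \<Omega> (snd U))^2)"

definition st_diff :: "'a state \<Rightarrow> 'a state \<Rightarrow> 'a state" where
  "st_diff U V = ((\<lambda>x. fst U x - fst V x), (\<lambda>x. snd U x - snd V x))"

definition st_scale :: "complex \<Rightarrow> 'a state \<Rightarrow> 'a state" where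
  "st_scale c U = ((\<lambda>x. c * fst U x), (\<lambda>x. c * snd U x))"

text \<open>Graph of A_D: U in Dom(A_D) and W = A_D U, where A_D (u,v) = (v, -Delta u - i a v).
  The second component is taken in the distributional sense (tested against test functions).\<close>
definition graphA :: "'a::euclidean_space set \<Rightarrow> ('a \<Rightarrow> real) \<Rightarrow> 'a state \<Rightarrow> 'a state \<Rightarrow> bool" where
  "graphA \<Omega> a U W = (ED \<Omega> U \<and> ED \<Omega> W
      \<and> (AE x in lebesgue_on \<Omega>. fst W x = snd U x)
      \<and> (\<forall>\<phi>. test_fun \<Omega> \<phi> \<longrightarrow>
           (\<integral>x. (snd W x + \<i> * complex_of_real (a x) * snd U x) * \<phi> x \<partial>lebesgue_on \<Omega>)
         = (\<integral>x. (\<Sum>b\<in>Basis. grad \<Omega> (fst U) b x * pd \<phi> b x) \<partial>lebesgue_on \<Omega>)))"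

text \<open>U is a classical solution of U' = -i A_D U on [0,oo) with U(0) = U0; for U0 in Dom(A_D)
  this is exactly U(t) = exp(-i t A_D) U0 (up to null sets).\<close>
definition damped_solution :: "'a::euclidean_space set \<Rightarrow> ('a \<Rightarrow> real) \<Rightarrow> 'a state \<Rightarrow> (real \<Rightarrow> 'a state) \<Rightarrow> bool" where
  "damped_solution \<Omega> a U0 U = ((\<forall>t\<ge>0. ED \<Omega> (U t)) \<and> EDnorm \<Omega> (st_diff (U 0) U0) = 0
     \<and> (\<exists>W. \<forall>t\<ge>0. graphA \<Omega> a (U t) (st_scale \<i> (W t))
          \<and> ((\<lambda>h. EDnorm \<Omega> (st_diff (st_scale (complex_of_real (1/h)) (st_diff (U (t+h)) (U t))) (W t)))
               \<longlongrightarrow> 0) (at 0 within {h. 0 \<le> t + h})))"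

end

(*
Write v for the displacement and p = v_t. Let x be a coordinate of the unbounded factor. For g = sin(x/L)
with L large, the multiplier g v_x + g'v/2, corrected by a multiple of chi v where chi is supported in the
damped region |x| > R, gives a functional J of the energy space with
J' <= - c |v|^2 + C <a v, v> + C <a p, p>: the term g''' v^2/4 produced by the commutator has the good
sign for |x| <= R, so that |v|^2 is controlled without any control of the transversal derivatives.
Applied to the difference quotients of a solution u this bounds the time integral of |u_t|^2, since
<a u_t, u_t> is integrable in time by dissipation; by equipartition the whole energy of u is integrable,
and as it decreases, |U(T)| <= C T^(-1/2) |U'(0)|.
For general k the estimate is iterated on the difference quotients D_h^k U, which again are solutions.
They are bounded at time 0 by |A^k U_0| because U differs from its Taylor polynomial of degree k - 1 by
at most t^k |A^k U_0| / k!, by dissipativity. Thus neither a semigroup nor a resolvent is needed.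
*)
theory Submission
  imports Defs
begin

section \<open>Dissipative evolutions\<close>

text \<open>The obstacle is regularity. A classical solution is known to be differentiable once, and
  its derivative is not known to solve the equation. Difference quotients in time stand in for
  derivatives: the graph of the generator is a linear subspace, so they are orbits again. Their
  norms decrease in time, and a quotient with a coarse step is a mean of quotients with finer steps;
  so bounds for small steps pass to larger steps and to the limit. In space, translations along the
  unbounded factor preserve the domain and its test functions, and replace second derivatives of v.
  A state is the pair of gradient and velocity, as the energy sees nothing else. The displacement is
  recovered through Poincare's inequality, available because the cross section is bounded. The same
  inequality bounds the generator from below; this turns an estimate by |U(0)| and |U'(0)| into one
  by |U'(0)| alone. L = 2R is large enough: g' is then bounded below for |x| <= 2R, and chi takes
  over beyond, where g' may be negative.\<close>

definition orbit :: "('x::real_inner \<times> 'x) set \<Rightarrow> (real \<Rightarrow> 'x) \<Rightarrow> (real \<Rightarrow> 'x) \<Rightarrow> bool" where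
  "orbit A x y \<longleftrightarrow> (\<forall>t\<ge>0. (x t, y t) \<in> A \<and> (x has_vector_derivative y t) (at t within {0..}))"

definition dissipative :: "('x::real_inner \<times> 'x) set \<Rightarrow> bool" where
  "dissipative A \<longleftrightarrow> (\<forall>(x, y)\<in>A. inner x y \<le> 0)"

text \<open>Since \<open>1 / 0 = 0\<close>, \<open>dq 0 x\<close> is the zero function; this is why
  \<open>orbit_dq\<close> covers \<open>h = 0\<close>.\<close>

definition dq :: "real \<Rightarrow> (real \<Rightarrow> 'x::real_vector) \<Rightarrow> real \<Rightarrow> 'x" where
  "dq h x t = (1 / h) *\<^sub>R (x (t + h) - x t)"

section \<open>Growth bounds for norms along trajectories\<close>

lemma has_vector_derivative_tendsto:
  fixes f :: "real \<Rightarrow> 'x::real_normed_vector"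
  shows "(f has_vector_derivative d) (at x within S) \<longleftrightarrow>
    ((\<lambda>y. (1 / (y - x)) *\<^sub>R (f y - f x)) \<longlongrightarrow> d) (at x within S)"
proof -
  have "norm (f y - f x - (y - x) *\<^sub>R d) / norm (y - x) = norm ((1 / (y - x)) *\<^sub>R (f y - f x) - d)" if "y \<noteq> x" for y
  proof -
    have "(1 / (y - x)) *\<^sub>R (f y - f x) - d = (1 / (y - x)) *\<^sub>R (f y - f x - (y - x) *\<^sub>R d)"
      using that by (simp add: scaleR_diff_right)
    then show ?thesis by (simp add: divide_inverse)
  qed
  then have "((\<lambda>y. norm (f y - f x - (y - x) *\<^sub>R d) / norm (y - x)) \<longlongrightarrow> 0) (at x within S) \<longleftrightarrow>
      ((\<lambda>y. norm ((1 / (y - x)) *\<^sub>R (f y - f x) - d)) \<longlongrightarrow> 0) (at x within S)"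
    by (intro tendsto_cong) (auto simp: eventually_at_filter intro!: always_eventually)
  then show ?thesis
    unfolding has_vector_derivative_def has_derivative_iff_norm
    by (simp add: bounded_linear_scaleR_left tendsto_norm_zero_iff LIM_zero_iff)
qed

text \<open>Formally \<open>sqrt f\<close> has derivative \<open>f' / (2 * sqrt f)\<close>, which is
  at most \<open>b'\<close>. The root is not differentiable where its argument vanishes, so the
  bound is proved for \<open>sqrt (f + e\<^sup>2)\<close> and \<open>e\<close> tends to 0.\<close>

lemma sqrt_growth_bound:
  fixes f f' b b' :: "real \<Rightarrow> real"
  assumes f: "\<And>t. t \<ge> 0 \<Longrightarrow> (f has_real_derivative f' t) (at t within {0..})"
    and b: "\<And>t. t \<ge> 0 \<Longrightarrow> (b has_real_derivative b' t) (at t within {0..})"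
    and pos: "\<And>t. t \<ge> 0 \<Longrightarrow> f t \<ge> 0" "\<And>t. t \<ge> 0 \<Longrightarrow> b' t \<ge> 0"
    and le: "\<And>t. t \<ge> 0 \<Longrightarrow> f' t \<le> 2 * b' t * sqrt (f t)"
    and T: "0 \<le> s" "s \<le> T"
  shows "sqrt (f T) \<le> sqrt (f s) + (b T - b s)"
proof -
  have eps: "sqrt (f T + e\<^sup>2) \<le> sqrt (f s + e\<^sup>2) + (b T - b s)" if e: "e > 0" for e
  proof -
    define F where "F t = sqrt (f t + e\<^sup>2) - b t" for t
    have der: "(F has_real_derivative (f' t / (2 * sqrt (f t + e\<^sup>2)) - b' t)) (at t within {s..T})"
      if t: "t \<in> {s..T}" for t
    proof -
      have t0: "t \<ge> 0" using t T by auto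
      have sub: "{s..T} \<subseteq> {0..}" using T by auto
      have p: "f t + e\<^sup>2 > 0" using pos(1)[OF t0] e by (simp add: add_nonneg_pos)
      show ?thesis unfolding F_def
        using DERIV_subset[OF f[OF t0] sub] DERIV_subset[OF b[OF t0] sub] p
        by (auto intro!: derivative_eq_intros simp: field_simps)
    qed
    have neg: "f' t / (2 * sqrt (f t + e\<^sup>2)) - b' t \<le> 0" if t: "t \<in> {s..T}" for t
    proof -
      have t0: "t \<ge> 0" using t T by auto
      have p: "sqrt (f t + e\<^sup>2) > 0" using pos(1)[OF t0] e by (simp add: add_nonneg_pos)
      have "f' t \<le> 2 * b' t * sqrt (f t + e\<^sup>2)"
        using le[OF t0] pos(2)[OF t0] by (smt (verit, best) mult_left_mono real_sqrt_le_mono zero_le_power2)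
      then show ?thesis using p by (simp add: field_simps)
    qed
    have "F T \<le> F s"
    proof (rule DERIV_nonpos_imp_decreasing_open[OF T(2)])
      show "\<exists>y. (F has_real_derivative y) (at x) \<and> y \<le> 0" if "s < x" "x < T" for x
        using der[of x] neg[of x] that
        by (metis at_within_Icc_at atLeastAtMost_iff less_eq_real_def)
      show "continuous_on {s..T} F"
        using der by (meson DERIV_isCont continuous_on_eq_continuous_within has_field_derivative_imp_has_derivative has_derivative_continuous)
    qed
    then show ?thesis by (simp add: F_def)
  qed
  have "((\<lambda>e. sqrt (f T + e\<^sup>2)) \<longlongrightarrow> sqrt (f T + 0\<^sup>2)) (at_right 0)"
    by (intro tendsto_intros)
  moreover have "((\<lambda>e. sqrt (f s + e\<^sup>2) + (b T - b s)) \<longlongrightarrow> sqrt (f s + 0\<^sup>2) + (b T - b s)) (at_right 0)"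
    by (intro tendsto_intros)
  ultimately show ?thesis
    using tendsto_le[of "at_right (0::real)" "\<lambda>e. sqrt (f s + e\<^sup>2) + (b T - b s)" _ "\<lambda>e. sqrt (f T + e\<^sup>2)"] eps
    by (simp add: eventually_at_right_less eventually_mono[OF eventually_at_right_less])
qed

text \<open>A dissipative equation with a source of norm at most \<open>b'\<close> gives exactly the
  hypothesis on \<open>inner (z t) (w t)\<close>. A constant \<open>b\<close> yields contraction of
  orbits, a monomial the Taylor remainder.\<close>

lemma dissipative_growth_bound:
  fixes z w :: "real \<Rightarrow> 'x::real_inner" and b b' :: "real \<Rightarrow> real"
  assumes z: "\<And>t. t \<ge> 0 \<Longrightarrow> (z has_vector_derivative w t) (at t within {0..})"
    and b: "\<And>t. t \<ge> 0 \<Longrightarrow> (b has_real_derivative b' t) (at t within {0..})"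
    and b': "\<And>t. t \<ge> 0 \<Longrightarrow> b' t \<ge> 0"
    and le: "\<And>t. t \<ge> 0 \<Longrightarrow> inner (z t) (w t) \<le> b' t * norm (z t)"
    and T: "0 \<le> s" "s \<le> T"
  shows "norm (z T) \<le> norm (z s) + (b T - b s)"
proof -
  have "sqrt (inner (z T) (z T)) \<le> sqrt (inner (z s) (z s)) + (b T - b s)"
  proof (rule sqrt_growth_bound[OF _ b _ b' _ T])
    show "((\<lambda>t. inner (z t) (z t)) has_real_derivative 2 * inner (z t) (w t)) (at t within {0..})"
      if "t \<ge> 0" for t
    proof -
      have "((\<lambda>t. inner (z t) (z t)) has_vector_derivative inner (z t) (w t) + inner (w t) (z t)) (at t within {0..})"
        by (rule bounded_bilinear.has_vector_derivative[OF bounded_bilinear_inner z[OF that] z[OF that]])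
      then show ?thesis by (simp add: has_real_derivative_iff_has_vector_derivative inner_commute)
    qed
    show "2 * inner (z t) (w t) \<le> 2 * b' t * sqrt (inner (z t) (z t))" if "t \<ge> 0" for t
      using le[OF that] by (simp add: norm_eq_sqrt_inner)
  qed auto
  then show ?thesis by (simp add: norm_eq_sqrt_inner)
qed

section \<open>Shifts and difference quotients of orbits\<close>

lemma orbit_derivative: "orbit A x y \<Longrightarrow> t \<ge> 0 \<Longrightarrow> (x has_vector_derivative y t) (at t within {0..})"
  by (simp add: orbit_def)

lemma orbit_mem: "orbit A x y \<Longrightarrow> t \<ge> 0 \<Longrightarrow> (x t, y t) \<in> A"
  by (simp add: orbit_def)

lemma orbit_norm_mono:
  assumes "orbit A x y" "dissipative A" "0 \<le> s" "s \<le> t"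
  shows "norm (x t) \<le> norm (x s)"
proof -
  have "norm (x t) \<le> norm (x s) + (0 - 0)"
    using assms by (intro dissipative_growth_bound[where w=y and b="\<lambda>_. 0" and b'="\<lambda>_. 0"])
      (auto simp: orbit_def dissipative_def)
  then show ?thesis by simp
qed

lemma orbit_shift:
  assumes "orbit A x y" "s \<ge> 0"
  shows "orbit A (\<lambda>t. x (t + s)) (\<lambda>t. y (t + s))"
  unfolding orbit_def
proof (intro allI impI conjI)
  fix t :: real assume t: "t \<ge> 0"
  show "(x (t + s), y (t + s)) \<in> A" using assms t by (simp add: orbit_def)
  have "(x has_vector_derivative y (t + s)) (at (t + s) within {0..})"
    using assms t by (simp add: orbit_def)
  then have "(x has_vector_derivative y (t + s)) (at (t + s) within ((\<lambda>t. t + s) ` {0..}))"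
    by (rule has_vector_derivative_within_subset) (use assms in auto)
  then have "((x \<circ> (\<lambda>t. t + s)) has_vector_derivative 1 *\<^sub>R y (t + s)) (at t within {0..})"
    by (intro vector_diff_chain_within) (auto intro!: derivative_eq_intros)
  then show "((\<lambda>t. x (t + s)) has_vector_derivative y (t + s)) (at t within {0..})"
    by (simp add: o_def)
qed

text \<open>The equation is linear and autonomous, so a quotient of two shifted copies of an orbit
  is an orbit. The quotient of \<open>y\<close> accompanies that of \<open>x\<close>; a derivative
  of \<open>y\<close> never appears.\<close>

lemma orbit_dq:
  assumes "subspace A" "orbit A x y" "h \<ge> 0"
  shows "orbit A (dq h x) (dq h y)"
  unfolding orbit_def
proof (intro allI impI conjI)
  fix t :: real assume t: "t \<ge> 0"
  have "((x (t + h), y (t + h)) - (x t, y t)) \<in> A"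
    using assms t orbit_mem[OF orbit_shift[OF assms(2,3)] t] by (intro subspace_diff) (auto simp: orbit_def)
  then have "(1/h) *\<^sub>R ((x (t + h), y (t + h)) - (x t, y t)) \<in> A"
    by (rule subspace_scale[OF assms(1)])
  then show "(dq h x t, dq h y t) \<in> A" by (simp add: dq_def)
  show "(dq h x has_vector_derivative dq h y t) (at t within {0..})"
    unfolding dq_def[abs_def]
    by (rule has_vector_derivative_scaleR[where f="\<lambda>_. 1/h" and f'=0, simplified]
      has_vector_derivative_diff derivative_eq_intros orbit_derivative[OF orbit_shift[OF assms(2,3)] t]
      orbit_derivative[OF assms(2) t] | simp)+
qed

lemma orbit_dq_funpow:
  assumes "subspace A" "orbit A x y" "h \<ge> 0"
  shows "orbit A ((dq h ^^ k) x) ((dq h ^^ k) y)"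
  by (induction k) (use assms in \<open>auto intro: orbit_dq\<close>)

lemma dq_commute: "dq h (dq h' x) = dq h' (dq h x)"
  by (rule ext) (simp add: dq_def algebra_simps)

lemma dq_funpow_commute: "(dq h ^^ k) (dq h' x) = dq h' ((dq h ^^ k) x)"
  by (induction k) (auto simp: dq_commute)

lemma dq_diff: "dq h (\<lambda>t. x t - y t) = (\<lambda>t. dq h x t - dq h y t)"
  by (rule ext) (simp add: dq_def algebra_simps)

lemma dq_add: "dq h (\<lambda>t. x t + y t) = (\<lambda>t. dq h x t + dq h y t)"
  by (rule ext) (simp add: dq_def algebra_simps)

lemma dq_funpow_diff: "(dq h ^^ k) (\<lambda>t. x t - y t) = (\<lambda>t. (dq h ^^ k) x t - (dq h ^^ k) y t)"
  by (induction k) (auto simp: dq_diff)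

text \<open>A quotient over a long step telescopes into the mean of \<open>m\<close> quotients over
  short steps, taken at successive times.\<close>

lemma dq_multiple:
  assumes "m > 0"
  shows "dq (real m * h) x t = (1 / real m) *\<^sub>R (\<Sum>i<m. dq h x (t + real i * h))"
proof -
  have "(\<Sum>i<m. x (t + real i * h + h) - x (t + real i * h)) = x (t + real m * h) - x t"
    using sum_lessThan_telescope[of "\<lambda>i. x (t + real i * h)" m] by (simp add: algebra_simps)
  then show ?thesis by (simp add: dq_def scaleR_sum_right[symmetric])
qed

text \<open>By dissipation the norms of the summands of that mean decrease in time, so the first
  bounds all. Refining the step by an integer factor can only increase the norm.\<close>

lemma orbit_dq_multiple_le:
  assumes "subspace A" "dissipative A" "orbit A x y" "h \<ge> 0" "t \<ge> 0" "m > 0"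
  shows "norm (dq (real m * h) x t) \<le> norm (dq h x t)"
proof -
  have "norm (\<Sum>i<m. dq h x (t + real i * h)) \<le> (\<Sum>i<m. norm (dq h x t))"
    by (rule sum_norm_le)
      (use assms in \<open>auto intro!: orbit_norm_mono[OF orbit_dq[OF assms(1,3,4)] assms(2)]\<close>)
  then show ?thesis using assms(6)
    by (simp only: dq_multiple norm_scaleR) (simp add: divide_le_eq mult.commute)
qed

text \<open>Quotients with different steps commute, so the \<open>k\<close> steps can be refined one
  at a time.\<close>

lemma orbit_dq_funpow_multiple_le:
  assumes "subspace A" "dissipative A" "h \<ge> 0" "t \<ge> 0" "m > 0"
  shows "orbit A x y \<Longrightarrow> norm ((dq (real m * h) ^^ k) x t) \<le> norm ((dq h ^^ k) x t)"
proof (induction k arbitrary: x y)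
  case (Suc k)
  have mh: "real m * h \<ge> 0" using assms by simp
  have "norm ((dq (real m * h) ^^ Suc k) x t) \<le> norm (dq h ((dq (real m * h) ^^ k) x) t)"
    using orbit_dq_multiple_le[OF assms(1,2) orbit_dq_funpow[OF assms(1) Suc.prems mh] assms(3-5)] by simp
  also have "\<dots> = norm ((dq (real m * h) ^^ k) (dq h x) t)" by (simp add: dq_funpow_commute)
  also have "\<dots> \<le> norm ((dq h ^^ k) (dq h x) t)"
    by (rule Suc.IH[OF orbit_dq[OF assms(1) Suc.prems assms(3)]])
  also have "\<dots> = norm ((dq h ^^ Suc k) x t)" by (simp add: dq_funpow_commute)
  finally show ?case .
qed simp

section \<open>Vector-valued polynomials and Taylor expansion of orbits\<close>

inductive poly_below :: "nat \<Rightarrow> (real \<Rightarrow> 'x::real_vector) \<Rightarrow> bool" for k where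
  poly_below_zero: "poly_below k (\<lambda>_. 0)"
| poly_below_add: "j < k \<Longrightarrow> poly_below k f \<Longrightarrow> poly_below k (\<lambda>t. t ^ j *\<^sub>R c + f t)"

lemma poly_below_add2: "poly_below k f \<Longrightarrow> poly_below k g \<Longrightarrow> poly_below k (\<lambda>t. f t + g t)"
proof (induction rule: poly_below.induct)
  case (poly_below_add j f c)
  then show ?case using poly_below.poly_below_add[of j k "\<lambda>t. f t + g t" c] by (simp add: add.assoc)
qed simp

lemma poly_below_sum:
  "finite I \<Longrightarrow> (\<And>i. i \<in> I \<Longrightarrow> j i < k) \<Longrightarrow> poly_below k (\<lambda>t. \<Sum>i\<in>I. t ^ j i *\<^sub>R c i)"
  by (induction rule: finite_induct) (auto intro: poly_below.intros)

text \<open>In the binomial expansion of \<open>(t + h) ^ j - t ^ j\<close> the leading power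
  cancels, so one quotient lowers the degree.\<close>

lemma poly_below_dq:
  assumes "poly_below (Suc k) f" "h \<noteq> 0"
  shows "poly_below k (dq h f)"
  using assms(1)
proof (induction rule: poly_below.induct)
  case poly_below_zero
  then show ?case by (simp add: dq_def[abs_def] poly_below.intros)
next
  case (poly_below_add j f c)
  have "dq h (\<lambda>t. t ^ j *\<^sub>R c) = (\<lambda>t. \<Sum>i<j. t ^ i *\<^sub>R ((real (j choose i) * h ^ (j - i) / h) *\<^sub>R c))"
  proof
    fix t
    have "(t + h) ^ j - t ^ j = (\<Sum>i<j. of_nat (j choose i) * t ^ i * h ^ (j - i))"
      by (simp add: binomial_ring lessThan_Suc_atMost[symmetric])
    then show "dq h (\<lambda>t. t ^ j *\<^sub>R c) t = (\<Sum>i<j. t ^ i *\<^sub>R ((real (j choose i) * h ^ (j - i) / h) *\<^sub>R c))"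
      by (simp add: dq_def scaleR_diff_left[symmetric] scaleR_sum_left[symmetric] sum_divide_distrib ac_simps)
  qed
  moreover have "poly_below k (\<lambda>t. \<Sum>i<j. t ^ i *\<^sub>R ((real (j choose i) * h ^ (j - i) / h) *\<^sub>R c))"
    using poly_below_add(1) by (intro poly_below_sum) auto
  ultimately show ?case using poly_below_add by (simp add: dq_add poly_below_add2)
qed

lemma poly_below_dq_funpow:
  assumes "poly_below k f" "h \<noteq> 0"
  shows "(dq h ^^ k) f = (\<lambda>_. 0)"
  using assms(1)
proof (induction k arbitrary: f)
  case 0
  then show ?case by (induction rule: poly_below.induct) auto
next
  case (Suc k)
  then show ?case using poly_below_dq[OF Suc.prems assms(2)] by (simp add: dq_funpow_commute[symmetric])
qed

text \<open>Each quotient costs a factor \<open>2 / h\<close>, and \<open>k\<close> of them look at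
  \<open>z\<close> only on an interval of length \<open>k * h\<close>.\<close>

lemma dq_funpow_norm_le:
  assumes "h > 0"
  shows "(\<And>s. t \<le> s \<Longrightarrow> s \<le> t + real k * h \<Longrightarrow> norm (z s) \<le> M) \<Longrightarrow> norm ((dq h ^^ k) z t) \<le> (2 / h) ^ k * M"
proof (induction k arbitrary: t)
  case (Suc k)
  have a: "norm ((dq h ^^ k) z t) \<le> (2 / h) ^ k * M" "norm ((dq h ^^ k) z (t + h)) \<le> (2 / h) ^ k * M"
    by (rule Suc.IH, rule Suc.prems; use assms in \<open>auto simp: algebra_simps\<close>)+
  have "norm ((dq h ^^ Suc k) z t) \<le> (1 / h) * (norm ((dq h ^^ k) z (t + h)) + norm ((dq h ^^ k) z t))"
    using assms by (simp add: dq_def divide_right_mono norm_triangle_ineq4 del: times_divide_eq_left)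
  also have "\<dots> \<le> (1 / h) * ((2 / h) ^ k * M + (2 / h) ^ k * M)"
    using assms by (intro mult_left_mono add_mono a) auto
  also have "\<dots> = (2 / h) ^ Suc k * M" by (simp add: algebra_simps)
  finally show ?case .
qed simp

lemma DERIV_power_over_fact:
  "((\<lambda>t::real. t ^ Suc m / fact (Suc m)) has_real_derivative (t ^ m / fact m)) (at t within S)"
proof -
  have "((\<lambda>t::real. t ^ Suc m) has_real_derivative (real (Suc m) * t ^ m)) (at t within S)"
    by (rule derivative_eq_intros refl | simp)+
  from DERIV_cdivide[OF this, of "fact (Suc m)"] show ?thesis
    by (simp del: of_nat_Suc)
qed

text \<open>The Taylor polynomial built from the chain \<open>X\<close> solves the equation up to
  the source \<open>(t ^ k / fact k) *\<^sub>R X (Suc k)\<close>. By dissipativity the difference to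
  the orbit grows at most like the time integral of the norm of that source.\<close>

lemma orbit_taylor:
  assumes A: "subspace A" "dissipative A" and x: "orbit A x y"
    and X: "x 0 = X 0" "\<And>j. j \<le> k \<Longrightarrow> (X j, X (Suc j)) \<in> A" and t: "t \<ge> 0"
  shows "norm (x t - (\<Sum>j\<le>k. (t ^ j / fact j) *\<^sub>R X j)) \<le> t ^ Suc k / fact (Suc k) * norm (X (Suc k))"
proof -
  define P where "P m t = (\<Sum>j\<le>m. (t ^ j / fact j) *\<^sub>R X j)" for m and t :: real
  define Q where "Q m t = (\<Sum>j\<le>m. (t ^ j / fact j) *\<^sub>R X (Suc j))" for m and t :: real
  \<comment> \<open>\<open>Q\<close> is what the generator assigns to \<open>P\<close>. The
    derivative of \<open>P\<close> lacks the last term of \<open>Q\<close>, and this defect is the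
    source.\<close>
  have dP: "(P m has_vector_derivative (Q m t - (t ^ m / fact m) *\<^sub>R X (Suc m))) (at t within {0..})" for m and t
  proof (induction m)
    case 0
    then show ?case by (simp add: P_def[abs_def] Q_def)
  next
    case (Suc m)
    have d: "((\<lambda>t. t ^ Suc m / fact (Suc m)) has_real_derivative (t ^ m / fact m)) (at t within {0..})"
      by (rule DERIV_power_over_fact)
    have "((\<lambda>t. P m t + (t ^ Suc m / fact (Suc m)) *\<^sub>R X (Suc m)) has_vector_derivative
       (Q m t - (t ^ m / fact m) *\<^sub>R X (Suc m)) + (t ^ m / fact m) *\<^sub>R X (Suc m)) (at t within {0..})"
      using has_vector_derivative_add[OF Suc.IH has_vector_derivative_scaleR[OF d has_vector_derivative_const[of "X (Suc m)"]]]
      by simp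
    then show ?case by (simp add: P_def[abs_def] Q_def)
  qed
  have mem: "(P k t, Q k t) \<in> A" for t
  proof -
    have "(\<Sum>j\<le>k. (t ^ j / fact j) *\<^sub>R (X j, X (Suc j))) \<in> A"
      using X by (intro subspace_sum[OF A(1)] subspace_scale[OF A(1)]) auto
    moreover have "(\<Sum>j\<le>m. (t ^ j / fact j) *\<^sub>R (X j, X (Suc j))) = (P m t, Q m t)" for m
      by (induction m) (auto simp: P_def Q_def)
    ultimately show ?thesis by simp
  qed
  define N where "N = norm (X (Suc k))"
  have "norm (x t - P k t) \<le> norm (x 0 - P k 0) + (t ^ Suc k / fact (Suc k) * N - 0 ^ Suc k / fact (Suc k) * N)"
  proof (rule dissipative_growth_bound[OF _ _ _ _ order_refl t])
    fix s :: real assume s: "s \<ge> 0"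
    show "((\<lambda>s. x s - P k s) has_vector_derivative (y s - (Q k s - (s ^ k / fact k) *\<^sub>R X (Suc k)))) (at s within {0..})"
      by (intro has_vector_derivative_diff dP orbit_derivative[OF x s])
    show "((\<lambda>s. s ^ Suc k / fact (Suc k) * N) has_real_derivative (s ^ k / fact k * N)) (at s within {0..})"
      by (rule DERIV_cmult_right[OF DERIV_power_over_fact])
    show "0 \<le> s ^ k / fact k * N" using s by (simp add: N_def)
    have "(x s, y s) - (P k s, Q k s) \<in> A"
      by (intro subspace_diff A mem orbit_mem[OF x s])
    then have "inner (x s - P k s) (y s - Q k s) \<le> 0" using A(2) by (auto simp: dissipative_def)
    moreover have "inner (x s - P k s) ((s ^ k / fact k) *\<^sub>R X (Suc k)) \<le> norm (x s - P k s) * norm ((s ^ k / fact k) *\<^sub>R X (Suc k))"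
      by (rule norm_cauchy_schwarz)
    ultimately show "inner (x s - P k s) (y s - (Q k s - (s ^ k / fact k) *\<^sub>R X (Suc k))) \<le> s ^ k / fact k * N * norm (x s - P k s)"
      using s by (simp add: inner_diff_right inner_add_right N_def ac_simps)
  qed
  moreover have "P k 0 = X 0"
  proof -
    have "P m 0 = X 0" for m by (induction m) (auto simp: P_def)
    then show ?thesis by simp
  qed
  ultimately show ?thesis using X(1) by (simp add: P_def N_def)
qed

text \<open>Subtracting the Taylor polynomial of degree \<open>k - 1\<close> does not change the
  \<open>k\<close>-th quotient. The remainder is at most
  \<open>(k * h) ^ k / fact k * norm (X k)\<close> on the interval used, which balances the factor
  \<open>(2 / h) ^ k\<close>; hence a bound independent of \<open>h\<close>.\<close>

lemma orbit_dq_funpow_bound: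
  assumes A: "subspace A" "dissipative A" and x: "orbit A x y"
    and X: "x 0 = X 0" "\<And>j. j < k \<Longrightarrow> (X j, X (Suc j)) \<in> A" and h: "h > 0"
  shows "norm ((dq h ^^ k) x 0) \<le> (2 ^ k * real k ^ k / fact k) * norm (X k)"
proof (cases k)
  case 0
  then show ?thesis using X by simp
next
  case (Suc m)
  define P where "P t = (\<Sum>j\<le>m. (t ^ j / fact j) *\<^sub>R X j)" for t :: real
  have "poly_below k P"
    unfolding P_def using poly_below_sum[of "{..m}" "\<lambda>j. j" k "\<lambda>j. (1 / fact j) *\<^sub>R X j"] Suc by simp
  then have "(dq h ^^ k) P = (\<lambda>_. 0)" using h by (intro poly_below_dq_funpow) auto
  then have "(dq h ^^ k) x 0 = (dq h ^^ k) (\<lambda>t. x t - P t) 0" by (simp add: dq_funpow_diff)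
  also have "norm \<dots> \<le> (2 / h) ^ k * ((real k * h) ^ k / fact k * norm (X k))"
  proof (rule dq_funpow_norm_le[OF h])
    fix s :: real assume s: "0 \<le> s" "s \<le> 0 + real k * h"
    have "norm (x s - P s) \<le> s ^ k / fact k * norm (X k)"
      using orbit_taylor[OF A x, of X m s] Suc X s unfolding P_def by (simp del: fact_Suc of_nat_Suc)
    also have "\<dots> \<le> (real k * h) ^ k / fact k * norm (X k)"
      using s by (intro mult_right_mono divide_right_mono power_mono) auto
    finally show "norm (x s - P s) \<le> (real k * h) ^ k / fact k * norm (X k)" .
  qed
  finally show ?thesis using h by (simp add: power_mult_distrib power_divide)
qed

text \<open>One half of the time pays for one quotient through \<open>one\<close>, the other half
  for the remaining \<open>k\<close> through the induction hypothesis, applied to the orbit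
  restarted at \<open>T / 2\<close>. All steps are powers of 1/2, so that of any two the larger is
  an integer multiple of the smaller.\<close>

lemma orbit_decay_iterate:
  assumes A: "subspace A" "dissipative A" and C: "C \<ge> 0"
    and one: "\<And>x y T. orbit A x y \<Longrightarrow> T > 0 \<Longrightarrow> norm (x T) \<le> C * T powr (-1/2) * norm (y 0)"
  shows "\<exists>D\<ge>0. \<forall>x y T B. orbit A x y \<longrightarrow> T > 0 \<longrightarrow> (\<forall>n. norm ((dq ((1/2) ^ n) ^^ k) x 0) \<le> B)
           \<longrightarrow> norm (x T) \<le> D * T powr (- (real k / 2)) * B"
proof (induction k)
  case 0
  show ?case
  proof (intro exI[of _ 1] conjI allI impI)
    fix x y and T B :: real
    assume "orbit A x y" "T > 0" "\<forall>n. norm ((dq ((1/2) ^ n) ^^ 0) x 0) \<le> B"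
    then show "norm (x T) \<le> 1 * T powr (- (real 0 / 2)) * B"
      using orbit_norm_mono[of A x y 0 T] A by simp
  qed simp
next
  case (Suc k)
  then obtain D where D: "D \<ge> 0" and IH: "\<And>x y T B. orbit A x y \<Longrightarrow> T > 0 \<Longrightarrow>
      (\<And>n. norm ((dq ((1/2) ^ n) ^^ k) x 0) \<le> B) \<Longrightarrow> norm (x T) \<le> D * T powr (- (real k / 2)) * B"
    by meson
  \<comment> \<open>The power of 1/2 in the constant comes from using \<open>T / 2\<close> in both
    factors.\<close>
  show ?case
  proof (intro exI[of _ "D * C * (1/2) powr (- (real (Suc k) / 2))"] conjI allI impI)
    show "0 \<le> D * C * (1/2) powr (- (real (Suc k) / 2))" using D C by simp
    fix x y and T B :: real
    assume x: "orbit A x y" and T: "T > 0" and B: "\<forall>n. norm ((dq ((1/2) ^ n) ^^ Suc k) x 0) \<le> B"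
    define h where "h n = (1/2 :: real) ^ n" for n :: nat
    have hpos: "h n > 0" for n by (simp add: h_def)
    have h0: "h \<longlonglongrightarrow> 0" unfolding h_def[abs_def] by (rule LIMSEQ_power_zero) simp
    have "norm ((dq (h n) ^^ k) x (T / 2)) \<le> C * (T/2) powr (-1/2) * B" for n
    proof -
      let ?z = "(dq (h n) ^^ k) x" and ?w = "(dq (h n) ^^ k) y"
      have z: "orbit A ?z ?w" using hpos[of n] by (intro orbit_dq_funpow A x) simp
      have "(?z has_vector_derivative ?w 0) (at 0 within {0..})"
        by (rule orbit_derivative[OF z]) simp
      then have "((\<lambda>s. (1 / s) *\<^sub>R (?z s - ?z 0)) \<longlongrightarrow> ?w 0) (at 0 within {0..})"
        by (simp add: has_vector_derivative_tendsto)
      then have "(\<lambda>m. (1 / h m) *\<^sub>R (?z (h m) - ?z 0)) \<longlonglongrightarrow> ?w 0"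
        using h0 hpos by (auto simp: tendsto_at_iff_sequentially o_def less_imp_le less_imp_neq[symmetric])
      then have lim: "(\<lambda>m. norm (dq (h m) ?z 0)) \<longlonglongrightarrow> norm (?w 0)"
        by (intro tendsto_norm) (simp add: dq_def)
      \<comment> \<open>The velocity at time 0 is the limit of quotients with step
        \<open>h m\<close>. For \<open>m \<ge> n\<close> the \<open>k\<close> other steps are
        refined from \<open>h n\<close> to \<open>h m\<close>, and then the hypothesis on
        \<open>B\<close> applies.\<close>
      have "norm (?w 0) \<le> B"
      proof (rule Lim_bounded[OF lim])
        show "\<forall>m\<ge>n. norm (dq (h m) ?z 0) \<le> B"
        proof (intro allI impI)
          fix m assume m: "m \<ge> n"
          have hn: "h n = real (2 ^ (m - n)) * h m"
            using m by (simp add: h_def power_one_over field_simps power_add[symmetric])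
          have "dq (h m) ?z 0 = (dq (h n) ^^ k) (dq (h m) x) 0" by (simp add: dq_funpow_commute)
          also have "norm \<dots> \<le> norm ((dq (h m) ^^ k) (dq (h m) x) 0)"
            unfolding hn using hpos[of m]
            by (intro orbit_dq_funpow_multiple_le[OF A _ _ _ orbit_dq[OF A(1) x]]) auto
          also have "\<dots> = norm ((dq (h m) ^^ Suc k) x 0)" by (simp add: dq_funpow_commute)
          also have "\<dots> \<le> B" using B by (simp add: h_def)
          finally show "norm (dq (h m) ?z 0) \<le> B" .
        qed
      qed
      then show ?thesis
        using one[OF z, of "T/2"] T C by (smt (verit) half_gt_zero mult_left_mono mult_nonneg_nonneg powr_ge_zero)
    qed
    moreover have "(dq (h n) ^^ k) x (0 + s) = (dq (h n) ^^ k) (\<lambda>t. x (t + s)) 0" for n s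
    proof -
      have "(dq g ^^ k) x (t + s) = (dq g ^^ k) (\<lambda>t. x (t + s)) t" for g t
      proof (induction k arbitrary: t)
        case (Suc k)
        show ?case using Suc[of "t + g"] Suc[of t] by (simp add: dq_def add_ac)
      qed simp
      then show ?thesis by blast
    qed
    ultimately have "norm ((dq ((1/2) ^ n) ^^ k) (\<lambda>t. x (t + T/2)) 0) \<le> C * (T/2) powr (-1/2) * B" for n
      by (metis add_0 h_def)
    then have "norm (x (T/2 + T/2)) \<le> D * (T/2) powr (- (real k / 2)) * (C * (T/2) powr (-1/2) * B)"
      using T by (intro IH[OF orbit_shift[OF x, of "T/2"]]) auto
    also have "\<dots> = D * C * (T/2) powr (- (real (Suc k) / 2)) * B"
      using T by (simp add: powr_add[symmetric] add_divide_distrib ac_simps)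
    also have "\<dots> = D * C * (1/2) powr (- (real (Suc k) / 2)) * T powr (- (real (Suc k) / 2)) * B"
      using T powr_mult[of "1/2" T "- (real (Suc k) / 2)"] by simp
    finally show "norm (x T) \<le> D * C * (1/2) powr (- (real (Suc k) / 2)) * T powr (- (real (Suc k) / 2)) * B"
      by simp
  qed
qed

text \<open>The chain \<open>X\<close> expresses that the initial value lies in the domain of the
  \<open>k\<close>-th power of the generator, with image \<open>X k\<close>. Only the initial value
  is constrained in this way.\<close>

theorem orbit_decay:
  assumes A: "subspace A" "dissipative A" and C: "C \<ge> 0"
    and one: "\<And>x y T. orbit A x y \<Longrightarrow> T > 0 \<Longrightarrow> norm (x T) \<le> C * T powr (-1/2) * norm (y 0)"
  shows "\<exists>D\<ge>0. \<forall>x y X T. orbit A x y \<longrightarrow> x 0 = X 0 \<longrightarrow> (\<forall>j<k. (X j, X (Suc j)) \<in> A) \<longrightarrow> T > 0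
           \<longrightarrow> norm (x T) \<le> D * T powr (- (real k / 2)) * norm (X k)"
proof -
  have "\<exists>D\<ge>0. \<forall>x y T B. orbit A x y \<longrightarrow> T > 0 \<longrightarrow> (\<forall>n. norm ((dq ((1/2) ^ n) ^^ k) x 0) \<le> B)
           \<longrightarrow> norm (x T) \<le> D * T powr (- (real k / 2)) * B"
    by (rule orbit_decay_iterate[OF A C]) (rule one)
  then obtain D where D: "D \<ge> 0" and dec: "\<forall>x y T B. orbit A x y \<longrightarrow> T > 0 \<longrightarrow>
      (\<forall>n. norm ((dq ((1/2) ^ n) ^^ k) x 0) \<le> B) \<longrightarrow> norm (x T) \<le> D * T powr (- (real k / 2)) * B"
    by (elim exE conjE)
  define M where "M = (2 ^ k * real k ^ k / fact k :: real)"
  show ?thesis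
  proof (intro exI[of _ "D * M"] conjI allI impI)
    show "D * M \<ge> 0" using D by (simp add: M_def)
    fix x y X and T :: real
    assume x: "orbit A x y" "x 0 = X 0" "\<forall>j<k. (X j, X (Suc j)) \<in> A" "T > 0"
    have "\<forall>n. norm ((dq ((1/2) ^ n) ^^ k) x 0) \<le> M * norm (X k)"
      unfolding M_def using x by (intro allI orbit_dq_funpow_bound[OF A x(1)]) auto
    then have "norm (x T) \<le> D * T powr (- (real k / 2)) * (M * norm (X k))"
      using dec x(1,4) by blast
    then show "norm (x T) \<le> D * M * T powr (- (real k / 2)) * norm (X k)"
      by (simp add: ac_simps)
  qed
qed

section \<open>The Hilbert space of square integrable functions\<close>

text \<open>All functions live on the whole space, and functions on the domain are extended by zero,
  so that translations and multiplications act on one fixed space.\<close>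

definition sqi :: "('a::euclidean_space \<Rightarrow> complex) \<Rightarrow> bool" where
  "sqi f \<longleftrightarrow> f \<in> borel_measurable lebesgue \<and> integrable lebesgue (\<lambda>x. (cmod (f x))\<^sup>2)"

lemma sqi_measurable [measurable_dest]: "sqi f \<Longrightarrow> f \<in> borel_measurable lebesgue"
  by (simp add: sqi_def)

lemma sqi_integrable_norm2: "sqi f \<Longrightarrow> integrable lebesgue (\<lambda>x. (cmod (f x))\<^sup>2)"
  by (simp add: sqi_def)

lemma sqi_dominated:
  assumes "f \<in> borel_measurable lebesgue" "integrable lebesgue g" "\<And>x. (cmod (f x))\<^sup>2 \<le> g x"
  shows "sqi f"
  unfolding sqi_def
proof (intro conjI assms(1))
  have [measurable]: "f \<in> borel_measurable lebesgue" by (rule assms)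
  show "integrable lebesgue (\<lambda>x. (cmod (f x))\<^sup>2)"
  proof (rule Bochner_Integration.integrable_bound[OF assms(2)])
    show "AE x in lebesgue. norm ((cmod (f x))\<^sup>2) \<le> norm (g x)"
      using assms(3) by (intro AE_I2) (smt (verit) norm_ge_zero real_norm_def zero_le_power2)
  qed measurable
qed

lemma sqi_0 [simp]: "sqi (\<lambda>_. 0)"
  by (simp add: sqi_def)

lemma sqi_add:
  assumes "sqi f" "sqi g"
  shows "sqi (\<lambda>x. f x + g x)"
proof (rule sqi_dominated)
  show "integrable lebesgue (\<lambda>x. 2 * (cmod (f x))\<^sup>2 + 2 * (cmod (g x))\<^sup>2)"
    using assms by (auto simp: sqi_def)
  show "(cmod (f x + g x))\<^sup>2 \<le> 2 * (cmod (f x))\<^sup>2 + 2 * (cmod (g x))\<^sup>2" for x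
  proof -
    have "(cmod (f x + g x))\<^sup>2 \<le> (cmod (f x) + cmod (g x))\<^sup>2"
      by (simp add: norm_triangle_ineq power_mono)
    also have "\<dots> \<le> 2 * (cmod (f x))\<^sup>2 + 2 * (cmod (g x))\<^sup>2"
      using zero_le_power2[of "cmod (f x) - cmod (g x)"] by (simp add: power2_eq_square algebra_simps)
    finally show ?thesis .
  qed
qed (use assms in \<open>measurable\<close>)

lemma sqi_mult_bounded:
  assumes "sqi f" "m \<in> borel_measurable lebesgue" "\<And>x. cmod (m x) \<le> B"
  shows "sqi (\<lambda>x. m x * f x)"
proof (rule sqi_dominated)
  show "integrable lebesgue (\<lambda>x. B\<^sup>2 * (cmod (f x))\<^sup>2)"
    using assms by (auto simp: sqi_def)
  show "(cmod (m x * f x))\<^sup>2 \<le> B\<^sup>2 * (cmod (f x))\<^sup>2" for x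
    using assms(3)[of x] by (simp add: norm_mult power_mult_distrib mult_right_mono power_mono)
qed (use assms in \<open>measurable\<close>)

lemma sqi_cmult: "sqi f \<Longrightarrow> sqi (\<lambda>x. c * f x)"
  by (rule sqi_mult_bounded[where B="cmod c"]) auto

lemma sqi_scaleR: "sqi f \<Longrightarrow> sqi (\<lambda>x. c *\<^sub>R f x)"
  using sqi_cmult[of f "of_real c"] by (simp add: scaleR_conv_of_real)

lemma sqi_minus: "sqi f \<Longrightarrow> sqi (\<lambda>x. - f x)"
  using sqi_cmult[of f "-1"] by simp

lemma sqi_diff: "sqi f \<Longrightarrow> sqi g \<Longrightarrow> sqi (\<lambda>x. f x - g x)"
  using sqi_add[of f "\<lambda>x. - g x"] sqi_minus[of g] by simp

lemma sqi_integrable_mult: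
  assumes "sqi f" "sqi g"
  shows "integrable lebesgue (\<lambda>x. f x * g x)"
proof (rule Bochner_Integration.integrable_bound)
  show "integrable lebesgue (\<lambda>x. (cmod (f x))\<^sup>2 + (cmod (g x))\<^sup>2)"
    using assms by (auto simp: sqi_def)
  show "AE x in lebesgue. norm (f x * g x) \<le> norm ((cmod (f x))\<^sup>2 + (cmod (g x))\<^sup>2)"
  proof (rule AE_I2)
    fix x
    have "2 * (cmod (f x) * cmod (g x)) \<le> (cmod (f x))\<^sup>2 + (cmod (g x))\<^sup>2"
      using zero_le_power2[of "cmod (f x) - cmod (g x)"] by (simp add: power2_eq_square algebra_simps)
    moreover have "0 \<le> cmod (f x) * cmod (g x)" by simp
    ultimately have "cmod (f x) * cmod (g x) \<le> (cmod (f x))\<^sup>2 + (cmod (g x))\<^sup>2" by linarith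
    then show "norm (f x * g x) \<le> norm ((cmod (f x))\<^sup>2 + (cmod (g x))\<^sup>2)"
      by (simp add: norm_mult)
  qed
qed (use assms in \<open>measurable\<close>)

lemma sqi_cnj: "sqi f \<Longrightarrow> sqi (\<lambda>x. cnj (f x))"
  by (auto simp: sqi_def intro!: borel_measurable_continuous_on[OF continuous_on_cnj])

lemma inner_eq_Re_mult_cnj: "inner (z::complex) w = Re (z * cnj w)"
  by (simp add: inner_complex_def)

lemma sqi_integrable_inner:
  assumes "sqi f" "sqi g"
  shows "integrable lebesgue (\<lambda>x. inner (f x) (g x))"
  unfolding inner_eq_Re_mult_cnj
  by (intro integrable_Re sqi_integrable_mult assms sqi_cnj)

\<comment> \<open>A partial quotient, because only square integrable functions have a class. Scalars
  are real and the inner product is the real part of the Hermitian one, which is what energies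
  involve; factors such as \<open>- \<i>\<close> act on representatives.\<close>
quotient_type (overloaded) 'a l2 = "'a::euclidean_space \<Rightarrow> complex" / partial:
  "\<lambda>f g. sqi f \<and> sqi g \<and> (AE x in lebesgue. f x = g x)"
proof (rule part_equivpI)
  show "\<exists>f. sqi f \<and> sqi f \<and> (AE x in lebesgue. f x = f x)" by (intro exI[of _ "\<lambda>_. 0"]) simp
  show "symp (\<lambda>f g. sqi f \<and> sqi g \<and> (AE x in lebesgue. f x = g x))"
    by (auto intro!: sympI elim: eventually_mono)
  show "transp (\<lambda>f g. sqi f \<and> sqi g \<and> (AE x in lebesgue. f x = g x))"
    by (rule transpI) (auto elim!: eventually_elim2)
qed

lemma sqi_rep [simp, measurable_dest]: "sqi (rep_l2 v)"
  using Quotient3_rep_reflp[OF Quotient3_l2] by blast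

lemma abs_rep_l2 [simp]: "abs_l2 (rep_l2 v) = v"
  by (rule Quotient3_abs_rep[OF Quotient3_l2])

lemma abs_l2_eq_iff: "sqi f \<Longrightarrow> sqi g \<Longrightarrow> abs_l2 f = abs_l2 g \<longleftrightarrow> (AE x in lebesgue. f x = g x)"
  using Quotient3_rel[OF Quotient3_l2, of f g] by simp

lemma rep_abs_l2: "sqi f \<Longrightarrow> AE x in lebesgue. rep_l2 (abs_l2 f) x = f x"
  using abs_l2_eq_iff[of "rep_l2 (abs_l2 f)" f] by simp

lemma rep_l2_measurable [measurable]: "rep_l2 v \<in> borel_measurable lebesgue"
  by (simp add: sqi_measurable)

instantiation l2 :: (euclidean_space) real_inner
begin

definition "0 = abs_l2 (\<lambda>_. 0)"
definition "v + w = abs_l2 (\<lambda>x. rep_l2 v x + rep_l2 w x)"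
definition "v - w = abs_l2 (\<lambda>x. rep_l2 v x - rep_l2 w x)"
definition "- v = abs_l2 (\<lambda>x. - rep_l2 v x)"
definition "c *\<^sub>R v = abs_l2 (\<lambda>x. c *\<^sub>R rep_l2 v x)"
definition "inner v w = integral\<^sup>L lebesgue (\<lambda>x. inner (rep_l2 v x) (rep_l2 w x))"
definition norm_l2_def: "norm (v::'a l2) = sqrt (inner v v)"
definition dist_l2_def: "dist v (w::'a l2) = norm (v - w)"
definition sgn_l2_def: "sgn (v::'a l2) = inverse (norm v) *\<^sub>R v"
definition uniformity_l2_def:
  "(uniformity :: ('a l2 \<times> 'a l2) filter) = (INF e\<in>{0<..}. principal {(x, y). dist x y < e})"
definition open_l2_def:
  "open (U :: 'a l2 set) = (\<forall>x\<in>U. eventually (\<lambda>(x', y). x' = x \<longrightarrow> y \<in> U) uniformity)"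

instance
proof
  have eqI: "abs_l2 f = abs_l2 g" if "sqi f" "sqi g" "AE x in lebesgue. f x = g x" for f g :: "'a \<Rightarrow> complex"
    using that by (simp add: abs_l2_eq_iff)
  have ext: "v = w" if "AE x in lebesgue. rep_l2 v x = rep_l2 w x" for v w :: "'a l2"
    using eqI[OF sqi_rep sqi_rep that] by simp
  note sq = sqi_add sqi_diff sqi_minus sqi_scaleR
  fix u v w :: "'a l2" and r s :: real
  have rp: "AE x in lebesgue. rep_l2 (v + w) x = rep_l2 v x + rep_l2 w x"
     "AE x in lebesgue. rep_l2 (v - w) x = rep_l2 v x - rep_l2 w x"
     "AE x in lebesgue. rep_l2 (- v) x = - rep_l2 v x"
     "AE x in lebesgue. rep_l2 (r *\<^sub>R v) x = r *\<^sub>R rep_l2 v x"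
     "AE x in lebesgue. rep_l2 (0::'a l2) x = 0" for v w :: "'a l2" and r
    unfolding plus_l2_def minus_l2_def uminus_l2_def scaleR_l2_def zero_l2_def
    by (rule rep_abs_l2; simp add: sq)+
  show "u + v + w = u + (v + w)"
    by (rule ext) (use rp(1)[of "u + v" w] rp(1)[of u v] rp(1)[of u "v + w"] rp(1)[of v w] in eventually_elim, simp)
  show "v + w = w + v"
    by (rule ext) (use rp(1)[of v w] rp(1)[of w v] in eventually_elim, simp)
  show "0 + v = v"
    by (rule ext) (use rp(1)[of 0 v] rp(5) in eventually_elim, simp)
  show "- v + v = 0"
    by (rule ext) (use rp(1)[of "- v" v] rp(3)[of v] rp(5) in eventually_elim, simp)
  show "v - w = v + - w"
    by (rule ext) (use rp(1)[of v "- w"] rp(3)[of w] rp(2)[of v w] in eventually_elim, simp)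
  show "r *\<^sub>R (v + w) = r *\<^sub>R v + r *\<^sub>R w"
    by (rule ext) (use rp(4)[of r "v + w"] rp(1)[of v w] rp(1)[of "r *\<^sub>R v" "r *\<^sub>R w"] rp(4)[of r v] rp(4)[of r w]
      in eventually_elim, simp add: algebra_simps)
  show "(r + s) *\<^sub>R v = r *\<^sub>R v + s *\<^sub>R v"
    by (rule ext) (use rp(4)[of "r + s" v] rp(1)[of "r *\<^sub>R v" "s *\<^sub>R v"] rp(4)[of r v] rp(4)[of s v]
      in eventually_elim, simp add: algebra_simps)
  show "r *\<^sub>R s *\<^sub>R v = (r * s) *\<^sub>R v"
    by (rule ext) (use rp(4)[of "r * s" v] rp(4)[of r "s *\<^sub>R v"] rp(4)[of s v]
      in eventually_elim, simp add: algebra_simps)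
  show "1 *\<^sub>R v = v"
    by (rule ext) (use rp(4)[of 1 v] in eventually_elim, simp)
  show "dist v w = norm (v - w)" by (rule dist_l2_def)
  show "sgn v = inverse (norm v) *\<^sub>R v" by (rule sgn_l2_def)
  show "(uniformity :: ('a l2 \<times> 'a l2) filter) = (INF e\<in>{0<..}. principal {(x, y). dist x y < e})"
    by (rule uniformity_l2_def)
  show "open U \<longleftrightarrow> (\<forall>x\<in>U. eventually (\<lambda>(x', y). x' = x \<longrightarrow> y \<in> U) uniformity)" for U :: "'a l2 set"
    by (rule open_l2_def)
  show "inner v w = inner w v" by (simp add: inner_l2_def inner_commute)
  show "inner (u + v) w = inner u w + inner v w"
  proof -
    have "inner (u + v) w = (\<integral>x. inner (rep_l2 u x) (rep_l2 w x) + inner (rep_l2 v x) (rep_l2 w x) \<partial>lebesgue)"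
      unfolding inner_l2_def
    proof (rule integral_cong_AE)
      show "AE x in lebesgue. inner (rep_l2 (u + v) x) (rep_l2 w x) = inner (rep_l2 u x) (rep_l2 w x) + inner (rep_l2 v x) (rep_l2 w x)"
        using rp(1)[of u v] by eventually_elim (simp add: inner_add_left)
    qed measurable
    then show ?thesis by (simp add: inner_l2_def sqi_integrable_inner)
  qed
  show "inner (r *\<^sub>R v) w = r * inner v w"
  proof -
    have "inner (r *\<^sub>R v) w = (\<integral>x. r * inner (rep_l2 v x) (rep_l2 w x) \<partial>lebesgue)"
      unfolding inner_l2_def
    proof (rule integral_cong_AE)
      show "AE x in lebesgue. inner (rep_l2 (r *\<^sub>R v) x) (rep_l2 w x) = r * inner (rep_l2 v x) (rep_l2 w x)"
        using rp(4)[of r v] by eventually_elim simp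
    qed measurable
    then show ?thesis by (simp add: inner_l2_def)
  qed
  show "0 \<le> inner v v" by (simp add: inner_l2_def)
  show "inner v v = 0 \<longleftrightarrow> v = 0"
  proof
    assume "inner v v = 0"
    then have "AE x in lebesgue. inner (rep_l2 v x) (rep_l2 v x) = 0"
      unfolding inner_l2_def
      by (subst (asm) integral_nonneg_eq_0_iff_AE) (auto intro!: sqi_integrable_inner)
    with rp(5) have "AE x in lebesgue. rep_l2 v x = rep_l2 0 x"
      by eventually_elim simp
    then show "v = 0" by (rule ext)
  next
    assume v: "v = 0"
    have "inner v v = integral\<^sup>L lebesgue (\<lambda>x::'a. 0::real)"
      unfolding inner_l2_def
    proof (rule integral_cong_AE)
      show "AE x in lebesgue. inner (rep_l2 v x) (rep_l2 v x) = 0"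
        using rp(5) unfolding v by eventually_elim simp
    qed measurable
    then show "inner v v = 0" by simp
  qed
  show "norm v = sqrt (inner v v)" by (rule norm_l2_def)
qed

end

lemma abs_l2_add:
  assumes "sqi f" "sqi g"
  shows "abs_l2 (\<lambda>x. f x + g x) = abs_l2 f + abs_l2 g"
  unfolding plus_l2_def
proof (rule abs_l2_eq_iff[THEN iffD2])
  show "AE x in lebesgue. f x + g x = rep_l2 (abs_l2 f) x + rep_l2 (abs_l2 g) x"
    using rep_abs_l2[OF assms(1)] rep_abs_l2[OF assms(2)] by eventually_elim simp
qed (auto intro!: sqi_add assms)

lemma abs_l2_diff:
  assumes "sqi f" "sqi g"
  shows "abs_l2 (\<lambda>x. f x - g x) = abs_l2 f - abs_l2 g"
  unfolding minus_l2_def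
proof (rule abs_l2_eq_iff[THEN iffD2])
  show "AE x in lebesgue. f x - g x = rep_l2 (abs_l2 f) x - rep_l2 (abs_l2 g) x"
    using rep_abs_l2[OF assms(1)] rep_abs_l2[OF assms(2)] by eventually_elim simp
qed (auto intro!: sqi_diff assms)

lemma abs_l2_scaleR:
  assumes "sqi f"
  shows "abs_l2 (\<lambda>x. c *\<^sub>R f x) = c *\<^sub>R abs_l2 f"
  unfolding scaleR_l2_def
proof (rule abs_l2_eq_iff[THEN iffD2])
  show "AE x in lebesgue. c *\<^sub>R f x = c *\<^sub>R rep_l2 (abs_l2 f) x"
    using rep_abs_l2[OF assms] by eventually_elim simp
qed (auto intro!: sqi_scaleR assms)

lemma inner_abs_l2:
  assumes "sqi f" "sqi g"
  shows "inner (abs_l2 f) (abs_l2 g) = (\<integral>x. inner (f x) (g x) \<partial>lebesgue)"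
  unfolding inner_l2_def
proof (rule integral_cong_AE)
  show "AE x in lebesgue. inner (rep_l2 (abs_l2 f) x) (rep_l2 (abs_l2 g) x) = inner (f x) (g x)"
    using rep_abs_l2[OF assms(1)] rep_abs_l2[OF assms(2)] by eventually_elim simp
qed (use assms in measurable)

lemma norm_abs_l2_power2: "sqi f \<Longrightarrow> (norm (abs_l2 f))\<^sup>2 = (\<integral>x. (cmod (f x))\<^sup>2 \<partial>lebesgue)"
  by (simp only: power2_norm_eq_inner inner_abs_l2)

lemma norm_abs_l2: "sqi f \<Longrightarrow> norm (abs_l2 f) = sqrt (\<integral>x. (cmod (f x))\<^sup>2 \<partial>lebesgue)"
  by (metis norm_abs_l2_power2 norm_ge_zero real_sqrt_unique)

section \<open>Multiplication by bounded measurable functions\<close>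

definition bm :: "('a::euclidean_space \<Rightarrow> real) \<Rightarrow> bool" where
  "bm m \<longleftrightarrow> m \<in> borel_measurable lebesgue \<and> bounded (range m)"

definition mul :: "('a::euclidean_space \<Rightarrow> real) \<Rightarrow> 'a l2 \<Rightarrow> 'a l2" where
  "mul m v = abs_l2 (\<lambda>x. m x *\<^sub>R rep_l2 v x)"

lemma bm_measurable [measurable_dest]: "bm m \<Longrightarrow> m \<in> borel_measurable lebesgue"
  by (simp add: bm_def)

lemma bmE:
  assumes "bm m"
  obtains B where "B > 0" "\<And>x. \<bar>m x\<bar> \<le> B"
  using assms by (auto simp: bm_def bounded_pos)

lemma sqi_mul:
  assumes m: "bm m" and f: "sqi f"
  shows "sqi (\<lambda>x. m x *\<^sub>R f x)"
proof -
  obtain B where B: "\<And>x. \<bar>m x\<bar> \<le> B" using m by (metis bmE)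
  have [measurable]: "m \<in> borel_measurable lebesgue" by (rule bm_measurable[OF m])
  show ?thesis unfolding scaleR_conv_of_real
    by (rule sqi_mult_bounded[OF f, of _ B]) (use B in auto)
qed

lemma mul_abs_l2:
  assumes m: "bm m" and f: "sqi f"
  shows "mul m (abs_l2 f) = abs_l2 (\<lambda>x. m x *\<^sub>R f x)"
  unfolding mul_def
proof (rule abs_l2_eq_iff[THEN iffD2])
  show "AE x in lebesgue. m x *\<^sub>R rep_l2 (abs_l2 f) x = m x *\<^sub>R f x"
    using rep_abs_l2[OF f] by eventually_elim simp
qed (auto intro!: sqi_mul assms)

lemma l2_cases: obtains f where "sqi f" "v = abs_l2 f"
  using that[of "rep_l2 v"] by simp

lemma mul_add: "bm m \<Longrightarrow> mul m (v + w) = mul m v + mul m w"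
  by (cases v rule: l2_cases; cases w rule: l2_cases)
     (simp add: mul_abs_l2 abs_l2_add[symmetric] sqi_add sqi_mul scaleR_add_right)

lemma mul_scaleR: "bm m \<Longrightarrow> mul m (c *\<^sub>R v) = c *\<^sub>R mul m v"
  by (cases v rule: l2_cases)
     (simp add: mul_abs_l2 abs_l2_scaleR[symmetric] sqi_scaleR sqi_mul ac_simps)

lemma norm_mul_le:
  assumes "bm m" "\<And>x. \<bar>m x\<bar> \<le> B"
  shows "norm (mul m v) \<le> B * norm v"
proof (cases v rule: l2_cases)
  fix f assume f: "sqi f" "v = abs_l2 f"
  have B: "B \<ge> 0" using assms(2)[of undefined] by linarith
  have "(norm (mul m v))\<^sup>2 \<le> (\<integral>x. B\<^sup>2 * (cmod (f x))\<^sup>2 \<partial>lebesgue)"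
    unfolding f(2) mul_abs_l2[OF assms(1) f(1)] norm_abs_l2_power2[OF sqi_mul[OF assms(1) f(1)]]
  proof (rule integral_mono)
    show "(cmod (m x *\<^sub>R f x))\<^sup>2 \<le> B\<^sup>2 * (cmod (f x))\<^sup>2" for x
      using assms(2)[of x] by (auto simp: power_mult_distrib intro!: mult_right_mono abs_le_square_iff[THEN iffD1])
  qed (use f assms sqi_mul in \<open>auto simp: sqi_def\<close>)
  also have "\<dots> = (B * norm v)\<^sup>2"
    by (simp add: f norm_abs_l2_power2 power_mult_distrib)
  finally show ?thesis by (rule power2_le_imp_le) (simp add: B)
qed

lemma bounded_linear_mul:
  assumes m: "bm m"
  shows "bounded_linear (mul m)"
proof -
  obtain B where B: "\<And>x. \<bar>m x\<bar> \<le> B" using m by (metis bmE)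
  show ?thesis
  proof (rule bounded_linear_intro)
    show "norm (mul m v) \<le> norm v * B" for v
      using norm_mul_le[OF m B] by (simp add: mult.commute)
  qed (simp_all add: m mul_add mul_scaleR)
qed

lemma inner_mul: "bm m \<Longrightarrow> inner (mul m v) w = inner v (mul m w)"
  by (cases v rule: l2_cases; cases w rule: l2_cases)
     (simp add: mul_abs_l2 inner_abs_l2 sqi_mul)

lemma bm_const [simp]: "bm (\<lambda>_. c)"
  by (simp add: bm_def)

lemma bm_add: "bm m \<Longrightarrow> bm n \<Longrightarrow> bm (\<lambda>x. m x + n x)"
  unfolding bm_def using bounded_plus_comp[of m UNIV n] by auto

lemma bm_mult:
  assumes "bm m" "bm n"
  shows "bm (\<lambda>x. m x * n x)"
proof -
  obtain B D where "\<And>x. \<bar>m x\<bar> \<le> B" "\<And>x. \<bar>n x\<bar> \<le> D" using assms by (metis bmE)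
  then have "\<bar>m x * n x\<bar> \<le> B * D" for x
    by (simp add: abs_mult) (meson abs_ge_zero mult_mono order_trans)
  then show ?thesis using assms by (auto simp: bm_def bounded_iff)
qed

lemma mul_mul: "bm m \<Longrightarrow> bm n \<Longrightarrow> mul m (mul n v) = mul (\<lambda>x. m x * n x) v"
  by (cases v rule: l2_cases) (simp add: mul_abs_l2 sqi_mul bm_mult)

section \<open>Translations and test functions\<close>

lemma translation_measurable: "(\<lambda>x. x + z) \<in> lebesgue \<rightarrow>\<^sub>M (lebesgue :: 'a::euclidean_space measure)"
  and distr_lebesgue_translation: "distr lebesgue lebesgue (\<lambda>x. x + z) = (lebesgue :: 'a::euclidean_space measure)"
proof -
  \<comment> \<open>A translation is the affine map with all scaling factors equal to 1, hence
    preserves Lebesgue measure.\<close>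
  have T: "(\<lambda>x. z + (\<Sum>j\<in>Basis. (1 * (x \<bullet> j)) *\<^sub>R j)) = (\<lambda>x. x + z)"
    by (simp add: euclidean_representation add.commute)
  show "(\<lambda>x. x + z) \<in> lebesgue \<rightarrow>\<^sub>M (lebesgue :: 'a measure)"
    using lebesgue_affine_measurable[of "\<lambda>_. 1" z] unfolding T by simp
  show "distr lebesgue lebesgue (\<lambda>x. x + z) = (lebesgue :: 'a measure)"
    using lebesgue_affine_euclidean[of "\<lambda>_. 1" z] unfolding T by (simp add: density_1)
qed

lemma sqi_translate:
  assumes "sqi f"
  shows "sqi (\<lambda>x. f (x + z))"
  unfolding sqi_def
proof (intro conjI)
  show "(\<lambda>x. f (x + z)) \<in> borel_measurable lebesgue"
    by (rule measurable_compose[OF translation_measurable sqi_measurable[OF assms]])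
  have "integrable (distr lebesgue lebesgue (\<lambda>x. x + z)) (\<lambda>x. (cmod (f x))\<^sup>2)"
    unfolding distr_lebesgue_translation by (rule sqi_integrable_norm2[OF assms])
  then show "integrable lebesgue (\<lambda>x. (cmod (f (x + z)))\<^sup>2)"
    by (rule integrable_distr[OF translation_measurable])
qed

definition tr :: "'a::euclidean_space \<Rightarrow> 'a l2 \<Rightarrow> 'a l2" where
  "tr z v = abs_l2 (\<lambda>x. rep_l2 v (x + z))"

lemma tr_abs_l2:
  assumes "sqi f"
  shows "tr z (abs_l2 f) = abs_l2 (\<lambda>x. f (x + z))"
  unfolding tr_def
proof (rule abs_l2_eq_iff[THEN iffD2])
  have "AE x in distr lebesgue lebesgue (\<lambda>x. x + z). rep_l2 (abs_l2 f) x = f x"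
    unfolding distr_lebesgue_translation by (rule rep_abs_l2[OF assms])
  then show "AE x in lebesgue. rep_l2 (abs_l2 f) (x + z) = f (x + z)"
    by (rule AE_distrD[OF translation_measurable])
qed (auto intro!: sqi_translate assms)

lemma tr_add: "tr z (v + w) = tr z v + tr z w"
  by (cases v rule: l2_cases; cases w rule: l2_cases)
     (simp add: tr_abs_l2 abs_l2_add[symmetric] sqi_add sqi_translate)

lemma tr_scaleR: "tr z (c *\<^sub>R v) = c *\<^sub>R tr z v"
  by (cases v rule: l2_cases) (simp add: tr_abs_l2 abs_l2_scaleR[symmetric] sqi_scaleR sqi_translate)

lemma tr_tr: "tr z (tr y v) = tr (z + y) v"
  by (cases v rule: l2_cases) (simp add: tr_abs_l2 sqi_translate add.assoc add.commute[of z y])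

lemma tr_0 [simp]: "tr 0 v = v"
  by (cases v rule: l2_cases) (simp add: tr_abs_l2)

lemma inner_tr_tr: "inner (tr z v) (tr z w) = inner v w"
proof (cases v rule: l2_cases; cases w rule: l2_cases)
  fix f g assume fg: "sqi f" "v = abs_l2 f" "sqi g" "w = abs_l2 g"
  have "(\<integral>x. inner (f x) (g x) \<partial>lebesgue) = (\<integral>x. inner (f x) (g x) \<partial>distr lebesgue lebesgue (\<lambda>x. x + z))"
    by (simp only: distr_lebesgue_translation)
  also have "\<dots> = (\<integral>x. inner (f (x + z)) (g (x + z)) \<partial>lebesgue)"
    by (rule integral_distr[OF translation_measurable])
       (intro borel_measurable_inner sqi_measurable fg)
  finally show ?thesis
    by (simp add: fg tr_abs_l2 inner_abs_l2 sqi_translate)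
qed

lemma norm_tr [simp]: "norm (tr z v) = norm v"
  by (simp add: norm_eq_sqrt_inner inner_tr_tr)

lemma inner_tr: "inner (tr z v) w = inner v (tr (- z) w)"
  using inner_tr_tr[of z v "tr (- z) w"] by (simp add: tr_tr)

lemma bounded_linear_tr: "bounded_linear (tr z)"
  by (rule bounded_linear_intro[where K=1]) (simp_all add: tr_add tr_scaleR)

section \<open>Calculus of smooth functions\<close>

lemma Ck_continuous: "Ck k f \<Longrightarrow> continuous_on UNIV f"
  by (cases k) (auto simp: continuous_on_eq_continuous_within intro: differentiable_imp_continuous_within)

lemma Ck_lower: "Ck (Suc k) f \<Longrightarrow> Ck k f"
proof (induction k arbitrary: f)
  case 0
  then show ?case using Ck_continuous[OF 0] by simp
next
  case (Suc k)
  then show ?case using Suc.IH[of "pd f _"] by simp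
qed

text \<open>A function in a set of differentiable functions that is stable under \<open>pd\<close>
  can be differentiated any number of times. For smoothness proofs this replaces formulas for higher
  derivatives by one choice of \<open>S\<close>.\<close>

lemma smooth_coinduct:
  assumes "f \<in> S" and S: "\<And>f. f \<in> S \<Longrightarrow> (\<forall>x. f differentiable (at x)) \<and> (\<forall>b\<in>Basis. pd f b \<in> S)"
  shows "smooth_fun f"
  unfolding smooth_fun_def
proof
  fix k
  show "Ck k f" using assms(1)
  proof (induction k arbitrary: f)
    case 0
    then show ?case using S[OF 0] by (auto simp: continuous_on_eq_continuous_within intro: differentiable_imp_continuous_within)
  next
    case (Suc k)
    then show ?case using S[OF Suc.prems] by (simp add: Suc.IH)
  qed
qed

lemma smooth_differentiable: "smooth_fun f \<Longrightarrow> f differentiable (at x)"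
  by (metis Ck.simps(2) smooth_fun_def)

lemma smooth_pd: "smooth_fun f \<Longrightarrow> b \<in> Basis \<Longrightarrow> smooth_fun (pd f b)"
  unfolding smooth_fun_def by (metis Ck.simps(2))

lemma smooth_continuous: "smooth_fun f \<Longrightarrow> continuous_on UNIV f"
  using Ck_continuous by (auto simp: smooth_fun_def)

lemma smooth_has_derivative: "smooth_fun f \<Longrightarrow> (f has_derivative frechet_derivative f (at x)) (at x)"
  using smooth_differentiable frechet_derivative_works by blast

lemma pd_eqI: "(f has_derivative f') (at x) \<Longrightarrow> pd f b x = f' b"
  using frechet_derivative_at by (metis pd_def)

lemma smooth_pd_has_derivative:
  "smooth_fun f \<Longrightarrow> (f has_derivative (\<lambda>h. pd f h x)) (at x)"
  using smooth_has_derivative[of f x] by (simp add: pd_def)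

lemma pd_add: "f differentiable (at x) \<Longrightarrow> g differentiable (at x) \<Longrightarrow> pd (\<lambda>x. f x + g x) b x = pd f b x + pd g b x"
  unfolding frechet_derivative_works pd_def by (rule pd_eqI[OF has_derivative_add, unfolded pd_def])

lemma pd_mult:
  fixes f g :: "'a::euclidean_space \<Rightarrow> complex"
  assumes "f differentiable (at x)" "g differentiable (at x)"
  shows "pd (\<lambda>x. f x * g x) b x = pd f b x * g x + f x * pd g b x"
proof -
  have "((\<lambda>x. f x * g x) has_derivative (\<lambda>h. f x * frechet_derivative g (at x) h + frechet_derivative f (at x) h * g x)) (at x)"
    using assms unfolding frechet_derivative_works by (rule has_derivative_mult)
  from pd_eqI[OF this] show ?thesis by (simp add: pd_def add.commute)
qed

lemma pd_bounded_linear: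
  assumes "bounded_linear L" "f differentiable (at x)"
  shows "pd (\<lambda>x. L (f x)) b x = L (pd f b x)"
  using pd_eqI[OF bounded_linear.has_derivative[OF assms(1)]] assms(2)
  unfolding frechet_derivative_works pd_def by blast

lemma Ck_add: "Ck k f \<Longrightarrow> Ck k g \<Longrightarrow> Ck k (\<lambda>x. f x + g x)"
proof (induction k arbitrary: f g)
  case (Suc k)
  have "pd (\<lambda>x. f x + g x) b = (\<lambda>x. pd f b x + pd g b x)" for b
    using Suc.prems by (auto simp: pd_add)
  then show ?case using Suc by auto
qed (auto intro: continuous_on_add)

lemma smooth_add: "smooth_fun f \<Longrightarrow> smooth_fun g \<Longrightarrow> smooth_fun (\<lambda>x. f x + g x)"
  by (simp add: smooth_fun_def Ck_add)

lemma Ck_mult: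
  fixes f g :: "'a::euclidean_space \<Rightarrow> complex"
  shows "Ck k f \<Longrightarrow> Ck k g \<Longrightarrow> Ck k (\<lambda>x. f x * g x)"
proof (induction k arbitrary: f g)
  case (Suc k)
  have "Ck k (\<lambda>x. pd f b x * g x + f x * pd g b x)" if "b \<in> Basis" for b
    using Suc.prems Ck_lower[OF Suc.prems(1)] Ck_lower[OF Suc.prems(2)] that
    by (intro Ck_add Suc.IH) auto
  moreover have "pd (\<lambda>x. f x * g x) b = (\<lambda>x. pd f b x * g x + f x * pd g b x)" for b
    using Suc.prems by (auto simp: pd_mult)
  ultimately show ?case using Suc.prems by auto
qed (auto intro: continuous_on_mult)

lemma smooth_mult:
  fixes f g :: "'a::euclidean_space \<Rightarrow> complex"
  shows "smooth_fun f \<Longrightarrow> smooth_fun g \<Longrightarrow> smooth_fun (\<lambda>x. f x * g x)"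
  by (simp add: smooth_fun_def Ck_mult)

lemma smooth_bounded_linear:
  assumes "smooth_fun f" "bounded_linear L"
  shows "smooth_fun (\<lambda>x. L (f x))"
proof (rule smooth_coinduct[of _ "{\<lambda>x. L (f x) | f. smooth_fun f}"])
  fix h assume "h \<in> {\<lambda>x. L (f x) | f. smooth_fun f}"
  then obtain f where f: "smooth_fun f" "h = (\<lambda>x. L (f x))" by auto
  have "pd h b = (\<lambda>x. L (pd f b x))" for b
    unfolding f(2) by (rule ext, rule pd_bounded_linear[OF assms(2) smooth_differentiable[OF f(1)]])
  moreover have "h differentiable (at x)" for x
    unfolding f(2) using bounded_linear.has_derivative[OF assms(2) smooth_has_derivative[OF f(1)]] by (rule differentiableI)
  ultimately show "(\<forall>x. h differentiable (at x)) \<and> (\<forall>b\<in>Basis. pd h b \<in> {\<lambda>x. L (f x) | f. smooth_fun f})"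
    using smooth_pd[OF f(1)] by auto
qed (use assms in auto)

lemma pd_translate:
  assumes "smooth_fun f"
  shows "pd (\<lambda>x. f (x + z)) b x = pd f b (x + z)"
    and "(\<lambda>x. f (x + z)) differentiable (at x)"
proof -
  have "((\<lambda>x. f (x + z)) has_derivative (\<lambda>h. pd f h (x + z))) (at x)"
    using has_derivative_compose[OF has_derivative_add_const[OF has_derivative_ident] smooth_pd_has_derivative[OF assms, of "x + z"]]
    by simp
  then show "pd (\<lambda>x. f (x + z)) b x = pd f b (x + z)" "(\<lambda>x. f (x + z)) differentiable (at x)"
    by (auto intro: pd_eqI differentiableI)
qed

lemma smooth_translate:
  assumes "smooth_fun f"
  shows "smooth_fun (\<lambda>x. f (x + z))"
proof (rule smooth_coinduct[of _ "{\<lambda>x. f (x + z) | f. smooth_fun f}"])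
  fix h assume "h \<in> {\<lambda>x. f (x + z) | f. smooth_fun f}"
  then obtain f where f: "smooth_fun f" "h = (\<lambda>x. f (x + z))" by auto
  have "pd h b = (\<lambda>x. pd f b (x + z))" for b
    unfolding f(2) by (rule ext, rule pd_translate[OF f(1)])
  moreover have "h differentiable (at x)" for x
    unfolding f(2) by (rule pd_translate[OF f(1)])
  ultimately show "(\<forall>x. h differentiable (at x)) \<and> (\<forall>b\<in>Basis. pd h b \<in> {\<lambda>x. f (x + z) | f. smooth_fun f})"
    using smooth_pd[OF f(1)] by auto
qed (use assms in auto)

lemma smooth_const: "smooth_fun (\<lambda>_. c)"
proof (rule smooth_coinduct[of _ "range (\<lambda>c _. c)"])
  fix f :: "'a \<Rightarrow> 'b" assume f: "f \<in> range (\<lambda>c _. c)"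
  have "pd f b = (\<lambda>_. 0)" for b
    using f by (auto intro!: ext pd_eqI derivative_eq_intros)
  then show "(\<forall>x. f differentiable (at x)) \<and> (\<forall>b\<in>Basis. pd f b \<in> range (\<lambda>c _. c))"
    using f by auto
qed auto

text \<open>Weights in one variable. Boundedness of all derivatives makes multiplication by the
  weight and by each of its derivatives bounded on \<open>l2\<close>. The whole sequence
  \<open>D\<close> is demanded so that derivatives are nice by shifting it.\<close>

definition nice :: "(real \<Rightarrow> real) \<Rightarrow> bool" where
  "nice \<eta> \<longleftrightarrow> (\<exists>D. D 0 = \<eta> \<and> (\<forall>n x. (D n has_real_derivative D (Suc n) x) (at x)) \<and> (\<forall>n. bounded (range (D n))))"

lemma niceI:
  assumes "D 0 = \<eta>" "\<And>n x. (D n has_real_derivative D (Suc n) x) (at x)" "\<And>n. bounded (range (D n))"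
  shows "nice \<eta>"
  using assms unfolding nice_def by blast

lemma nice_deriv:
  assumes "nice \<eta>" "\<And>x. (\<eta> has_real_derivative \<eta>' x) (at x)"
  shows "nice \<eta>'"
proof -
  obtain D where D: "D 0 = \<eta>" "\<And>n x. (D n has_real_derivative D (Suc n) x) (at x)" "\<And>n. bounded (range (D n))"
    using assms(1) unfolding nice_def by blast
  have "D (Suc 0) = \<eta>'" using DERIV_unique[OF D(2)[of 0]] assms(2) by (auto simp: D(1))
  then show ?thesis using D by (intro niceI[of "\<lambda>n. D (Suc n)"]) auto
qed

lemma nice_derivE:
  assumes "nice \<eta>"
  obtains \<eta>' where "\<And>x. (\<eta> has_real_derivative \<eta>' x) (at x)" "nice \<eta>'"
  using assms nice_deriv[OF assms] unfolding nice_def by metis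

lemma nice_bounded: "nice \<eta> \<Longrightarrow> bounded (range \<eta>)"
  unfolding nice_def by metis

lemma nice_continuous: "nice \<eta> \<Longrightarrow> continuous_on UNIV \<eta>"
  by (meson DERIV_isCont continuous_at_imp_continuous_on nice_derivE)

lemma nice_lincomb:
  assumes "nice \<eta>" "nice \<theta>"
  shows "nice (\<lambda>x. c * \<eta> x + d * \<theta> x)"
proof -
  obtain D where D: "D 0 = \<eta>" "\<And>n x. (D n has_real_derivative D (Suc n) x) (at x)" "\<And>n. bounded (range (D n))"
    using assms(1) unfolding nice_def by blast
  obtain E where E: "E 0 = \<theta>" "\<And>n x. (E n has_real_derivative E (Suc n) x) (at x)" "\<And>n. bounded (range (E n))"
    using assms(2) unfolding nice_def by blast
  show ?thesis
  proof (rule niceI[of "\<lambda>n x. c * D n x + d * E n x"])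
    show "((\<lambda>x. c * D n x + d * E n x) has_real_derivative c * D (Suc n) x + d * E (Suc n) x) (at x)" for n x
      by (intro DERIV_add DERIV_cmult D E)
    show "bounded (range (\<lambda>x. c * D n x + d * E n x))" for n
    proof -
      obtain K L where "\<And>x. \<bar>D n x\<bar> \<le> K" "\<And>x. \<bar>E n x\<bar> \<le> L"
        using D(3)[of n] E(3)[of n] by (auto simp: bounded_iff)
      then have "\<bar>c * D n x + d * E n x\<bar> \<le> \<bar>c\<bar> * K + \<bar>d\<bar> * L" for x
        by (intro order_trans[OF abs_triangle_ineq] add_mono) (auto simp: abs_mult mult_left_mono)
      then show ?thesis by (auto simp: bounded_iff)
    qed
  qed (simp add: D E)
qed

lemma pd_lift:
  assumes "(\<eta> has_real_derivative \<eta>') (at (inner x e))"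
  shows "pd (\<lambda>x::'a::euclidean_space. c * complex_of_real (\<eta> (inner x e))) b x = c * complex_of_real (\<eta>' * inner b e)"
    and "(\<lambda>x::'a::euclidean_space. c * complex_of_real (\<eta> (inner x e))) differentiable (at x)"
proof -
  have "((\<lambda>x. \<eta> (inner x e)) has_derivative (\<lambda>h. \<eta>' * inner h e)) (at x)"
    using has_derivative_compose[OF has_derivative_inner_left[OF has_derivative_ident] assms[unfolded has_field_derivative_def]]
    by simp
  then have "((\<lambda>x. c * complex_of_real (\<eta> (inner x e))) has_derivative (\<lambda>h. c * complex_of_real (\<eta>' * inner h e))) (at x)"
    by (intro has_derivative_mult_right has_derivative_of_real)
  then show "pd (\<lambda>x. c * complex_of_real (\<eta> (inner x e))) b x = c * complex_of_real (\<eta>' * inner b e)"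
    "(\<lambda>x. c * complex_of_real (\<eta> (inner x e))) differentiable (at x)"
    by (rule pd_eqI, rule differentiableI)
qed

lemma smooth_lift:
  assumes "nice \<eta>"
  shows "smooth_fun (\<lambda>x::'a::euclidean_space. complex_of_real (\<eta> (inner x e)))"
\<comment> \<open>The factor \<open>c\<close> absorbs the number \<open>inner b e\<close> that every
  differentiation produces.\<close>
proof (rule smooth_coinduct[of _ "{\<lambda>x. c * complex_of_real (\<eta> (inner x e)) | c \<eta>. nice \<eta>}"])
  show "(\<lambda>x::'a. complex_of_real (\<eta> (inner x e))) \<in> {\<lambda>x. c * complex_of_real (\<eta> (inner x e)) | c \<eta>. nice \<eta>}"
    using assms by (auto intro!: exI[of _ 1] exI[of _ \<eta>])
  fix h assume "h \<in> {\<lambda>x::'a. c * complex_of_real (\<eta> (inner x e)) | c \<eta>. nice \<eta>}"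
  then obtain c \<theta> where h: "nice \<theta>" "h = (\<lambda>x. c * complex_of_real (\<theta> (inner x e)))" by auto
  obtain \<theta>' where \<theta>': "\<And>x. (\<theta> has_real_derivative \<theta>' x) (at x)" "nice \<theta>'" using nice_derivE[OF h(1)] by metis
  have "pd h b = (\<lambda>x. (c * inner b e) * complex_of_real (\<theta>' (inner x e)))" for b
    unfolding h(2) by (rule ext) (simp add: pd_lift(1)[OF \<theta>'(1)])
  moreover have "h differentiable (at x)" for x
    unfolding h(2) by (rule pd_lift(2)[OF \<theta>'(1)])
  ultimately show "(\<forall>x. h differentiable (at x)) \<and> (\<forall>b\<in>Basis. pd h b \<in> {\<lambda>x::'a. c * complex_of_real (\<eta> (inner x e)) | c \<eta>. nice \<eta>})"
    using \<theta>'(2) by blast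
qed

section \<open>Test functions and their translates\<close>

lemma test_smooth: "test_fun \<Omega> \<phi> \<Longrightarrow> smooth_fun \<phi>"
  by (simp add: test_fun_def)

lemma test_funI:
  assumes "smooth_fun \<phi>" "{x. \<phi> x \<noteq> 0} \<subseteq> closure {x. \<psi> x \<noteq> 0}" "test_fun \<Omega> \<psi>"
  shows "test_fun \<Omega> \<phi>"
proof -
  have "closure {x. \<phi> x \<noteq> 0} \<subseteq> closure {x. \<psi> x \<noteq> 0}"
    by (rule closure_minimal[OF assms(2)]) simp
  then show ?thesis using assms(1,3) unfolding test_fun_def
    by (meson bounded_subset closed_closure compact_eq_bounded_closed order_trans)
qed

lemma test_0: "test_fun \<Omega> (\<lambda>_. 0)"
  by (simp add: test_fun_def smooth_const)

lemma test_mult_left: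
  assumes "test_fun \<Omega> \<phi>" "smooth_fun f"
  shows "test_fun \<Omega> (\<lambda>x. f x * \<phi> x)"
proof (rule test_funI[OF smooth_mult[OF assms(2) test_smooth[OF assms(1)]] _ assms(1)])
  show "{x. f x * \<phi> x \<noteq> 0} \<subseteq> closure {x. \<phi> x \<noteq> 0}"
    by (rule order_trans[OF _ closure_subset]) auto
qed

lemma test_bounded_linear:
  assumes "test_fun \<Omega> \<phi>" "bounded_linear L"
  shows "test_fun \<Omega> (\<lambda>x. L (\<phi> x))"
proof (rule test_funI[OF smooth_bounded_linear[OF test_smooth[OF assms(1)] assms(2)] _ assms(1)])
  show "{x. L (\<phi> x) \<noteq> 0} \<subseteq> closure {x. \<phi> x \<noteq> 0}"
    by (rule order_trans[OF _ closure_subset]) (auto simp: linear_0 bounded_linear.linear[OF assms(2)])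
qed

lemma test_add:
  assumes "test_fun \<Omega> \<phi>" "test_fun \<Omega> \<psi>"
  shows "test_fun \<Omega> (\<lambda>x. \<phi> x + \<psi> x)"
proof -
  let ?K = "closure {x. \<phi> x \<noteq> 0} \<union> closure {x. \<psi> x \<noteq> 0}"
  have K: "compact ?K" "?K \<subseteq> \<Omega>" using assms by (auto simp: test_fun_def)
  have "{x. \<phi> x + \<psi> x \<noteq> 0} \<subseteq> ?K"
    using closure_subset[of "{x. \<phi> x \<noteq> 0}"] closure_subset[of "{x. \<psi> x \<noteq> 0}"] by fastforce
  then have "closure {x. \<phi> x + \<psi> x \<noteq> 0} \<subseteq> ?K"
    by (rule closure_minimal) (intro closed_Un closed_closure)
  moreover from this have "compact (closure {x. \<phi> x + \<psi> x \<noteq> 0})"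
    using bounded_subset[OF compact_imp_bounded[OF K(1)]] by (simp add: compact_eq_bounded_closed)
  ultimately show ?thesis using K assms smooth_add[of \<phi> \<psi>] unfolding test_fun_def by auto
qed

text \<open>Off the closed support the function is locally zero, hence its derivative vanishes
  there.\<close>

lemma test_pd:
  assumes "test_fun \<Omega> \<phi>" "b \<in> Basis"
  shows "test_fun \<Omega> (pd \<phi> b)"
proof (rule test_funI[OF smooth_pd[OF test_smooth[OF assms(1)] assms(2)] _ assms(1)])
  show "{x. pd \<phi> b x \<noteq> 0} \<subseteq> closure {x. \<phi> x \<noteq> 0}"
  proof (rule ccontr)
    assume "\<not> ?thesis"
    then obtain x where x: "pd \<phi> b x \<noteq> 0" "x \<in> - closure {x. \<phi> x \<noteq> 0}" by auto
    have "(\<phi> has_derivative (\<lambda>_. 0)) (at x)"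
    proof (rule has_derivative_transform_within_open[OF has_derivative_const[of 0] _ x(2)])
      show "0 = \<phi> y" if "y \<in> - closure {x. \<phi> x \<noteq> 0}" for y
        using that closure_subset[of "{x. \<phi> x \<noteq> 0}"] by auto
    qed auto
    then show False using x(1) pd_eqI by metis
  qed
qed

lemma test_translate:
  assumes "test_fun \<Omega> \<phi>" "(\<lambda>x. x + z) ` \<Omega> = \<Omega>"
  shows "test_fun \<Omega> (\<lambda>x. \<phi> (x + z))"
proof -
  have "{x. \<phi> (x + z) \<noteq> 0} = (\<lambda>x. - z + x) ` {x. \<phi> x \<noteq> 0}"
    by (auto simp: image_iff intro!: exI[of _ "_ + z"])
  then have c: "closure {x. \<phi> (x + z) \<noteq> 0} = (\<lambda>x. - z + x) ` closure {x. \<phi> x \<noteq> 0}"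
    by (simp only: closure_translation)
  have "(\<lambda>x. - z + x) ` \<Omega> = \<Omega>"
    using arg_cong[OF assms(2), of "\<lambda>A. (\<lambda>x. - z + x) ` A"] by (simp add: image_image)
  then show ?thesis
    using assms(1) compact_translation[of "closure {x. \<phi> x \<noteq> 0}" "- z"] image_mono[of "closure {x. \<phi> x \<noteq> 0}" \<Omega> "\<lambda>x. - z + x"]
    unfolding test_fun_def c by (simp add: smooth_translate)
qed

lemma compact_support_sqi:
  fixes f :: "'a::euclidean_space \<Rightarrow> complex"
  assumes "continuous_on UNIV f" "compact K" "\<And>x. x \<notin> K \<Longrightarrow> f x = 0"
  shows "sqi f"
proof -
  obtain B where B: "\<And>x. x \<in> K \<Longrightarrow> norm (f x) \<le> B"
    using compact_imp_bounded[OF compact_continuous_image[OF continuous_on_subset[OF assms(1)] assms(2)]]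
    by (auto simp: bounded_iff)
  show ?thesis
  proof (rule sqi_dominated)
    have "f \<in> borel_measurable borel" by (rule borel_measurable_continuous_onI[OF assms(1)])
    then show "f \<in> borel_measurable lebesgue" by (simp add: measurable_completion)
    show "integrable lebesgue (\<lambda>x. B\<^sup>2 * indicator K x :: real)"
      using assms(2) by (intro integrable_mult_right integrable_real_indicator) (use lmeasurable_compact[OF assms(2)] in \<open>auto simp: fmeasurable_def\<close>)
    show "(cmod (f x))\<^sup>2 \<le> B\<^sup>2 * indicator K x" for x
      using B[of x] assms(3)[of x] by (cases "x \<in> K") (auto intro: power_mono)
  qed
qed

lemma test_sqi: "test_fun \<Omega> \<phi> \<Longrightarrow> sqi \<phi>"
  by (rule compact_support_sqi[of _ "closure {x. \<phi> x \<noteq> 0}"])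
     (auto simp: test_fun_def intro: smooth_continuous closure_subset[THEN subsetD])

lemma vector_derivative_bound:
  fixes f :: "real \<Rightarrow> 'x::real_normed_vector"
  assumes "\<And>r. (f has_vector_derivative f' r) (at r)" "\<And>r. norm (f' r) \<le> B"
  shows "norm (f s - f t) \<le> B * \<bar>s - t\<bar>"
proof -
  have "norm (f s - f t) \<le> B * norm (s - t)"
  proof (rule differentiable_bound[of UNIV f "\<lambda>r h. h *\<^sub>R f' r"])
    show "onorm (\<lambda>h. h *\<^sub>R f' r) \<le> B" for r
      using assms(2)[of r] by (intro onorm_le) (simp add: mult.commute[of B] mult_left_mono)
  qed (use assms(1) in \<open>auto simp: has_vector_derivative_def\<close>)
  then show ?thesis by simp
qed

lemma test_line_derivative:
  assumes "smooth_fun \<phi>"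
  shows "((\<lambda>r. \<phi> (x + r *\<^sub>R b)) has_vector_derivative pd \<phi> b (x + r *\<^sub>R b)) (at r)"
proof -
  have "((\<lambda>r. x + r *\<^sub>R b) has_derivative (\<lambda>h. h *\<^sub>R b)) (at r)"
    by (auto intro!: derivative_eq_intros)
  from has_derivative_compose[OF this smooth_pd_has_derivative[OF assms]]
  have "((\<lambda>r. \<phi> (x + r *\<^sub>R b)) has_derivative (\<lambda>h. pd \<phi> (h *\<^sub>R b) (x + r *\<^sub>R b))) (at r)" .
  moreover have "pd \<phi> (h *\<^sub>R b) y = h *\<^sub>R pd \<phi> b y" for h y
    using linear_scale[OF has_derivative_linear[OF smooth_has_derivative[OF assms, of y]]] by (simp add: pd_def)
  ultimately show ?thesis by (simp add: has_vector_derivative_def)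
qed

lemma test_bounded_deriv:
  assumes "test_fun \<Omega> \<phi>" "b \<in> Basis"
  obtains M where "M \<ge> 0" "\<And>x. norm (pd \<phi> b x) \<le> M"
proof -
  let ?K = "closure {x. pd \<phi> b x \<noteq> 0}"
  have t: "test_fun \<Omega> (pd \<phi> b)" by (rule test_pd[OF assms])
  then have "compact (pd \<phi> b ` ?K)"
    by (intro compact_continuous_image continuous_on_subset[OF smooth_continuous[OF test_smooth[OF t]]])
       (auto simp: test_fun_def)
  then obtain M where M: "M > 0" "\<And>x. x \<in> ?K \<Longrightarrow> norm (pd \<phi> b x) \<le> M"
    by (auto simp: bounded_pos dest!: compact_imp_bounded)
  have "norm (pd \<phi> b x) \<le> M" for x
  proof (cases "pd \<phi> b x = 0")
    case False
    then show ?thesis using M(2)[of x] closure_subset[of "{x. pd \<phi> b x \<noteq> 0}"] by auto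
  qed (use M in simp)
  then show ?thesis using that[of M] M(1) by auto
qed

text \<open>For \<open>\<bar>s\<bar> \<le> 1\<close> the errors \<open>Q s\<close> vanish outside
  one fixed ball and are bounded by twice a bound of \<open>pd \<phi> b\<close>, so their pointwise
  convergence becomes convergence in \<open>l2\<close> by domination.\<close>

lemma test_diff_quotient:
  assumes \<phi>: "test_fun UNIV \<phi>" and b: "b \<in> Basis"
  shows "((\<lambda>s. (1 / s) *\<^sub>R (tr (s *\<^sub>R b) (abs_l2 \<phi>) - abs_l2 \<phi>)) \<longlongrightarrow> abs_l2 (pd \<phi> b)) (at 0)"
proof -
  note sm = test_smooth[OF \<phi>] and sq = test_sqi[OF \<phi>] and sqp = test_sqi[OF test_pd[OF \<phi> b]]
  define Q where "Q s x = (1 / s) *\<^sub>R (\<phi> (x + s *\<^sub>R b) - \<phi> x) - pd \<phi> b x" for s x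
  have sqQ: "sqi (Q s)" for s
    unfolding Q_def[abs_def] by (intro sqi_diff sqi_scaleR sqi_translate sq sqp)
  obtain M where M: "M \<ge> 0" "\<And>x. norm (pd \<phi> b x) \<le> M" using test_bounded_deriv[OF \<phi> b] by blast
  obtain R where R: "\<And>x. \<phi> x \<noteq> 0 \<Longrightarrow> norm x \<le> R"
  proof -
    have "bounded {x. \<phi> x \<noteq> 0}" using \<phi> unfolding test_fun_def by (meson bounded_subset closure_subset compact_imp_bounded)
    then show ?thesis using that by (auto simp: bounded_iff)
  qed
  have pt: "((\<lambda>s. Q s x) \<longlongrightarrow> 0) (at 0)" for x
    using test_line_derivative[OF sm, of x b 0] unfolding has_vector_derivative_tendsto Q_def
    by (simp add: LIM_zero)
  have Qb: "norm (Q s x) \<le> 2 * M" for s x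
  proof -
    have "norm (\<phi> (x + s *\<^sub>R b) - \<phi> (x + 0 *\<^sub>R b)) \<le> M * \<bar>s - 0\<bar>"
      by (rule vector_derivative_bound[OF test_line_derivative[OF sm] M(2)])
    then have "norm ((1 / s) *\<^sub>R (\<phi> (x + s *\<^sub>R b) - \<phi> x)) \<le> M"
      using M(1) by (cases "s = 0") (auto simp: divide_le_eq)
    then show ?thesis using M(2)[of x] norm_triangle_ineq4[of "(1 / s) *\<^sub>R (\<phi> (x + s *\<^sub>R b) - \<phi> x)" "pd \<phi> b x"]
      by (simp add: Q_def)
  qed
  have Q0: "Q s x = 0" if "\<bar>s\<bar> \<le> 1" "norm x > R + 1" for s x
  proof -
    have "norm x \<le> norm (x + s *\<^sub>R b) + norm (s *\<^sub>R b)"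
      by (metis add_diff_cancel_right' norm_triangle_ineq4)
    moreover have "norm (s *\<^sub>R b) \<le> 1" using that b by simp
    ultimately have "\<phi> (x + s *\<^sub>R b) = 0" "\<phi> x = 0" using R[of "x + s *\<^sub>R b"] R[of x] that by force+
    moreover have "pd \<phi> b x = 0"
    proof (rule pd_eqI[where f'="\<lambda>_. 0"])
      show "(\<phi> has_derivative (\<lambda>_. 0)) (at x)"
      proof (rule has_derivative_transform_within_open[OF has_derivative_const[of 0]])
        show "open (- cball 0 R)" by auto
        show "x \<in> - cball 0 R" using that by auto
        show "0 = \<phi> y" if "y \<in> - cball 0 R" for y using R[of y] that by auto
      qed
    qed
    ultimately show ?thesis by (simp add: Q_def)
  qed
  have "((\<lambda>s. (norm (abs_l2 (Q s)))\<^sup>2) \<longlongrightarrow> 0) (at 0 within {-1<..<1})"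
    unfolding tendsto_at_iff_sequentially
  proof (intro allI impI)
    fix X :: "nat \<Rightarrow> real" assume X: "\<forall>i. X i \<in> {-1<..<1} - {0}" "X \<longlonglongrightarrow> 0"
    have "(\<lambda>i. \<integral>x. (cmod (Q (X i) x))\<^sup>2 \<partial>lebesgue) \<longlonglongrightarrow> integral\<^sup>L lebesgue (\<lambda>x::'a. 0::real)"
    proof (rule integral_dominated_convergence)
      show "(\<lambda>x. (cmod (Q (X i) x))\<^sup>2) \<in> borel_measurable lebesgue" for i
        using sqi_integrable_norm2[OF sqQ] by auto
      show "integrable lebesgue (\<lambda>x::'a. (2 * M)\<^sup>2 * indicator (cball 0 (R + 1)) x :: real)"
        by (intro integrable_mult_right integrable_real_indicator)
           (use lmeasurable_compact[of "cball 0 (R + 1) :: 'a set"] in \<open>auto simp: fmeasurable_def\<close>)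
      show "AE x in lebesgue. norm ((cmod (Q (X i) x))\<^sup>2) \<le> (2 * M)\<^sup>2 * indicator (cball 0 (R + 1)) x" for i
      proof (rule AE_I2)
        fix x :: 'a
        show "norm ((cmod (Q (X i) x))\<^sup>2) \<le> (2 * M)\<^sup>2 * indicator (cball 0 (R + 1)) x"
        proof (cases "x \<in> cball 0 (R + 1)")
          case True
          then show ?thesis using power_mono[OF Qb, of "X i" x 2] by simp
        next
          case False
          moreover have "\<bar>X i\<bar> \<le> 1" using X(1)[rule_format, of i] by auto
          ultimately show ?thesis using Q0[of "X i" x] by simp
        qed
      qed
      show "AE x in lebesgue. (\<lambda>i. (cmod (Q (X i) x))\<^sup>2) \<longlonglongrightarrow> 0"
      proof (rule AE_I2)
        fix x :: 'a
        have "(\<lambda>i. Q (X i) x) \<longlonglongrightarrow> 0"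
          using pt[of x] X unfolding tendsto_at_iff_sequentially by (auto simp: o_def)
        then have "(\<lambda>i. (cmod (Q (X i) x))\<^sup>2) \<longlonglongrightarrow> (cmod 0)\<^sup>2" by (intro tendsto_intros)
        then show "(\<lambda>i. (cmod (Q (X i) x))\<^sup>2) \<longlonglongrightarrow> 0" by simp
      qed
    qed auto
    then show "((\<lambda>s. (norm (abs_l2 (Q s)))\<^sup>2) \<circ> X) \<longlonglongrightarrow> 0"
      by (simp add: o_def norm_abs_l2_power2 sqQ)
  qed
  then have "((\<lambda>s. (norm (abs_l2 (Q s)))\<^sup>2) \<longlongrightarrow> 0) (at 0)"
    by (subst (asm) at_within_open) auto
  then have "((\<lambda>s. sqrt ((norm (abs_l2 (Q s)))\<^sup>2)) \<longlongrightarrow> sqrt 0) (at 0)"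
    by (rule tendsto_real_sqrt)
  then have "((\<lambda>s. abs_l2 (Q s)) \<longlongrightarrow> 0) (at 0)"
    by (simp add: tendsto_norm_zero_iff)
  moreover have "abs_l2 (Q s) = (1 / s) *\<^sub>R (tr (s *\<^sub>R b) (abs_l2 \<phi>) - abs_l2 \<phi>) - abs_l2 (pd \<phi> b)" for s
    unfolding Q_def[abs_def]
    by (simp only: abs_l2_diff[OF sqi_scaleR[OF sqi_diff[OF sqi_translate[OF sq] sq]] sqp]
      abs_l2_scaleR[OF sqi_diff[OF sqi_translate[OF sq] sq]] abs_l2_diff[OF sqi_translate[OF sq] sq] tr_abs_l2[OF sq])
  ultimately show ?thesis by (simp add: LIM_zero_iff)
qed

lemma test_tr_derivative:
  assumes \<phi>: "test_fun UNIV \<phi>" and b: "b \<in> Basis"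
  shows "((\<lambda>r. tr (r *\<^sub>R b) (abs_l2 \<phi>)) has_vector_derivative tr (r *\<^sub>R b) (abs_l2 (pd \<phi> b))) (at r)"
proof -
  have "((\<lambda>s. tr (r *\<^sub>R b) ((1 / s) *\<^sub>R (tr (s *\<^sub>R b) (abs_l2 \<phi>) - abs_l2 \<phi>))) \<longlongrightarrow> tr (r *\<^sub>R b) (abs_l2 (pd \<phi> b))) (at 0)"
    by (rule bounded_linear.tendsto[OF bounded_linear_tr test_diff_quotient[OF assms]])
  then have "((\<lambda>s. (1 / s) *\<^sub>R (tr ((r + s) *\<^sub>R b) (abs_l2 \<phi>) - tr (r *\<^sub>R b) (abs_l2 \<phi>))) \<longlongrightarrow> tr (r *\<^sub>R b) (abs_l2 (pd \<phi> b))) (at 0)"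
    by (simp add: tr_scaleR linear_diff[OF bounded_linear.linear[OF bounded_linear_tr]] tr_tr scaleR_add_left)
  then show ?thesis
    unfolding has_vector_derivative_tendsto by (subst LIM_offset_zero_iff) simp_all
qed

text \<open>Translation is isometric, so the translates move with constant speed
  \<open>norm (abs_l2 (pd \<phi> b))\<close>. Being uniform in \<open>s\<close>, the bound survives
  limits of test functions, and then carries \<open>test_diff_quotient\<close> along.\<close>

lemma test_tr_bound:
  assumes \<phi>: "test_fun UNIV \<phi>" and b: "b \<in> Basis"
  shows "norm (tr (s *\<^sub>R b) (abs_l2 \<phi>) - abs_l2 \<phi>) \<le> \<bar>s\<bar> * norm (abs_l2 (pd \<phi> b))"
  using vector_derivative_bound[OF test_tr_derivative[OF assms], of "norm (abs_l2 (pd \<phi> b))" s 0]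
  by (simp add: mult.commute)

section \<open>The space of functions with square integrable gradient\<close>

text \<open>One component per basis vector; the value 0 elsewhere makes the inner product
  definite.\<close>

typedef (overloaded) 'a gl2 = "{f :: 'a::euclidean_space \<Rightarrow> 'a l2. \<forall>x. x \<notin> Basis \<longrightarrow> f x = 0}"
  morphisms gcomp gabs
  by (intro exI[of _ "\<lambda>_. 0"]) simp

setup_lifting type_definition_gl2

lemma gl2_eqI:
  assumes "\<And>b. b \<in> Basis \<Longrightarrow> gcomp G b = gcomp H b"
  shows "G = H"
proof -
  have "gcomp G b = gcomp H b" for b
    using assms[of b] gcomp[of G] gcomp[of H] by (cases "b \<in> Basis") auto
  then show ?thesis by (auto simp: gcomp_inject[symmetric])
qed

instantiation gl2 :: (euclidean_space) real_inner
begin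

lift_definition zero_gl2 :: "'a gl2" is "\<lambda>_. 0" by simp
lift_definition plus_gl2 :: "'a gl2 \<Rightarrow> 'a gl2 \<Rightarrow> 'a gl2" is "\<lambda>f g b. f b + g b" by simp
lift_definition minus_gl2 :: "'a gl2 \<Rightarrow> 'a gl2 \<Rightarrow> 'a gl2" is "\<lambda>f g b. f b - g b" by simp
lift_definition uminus_gl2 :: "'a gl2 \<Rightarrow> 'a gl2" is "\<lambda>f b. - f b" by simp
lift_definition scaleR_gl2 :: "real \<Rightarrow> 'a gl2 \<Rightarrow> 'a gl2" is "\<lambda>c f b. c *\<^sub>R f b" by simp
definition "inner G H = (\<Sum>b\<in>Basis. inner (gcomp G b) (gcomp H b))"
definition norm_gl2_def: "norm (G::'a gl2) = sqrt (inner G G)"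
definition dist_gl2_def: "dist G (H::'a gl2) = norm (G - H)"
definition sgn_gl2_def: "sgn (G::'a gl2) = inverse (norm G) *\<^sub>R G"
definition uniformity_gl2_def:
  "(uniformity :: ('a gl2 \<times> 'a gl2) filter) = (INF e\<in>{0<..}. principal {(x, y). dist x y < e})"
definition open_gl2_def:
  "open (U :: 'a gl2 set) = (\<forall>x\<in>U. eventually (\<lambda>(x', y). x' = x \<longrightarrow> y \<in> U) uniformity)"

instance
proof
  fix u v w :: "'a gl2" and r s :: real
  show "u + v + w = u + (v + w)" "v + w = w + v" "0 + v = v" "- v + v = 0" "v - w = v + - w"
    "r *\<^sub>R (v + w) = r *\<^sub>R v + r *\<^sub>R w" "(r + s) *\<^sub>R v = r *\<^sub>R v + s *\<^sub>R v"
    "r *\<^sub>R s *\<^sub>R v = (r * s) *\<^sub>R v" "1 *\<^sub>R v = v"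
    by (transfer; simp add: algebra_simps fun_eq_iff)+
  show "dist v w = norm (v - w)" by (rule dist_gl2_def)
  show "sgn v = inverse (norm v) *\<^sub>R v" by (rule sgn_gl2_def)
  show "(uniformity :: ('a gl2 \<times> 'a gl2) filter) = (INF e\<in>{0<..}. principal {(x, y). dist x y < e})"
    by (rule uniformity_gl2_def)
  show "open U \<longleftrightarrow> (\<forall>x\<in>U. eventually (\<lambda>(x', y). x' = x \<longrightarrow> y \<in> U) uniformity)" for U :: "'a gl2 set"
    by (rule open_gl2_def)
  show "inner v w = inner w v" by (simp add: inner_gl2_def inner_commute)
  show "inner (u + v) w = inner u w + inner v w"
    by (simp add: inner_gl2_def plus_gl2.rep_eq inner_add_left sum.distrib)
  show "inner (r *\<^sub>R v) w = r * inner v w"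
    by (simp add: inner_gl2_def scaleR_gl2.rep_eq sum_distrib_left)
  show "0 \<le> inner v v" by (simp add: inner_gl2_def sum_nonneg)
  show "inner v v = 0 \<longleftrightarrow> v = 0"
  proof
    assume "inner v v = 0"
    then show "v = 0"
      by (intro gl2_eqI) (simp add: inner_gl2_def sum_nonneg_eq_0_iff zero_gl2.rep_eq)
  qed (simp add: inner_gl2_def zero_gl2.rep_eq)
  show "norm v = sqrt (inner v v)" by (rule norm_gl2_def)
qed

end

lemmas gcomp_simps [simp] = zero_gl2.rep_eq plus_gl2.rep_eq minus_gl2.rep_eq uminus_gl2.rep_eq scaleR_gl2.rep_eq

lemma norm_gl2_power2: "(norm G)\<^sup>2 = (\<Sum>b\<in>Basis. (norm (gcomp G b))\<^sup>2)"
  by (simp only: power2_norm_eq_inner inner_gl2_def)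

lemma norm_gcomp_le: "norm (gcomp G b) \<le> norm G"
proof (cases "b \<in> Basis")
  case True
  then have "(norm (gcomp G b))\<^sup>2 \<le> (norm G)\<^sup>2"
    unfolding norm_gl2_power2 by (rule member_le_sum) auto
  then show ?thesis by (rule power2_le_imp_le) simp
qed (use gcomp[of G] in auto)

lemma bounded_linear_gcomp: "bounded_linear (\<lambda>G. gcomp G b)"
  by (rule bounded_linear_intro[where K=1]) (auto simp: norm_gcomp_le)

lemma norm_gl2_le_sum: "norm G \<le> (\<Sum>b\<in>Basis. norm (gcomp G b))"
proof -
  have "norm G = L2_set (\<lambda>b. norm (gcomp G b)) Basis"
    unfolding norm_gl2_def inner_gl2_def L2_set_def power2_norm_eq_inner ..
  then show ?thesis using L2_set_le_sum[of Basis "\<lambda>b. norm (gcomp G b)"] by simp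
qed

definition gmk :: "('a::euclidean_space \<Rightarrow> 'a l2) \<Rightarrow> 'a gl2" where
  "gmk f = gabs (\<lambda>b. if b \<in> Basis then f b else 0)"

lemma gcomp_gmk [simp]: "b \<in> Basis \<Longrightarrow> gcomp (gmk f) b = f b"
  by (simp add: gmk_def gabs_inverse)

lemma bounded_linear_gmk:
  fixes f :: "'x::real_normed_vector \<Rightarrow> 'a::euclidean_space \<Rightarrow> 'a l2"
  assumes f: "\<And>b. b \<in> Basis \<Longrightarrow> bounded_linear (\<lambda>x. f x b)"
  shows "bounded_linear (\<lambda>x. gmk (f x))"
proof (rule bounded_linear_intro)
  show "gmk (f (x + y)) = gmk (f x) + gmk (f y)" for x y
    by (rule gl2_eqI) (simp add: linear_add[OF bounded_linear.linear[OF f]])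
  show "gmk (f (r *\<^sub>R x)) = r *\<^sub>R gmk (f x)" for r x
    by (rule gl2_eqI) (simp add: linear_scale[OF bounded_linear.linear[OF f]])
  show "norm (gmk (f x)) \<le> norm x * (\<Sum>b\<in>Basis. onorm (\<lambda>x. f x b))" for x
  proof -
    have "norm (gmk (f x)) \<le> (\<Sum>b\<in>Basis. norm (f x b))"
      using norm_gl2_le_sum[of "gmk (f x)"] by simp
    also have "\<dots> \<le> (\<Sum>b\<in>Basis. onorm (\<lambda>x. f x b) * norm x)"
      by (intro sum_mono onorm f)
    finally show ?thesis by (simp add: sum_distrib_left mult.commute)
  qed
qed

section \<open>The Sobolev space with zero boundary values\<close>

definition grd :: "('a::euclidean_space \<Rightarrow> complex) \<Rightarrow> 'a gl2" where
  "grd \<phi> = gmk (\<lambda>b. abs_l2 (pd \<phi> b))"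

text \<open>Each element is paired with its gradient. In this form the space is a closed subspace of
  a product, and bounded linear operators need to be examined on test functions only.\<close>

definition H1 :: "'a::euclidean_space set \<Rightarrow> ('a l2 \<times> 'a gl2) set" where
  "H1 \<Omega> = closure ((\<lambda>\<phi>. (abs_l2 \<phi>, grd \<phi>)) ` {\<phi>. test_fun \<Omega> \<phi>})"

lemma H1_test: "test_fun \<Omega> \<phi> \<Longrightarrow> (abs_l2 \<phi>, grd \<phi>) \<in> H1 \<Omega>"
  unfolding H1_def by (rule closure_subset[THEN subsetD]) auto

lemma H1_closed_induct:
  assumes "closed {z. P z}" "\<And>\<phi>. test_fun \<Omega> \<phi> \<Longrightarrow> P (abs_l2 \<phi>, grd \<phi>)" "z \<in> H1 \<Omega>"
  shows "P z"
  using closure_minimal[OF _ assms(1), of "(\<lambda>\<phi>. (abs_l2 \<phi>, grd \<phi>)) ` {\<phi>. test_fun \<Omega> \<phi>}"] assms(2,3)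
  unfolding H1_def by blast

lemma closed_H1: "closed (H1 \<Omega>)"
  by (simp add: H1_def)

lemma H1_image:
  assumes "bounded_linear T" "\<And>\<phi>. test_fun \<Omega> \<phi> \<Longrightarrow> T (abs_l2 \<phi>, grd \<phi>) \<in> H1 \<Omega>'" "z \<in> H1 \<Omega>"
  shows "T z \<in> H1 \<Omega>'"
proof (rule H1_closed_induct[where P="\<lambda>z. T z \<in> H1 \<Omega>'", OF _ _ assms(3)])
  show "closed {z. T z \<in> H1 \<Omega>'}"
    using continuous_closed_vimage[OF closed_H1 linear_continuous_at[OF assms(1)]] by (simp add: vimage_def)
qed (rule assms(2))

lemma grd_add: "test_fun \<Omega> \<phi> \<Longrightarrow> test_fun \<Omega> \<psi> \<Longrightarrow> grd (\<lambda>x. \<phi> x + \<psi> x) = grd \<phi> + grd \<psi>"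
proof (rule gl2_eqI)
  fix b :: 'a assume t: "test_fun \<Omega> \<phi>" "test_fun \<Omega> \<psi>" and b: "b \<in> Basis"
  have "pd (\<lambda>x. \<phi> x + \<psi> x) b = (\<lambda>x. pd \<phi> b x + pd \<psi> b x)"
    using t by (auto simp: pd_add smooth_differentiable test_smooth)
  then show "gcomp (grd (\<lambda>x. \<phi> x + \<psi> x)) b = gcomp (grd \<phi> + grd \<psi>) b"
    using b t by (simp add: grd_def abs_l2_add[OF test_sqi[OF test_pd] test_sqi[OF test_pd]])
qed

lemma grd_scaleR: "test_fun \<Omega> \<phi> \<Longrightarrow> grd (\<lambda>x. c *\<^sub>R \<phi> x) = c *\<^sub>R grd \<phi>"
proof (rule gl2_eqI)
  fix b :: 'a assume t: "test_fun \<Omega> \<phi>" and b: "b \<in> Basis"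
  have "pd (\<lambda>x. c *\<^sub>R \<phi> x) b = (\<lambda>x. c *\<^sub>R pd \<phi> b x)"
    using t by (auto intro!: pd_bounded_linear bounded_linear_scaleR_right smooth_differentiable test_smooth)
  then show "gcomp (grd (\<lambda>x. c *\<^sub>R \<phi> x)) b = gcomp (c *\<^sub>R grd \<phi>) b"
    using b t by (simp add: grd_def abs_l2_scaleR[OF test_sqi[OF test_pd]])
qed

lemma subspace_closure:
  fixes S :: "'x::real_normed_vector set"
  assumes "subspace S"
  shows "subspace (closure S)"
  unfolding subspace_def
proof (intro conjI ballI allI)
  show "0 \<in> closure S" using subspace_0[OF assms] closure_subset by blast
  show "x + y \<in> closure S" if xy: "x \<in> closure S" "y \<in> closure S" for x y
  proof -
    obtain X Y where "\<forall>n. X n \<in> S" "X \<longlonglongrightarrow> x" "\<forall>n. Y n \<in> S" "Y \<longlonglongrightarrow> y"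
      using xy unfolding closure_sequential by blast
    then show ?thesis unfolding closure_sequential
      by (intro exI[of _ "\<lambda>n. X n + Y n"]) (auto intro: tendsto_add subspace_add[OF assms])
  qed
  show "c *\<^sub>R x \<in> closure S" if x: "x \<in> closure S" for c x
  proof -
    obtain X where "\<forall>n. X n \<in> S" "X \<longlonglongrightarrow> x" using x unfolding closure_sequential by blast
    then show ?thesis unfolding closure_sequential
      by (intro exI[of _ "\<lambda>n. c *\<^sub>R X n"]) (auto intro: tendsto_scaleR subspace_scale[OF assms])
  qed
qed

lemma subspace_H1: "subspace (H1 \<Omega>)"
  unfolding H1_def
proof (rule subspace_closure, unfold subspace_def, intro conjI ballI allI)
  let ?S = "(\<lambda>\<phi>. (abs_l2 \<phi>, grd \<phi>)) ` {\<phi>. test_fun \<Omega> \<phi>}"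
  have sc: "c *\<^sub>R x \<in> ?S" if x: "x \<in> ?S" for c x
  proof -
    obtain \<phi> where \<phi>: "test_fun \<Omega> \<phi>" "x = (abs_l2 \<phi>, grd \<phi>)" using x by blast
    have "c *\<^sub>R x = (abs_l2 (\<lambda>x. c *\<^sub>R \<phi> x), grd (\<lambda>x. c *\<^sub>R \<phi> x))"
      by (simp add: \<phi>(2) abs_l2_scaleR[OF test_sqi[OF \<phi>(1)]] grd_scaleR[OF \<phi>(1)])
    moreover have "test_fun \<Omega> (\<lambda>x. c *\<^sub>R \<phi> x)"
      by (rule test_bounded_linear[OF \<phi>(1) bounded_linear_scaleR_right])
    ultimately show ?thesis by blast
  qed
  then show "\<And>x c. x \<in> ?S \<Longrightarrow> c *\<^sub>R x \<in> ?S" .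
  show "0 \<in> ?S" using sc[of "(abs_l2 (\<lambda>_. 0), grd (\<lambda>_. 0))" 0] test_0 by (auto simp: zero_prod_def)
  show "x + y \<in> ?S" if xy: "x \<in> ?S" "y \<in> ?S" for x y
  proof -
    obtain \<phi> \<psi> where \<phi>: "test_fun \<Omega> \<phi>" "x = (abs_l2 \<phi>, grd \<phi>)" and \<psi>: "test_fun \<Omega> \<psi>" "y = (abs_l2 \<psi>, grd \<psi>)"
      using xy by blast
    have "x + y = (abs_l2 (\<lambda>x. \<phi> x + \<psi> x), grd (\<lambda>x. \<phi> x + \<psi> x))"
      by (simp add: \<phi>(2) \<psi>(2) abs_l2_add[OF test_sqi[OF \<phi>(1)] test_sqi[OF \<psi>(1)]] grd_add[OF \<phi>(1) \<psi>(1)])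
    then show ?thesis using test_add[OF \<phi>(1) \<psi>(1)] by blast
  qed
qed

lemma H1_mono: "\<Omega> \<subseteq> \<Omega>' \<Longrightarrow> H1 \<Omega> \<subseteq> H1 \<Omega>'"
  unfolding H1_def by (intro closure_mono image_mono) (force simp: test_fun_def)

abbreviation lf :: "(real \<Rightarrow> real) \<Rightarrow> 'a::euclidean_space \<Rightarrow> 'a \<Rightarrow> real" where
  "lf \<eta> e \<equiv> \<lambda>x. \<eta> (inner x e)"

lemma bm_lf: "nice \<eta> \<Longrightarrow> bm (lf \<eta> e)"
proof -
  assume n: "nice \<eta>"
  have "continuous_on UNIV (lf \<eta> e)"
    by (intro continuous_on_compose2[OF nice_continuous[OF n]] continuous_intros) auto
  then have "lf \<eta> e \<in> borel_measurable borel" by (rule borel_measurable_continuous_onI)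
  then show "bm (lf \<eta> e)"
    using nice_bounded[OF n] unfolding bm_def by (auto simp: measurable_completion bounded_iff)
qed

text \<open>The Leibniz rule. The weight depends on one coordinate, so only the component along
  \<open>e\<close> receives an extra term. The map is bounded and linear in \<open>(v, G)\<close>,
  so test functions suffice.\<close>

lemma H1_mul:
  assumes \<eta>: "nice \<eta>" "\<And>x. (\<eta> has_real_derivative \<eta>' x) (at x)" and e: "e \<in> Basis"
    and z: "(v, G) \<in> H1 \<Omega>"
  shows "(mul (lf \<eta> e) v, gmk (\<lambda>b. mul (lf \<eta> e) (gcomp G b) + (if b = e then mul (lf \<eta>' e) v else 0))) \<in> H1 \<Omega>"
proof -
  note bm = bm_lf[OF \<eta>(1), of e] and bm' = bm_lf[OF nice_deriv[OF \<eta>], of e]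
  define T where "T z = (mul (lf \<eta> e) (fst z), gmk (\<lambda>b. mul (lf \<eta> e) (gcomp (snd z) b) + (if b = e then mul (lf \<eta>' e) (fst z) else 0)))"
    for z :: "'a l2 \<times> 'a gl2"
  have "bounded_linear T"
    unfolding T_def
  proof (intro bounded_linear_Pair bounded_linear_gmk bounded_linear_add)
    show "bounded_linear (\<lambda>z. mul (lf \<eta> e) (fst z) :: 'a l2)"
      by (rule bounded_linear_compose[OF bounded_linear_mul[OF bm] bounded_linear_fst])
    show "bounded_linear (\<lambda>z. mul (lf \<eta> e) (gcomp (snd z) b))" for b :: 'a
      by (rule bounded_linear_compose[OF bounded_linear_mul[OF bm] bounded_linear_compose[OF bounded_linear_gcomp bounded_linear_snd]])
    show "bounded_linear (\<lambda>z. if b = e then mul (lf \<eta>' e) (fst z) else 0 :: 'a l2)" for b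
      using bounded_linear_compose[OF bounded_linear_mul[OF bm'] bounded_linear_fst] by (cases "b = e") auto
  qed
  moreover have "T (abs_l2 \<phi>, grd \<phi>) \<in> H1 \<Omega>" if \<phi>: "test_fun \<Omega> \<phi>" for \<phi>
  proof -
    let ?\<psi> = "\<lambda>x. complex_of_real (\<eta> (inner x e)) * \<phi> x"
    have t: "test_fun \<Omega> ?\<psi>" by (rule test_mult_left[OF \<phi> smooth_lift[OF \<eta>(1)]])
    have pd\<psi>: "pd ?\<psi> b = (\<lambda>x. \<eta> (inner x e) *\<^sub>R pd \<phi> b x + (if b = e then \<eta>' (inner x e) else 0) *\<^sub>R \<phi> x)" if b: "b \<in> Basis" for b
    proof
      fix x
      have "pd ?\<psi> b x = pd (\<lambda>x. 1 * complex_of_real (\<eta> (inner x e))) b x * \<phi> x + complex_of_real (\<eta> (inner x e)) * pd \<phi> b x"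
        using pd_mult[OF pd_lift(2)[OF \<eta>(2), where c=1] smooth_differentiable[OF test_smooth[OF \<phi>]]] by simp
      also have "pd (\<lambda>x. 1 * complex_of_real (\<eta> (inner x e))) b x = of_real (if b = e then \<eta>' (inner x e) else 0)"
        unfolding pd_lift(1)[OF \<eta>(2)] using b e by (simp add: inner_Basis)
      finally show "pd ?\<psi> b x = \<eta> (inner x e) *\<^sub>R pd \<phi> b x + (if b = e then \<eta>' (inner x e) else 0) *\<^sub>R \<phi> x"
        by (simp add: scaleR_conv_of_real)
    qed
    have pdb: "abs_l2 (pd ?\<psi> b) = mul (lf \<eta> e) (abs_l2 (pd \<phi> b)) + (if b = e then mul (lf \<eta>' e) (abs_l2 \<phi>) else 0)"
      if "b \<in> Basis" for b
    proof -
      note s = test_sqi[OF \<phi>] and s' = test_sqi[OF test_pd[OF \<phi> that]]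
      show ?thesis
      proof (cases "b = e")
        case True
        note s' = test_sqi[OF test_pd[OF \<phi> e]]
        from True show ?thesis unfolding pd\<psi>[OF that]
          by (simp add: mul_abs_l2[OF bm s'] mul_abs_l2[OF bm' s] abs_l2_add[OF sqi_mul[OF bm s'] sqi_mul[OF bm' s]])
      next
        case False
        then show ?thesis unfolding pd\<psi>[OF that] by (simp add: mul_abs_l2[OF bm s'])
      qed
    qed
    have "grd ?\<psi> = snd (T (abs_l2 \<phi>, grd \<phi>))"
      by (rule gl2_eqI) (simp add: grd_def T_def pdb)
    moreover have "abs_l2 ?\<psi> = fst (T (abs_l2 \<phi>, grd \<phi>))"
      by (simp add: T_def mul_abs_l2[OF bm test_sqi[OF \<phi>]] scaleR_conv_of_real)
    ultimately show ?thesis using H1_test[OF t] by (metis prod.collapse)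
  qed
  ultimately have "T (v, G) \<in> H1 \<Omega>" using z by (rule H1_image)
  then show ?thesis unfolding T_def fst_conv snd_conv .
qed

definition gtr :: "'a::euclidean_space \<Rightarrow> 'a gl2 \<Rightarrow> 'a gl2" where
  "gtr z G = gmk (\<lambda>b. tr z (gcomp G b))"

lemma H1_tr:
  assumes \<Omega>: "(\<lambda>x. x + z) ` \<Omega> = \<Omega>" and v: "(v, G) \<in> H1 \<Omega>"
  shows "(tr z v, gtr z G) \<in> H1 \<Omega>"
proof -
  define T where "T y = (tr z (fst y), gtr z (snd y))" for y :: "'a l2 \<times> 'a gl2"
  have "bounded_linear T"
    unfolding T_def gtr_def
    by (intro bounded_linear_Pair bounded_linear_gmk bounded_linear_compose[OF bounded_linear_tr]
       bounded_linear_fst bounded_linear_compose[OF bounded_linear_gcomp bounded_linear_snd])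
  moreover have "T (abs_l2 \<phi>, grd \<phi>) \<in> H1 \<Omega>" if \<phi>: "test_fun \<Omega> \<phi>" for \<phi>
  proof -
    have "pd (\<lambda>x. \<phi> (x + z)) b = (\<lambda>x. pd \<phi> b (x + z))" for b
      by (rule ext) (rule pd_translate(1)[OF test_smooth[OF \<phi>]])
    then have "grd (\<lambda>x. \<phi> (x + z)) = gtr z (grd \<phi>)"
      using \<phi> by (intro gl2_eqI) (simp add: grd_def gtr_def tr_abs_l2[OF test_sqi[OF test_pd]])
    then show ?thesis
      using H1_test[OF test_translate[OF \<phi> \<Omega>]] by (simp add: T_def tr_abs_l2[OF test_sqi[OF \<phi>]])
  qed
  ultimately have "T (v, G) \<in> H1 \<Omega>" using v by (rule H1_image)
  then show ?thesis by (simp add: T_def)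
qed

lemma H1_tr_bound:
  assumes "(v, G) \<in> H1 UNIV" "e \<in> Basis"
  shows "norm (tr (s *\<^sub>R e) v - v) \<le> \<bar>s\<bar> * norm (gcomp G e)"
proof -
  have "norm (tr (s *\<^sub>R e) (fst z) - fst z) \<le> \<bar>s\<bar> * norm (gcomp (snd z) e)" if z: "z \<in> H1 UNIV" for z
  proof (rule H1_closed_induct[OF _ _ z])
    show "closed {z. norm (tr (s *\<^sub>R e) (fst z) - fst z) \<le> \<bar>s\<bar> * norm (gcomp (snd z) e)}"
      by (intro closed_Collect_le continuous_intros bounded_linear.continuous_on[OF bounded_linear_tr]
          bounded_linear.continuous_on[OF bounded_linear_gcomp])
    show "norm (tr (s *\<^sub>R e) (fst (abs_l2 \<phi>, grd \<phi>)) - fst (abs_l2 \<phi>, grd \<phi>)) \<le> \<bar>s\<bar> * norm (gcomp (snd (abs_l2 \<phi>, grd \<phi>)) e)"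
      if "test_fun UNIV \<phi>" for \<phi>
      using test_tr_bound[OF that assms(2), of s] assms(2) by (simp add: grd_def)
  qed
  from this[OF assms(1)] show ?thesis by simp
qed

text \<open>Approximation by a test function leaves a remainder in \<open>H1\<close>, whose
  quotients are bounded by its gradient uniformly in \<open>s\<close>. Hence three errors of size
  \<open>\<epsilon> / 3\<close>.\<close>

lemma H1_diff_quotient:
  assumes v: "(v, G) \<in> H1 UNIV" and e: "e \<in> Basis"
  shows "((\<lambda>s. (1 / s) *\<^sub>R (tr (s *\<^sub>R e) v - v)) \<longlongrightarrow> gcomp G e) (at 0)"
proof (rule tendstoI)
  fix \<epsilon> :: real assume \<epsilon>: "\<epsilon> > 0"
  obtain \<phi> where \<phi>: "test_fun UNIV \<phi>" "dist (abs_l2 \<phi>, grd \<phi>) (v, G) < \<epsilon> / 3"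
    using v \<epsilon> unfolding H1_def closure_approachable by (metis (no_types, lifting) divide_pos_pos imageE mem_Collect_eq zero_less_numeral)
  have g: "norm (gcomp (grd \<phi> - G) e) < \<epsilon> / 3"
    using norm_gcomp_le[of "grd \<phi> - G" e] norm_snd_le[of "grd \<phi> - G" "abs_l2 \<phi> - v"] \<phi>(2)
    by (simp add: dist_norm) 
  have "\<forall>\<^sub>F s in at 0. dist ((1 / s) *\<^sub>R (tr (s *\<^sub>R e) (abs_l2 \<phi>) - abs_l2 \<phi>)) (abs_l2 (pd \<phi> e)) < \<epsilon> / 3"
    using \<epsilon> by (intro tendstoD[OF test_diff_quotient[OF \<phi>(1) e]]) simp
  moreover have "\<forall>\<^sub>F s in at (0::real). s \<noteq> 0" by (simp add: eventually_at_filter)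
  ultimately show "\<forall>\<^sub>F s in at 0. dist ((1 / s) *\<^sub>R (tr (s *\<^sub>R e) v - v)) (gcomp G e) < \<epsilon>"
  proof eventually_elim
    case (elim s)
    have "(abs_l2 \<phi> - v, grd \<phi> - G) \<in> H1 UNIV"
      using subspace_diff[OF subspace_H1 H1_test[OF \<phi>(1)] v] by simp
    from H1_tr_bound[OF this e, of s]
    have "norm ((1 / s) *\<^sub>R (tr (s *\<^sub>R e) (abs_l2 \<phi> - v) - (abs_l2 \<phi> - v))) \<le> norm (gcomp (grd \<phi> - G) e)"
      using elim by (simp add: divide_le_eq mult.commute)
    moreover have "(1 / s) *\<^sub>R (tr (s *\<^sub>R e) v - v) - gcomp G e =
        ((1 / s) *\<^sub>R (tr (s *\<^sub>R e) (abs_l2 \<phi>) - abs_l2 \<phi>) - abs_l2 (pd \<phi> e))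
        - (1 / s) *\<^sub>R (tr (s *\<^sub>R e) (abs_l2 \<phi> - v) - (abs_l2 \<phi> - v)) + gcomp (grd \<phi> - G) e"
      using e by (simp add: grd_def linear_diff[OF bounded_linear.linear[OF bounded_linear_tr]] scaleR_diff_right)
    ultimately have "norm ((1 / s) *\<^sub>R (tr (s *\<^sub>R e) v - v) - gcomp G e) < \<epsilon> / 3 + \<epsilon> / 3 + \<epsilon> / 3"
      using g elim(1) by (smt (verit) dist_norm norm_triangle_ineq norm_triangle_ineq4)
    then show ?case by (simp add: dist_norm)
  qed
qed

text \<open>The adjoint of a translation is the inverse translation, so a quotient of one factor
  moves to the other with the opposite step, and both sides converge.\<close>

lemma H1_parts:
  assumes u: "(u, U) \<in> H1 UNIV" and v: "(v, V) \<in> H1 UNIV" and e: "e \<in> Basis"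
  shows "inner (gcomp U e) v = - inner u (gcomp V e)"
proof -
  have a: "((\<lambda>s. inner ((1 / s) *\<^sub>R (tr (s *\<^sub>R e) u - u)) v) \<longlongrightarrow> inner (gcomp U e) v) (at 0)"
    by (intro tendsto_inner H1_diff_quotient[OF u e] tendsto_const)
  have eq: "inner ((1 / s) *\<^sub>R (tr (s *\<^sub>R e) u - u)) v = - inner u ((1 / (- s)) *\<^sub>R (tr ((- s) *\<^sub>R e) v - v))" for s
    by (simp add: inner_diff_left inner_diff_right inner_tr)
  have b: "((\<lambda>s. - inner u ((1 / (- s)) *\<^sub>R (tr ((- s) *\<^sub>R e) v - v))) \<longlongrightarrow> - inner u (gcomp V e)) (at 0)"
  proof (intro tendsto_minus tendsto_inner tendsto_const)
    have "filterlim uminus (at (0::real)) (at 0)"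
      by (rule filterlim_atI) (auto intro!: tendsto_eq_intros simp: eventually_at_filter)
    from filterlim_compose[OF H1_diff_quotient[OF v e] this]
    show "((\<lambda>s. (1 / (- s)) *\<^sub>R (tr ((- s) *\<^sub>R e) v - v)) \<longlongrightarrow> gcomp V e) (at 0)" .
  qed
  show ?thesis by (rule tendsto_unique[OF _ a[unfolded eq] b]) simp
qed

text \<open>Vanishing almost everywhere outside the domain, written as a closed linear condition so
  that it passes from test functions to \<open>H1\<close>.\<close>

definition suppd :: "'a::euclidean_space set \<Rightarrow> 'a l2 \<Rightarrow> bool" where
  "suppd \<Omega> v \<longleftrightarrow> mul (indicator \<Omega>) v = v"

lemma bm_indicator: "\<Omega> \<in> sets lebesgue \<Longrightarrow> bm (indicator \<Omega>)"
  unfolding bm_def by (auto simp: bounded_iff indicator_def intro!: exI[of _ 1])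

lemma H1_suppd:
  assumes "\<Omega> \<in> sets lebesgue" "(v, G) \<in> H1 \<Omega>"
  shows "suppd \<Omega> v"
proof -
  have "mul (indicator \<Omega>) (fst z) = fst z" if z: "z \<in> H1 \<Omega>" for z
  proof (rule H1_closed_induct[OF _ _ z])
    show "closed {z. mul (indicator \<Omega>) (fst z) = (fst z :: 'a l2)}"
      by (intro closed_Collect_eq continuous_intros bounded_linear.continuous_on[OF bounded_linear_mul[OF bm_indicator[OF assms(1)]]])
    fix \<phi> assume \<phi>: "test_fun \<Omega> \<phi>"
    have "indicator \<Omega> x *\<^sub>R \<phi> x = \<phi> x" for x
      using \<phi> closure_subset[of "{x. \<phi> x \<noteq> 0}"] by (auto simp: test_fun_def indicator_def)
    then show "mul (indicator \<Omega>) (fst (abs_l2 \<phi>, grd \<phi>)) = fst (abs_l2 \<phi>, grd \<phi>)"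
      by (simp add: mul_abs_l2[OF bm_indicator[OF assms(1)] test_sqi[OF \<phi>]])
  qed
  from this[OF assms(2)] show ?thesis by (simp add: suppd_def)
qed

text \<open>The inequality is known on \<open>\<Omega>\<close> only; multiplying the representative
  by the indicator makes the integrands comparable at every point.\<close>

lemma inner_mul_mono:
  assumes "suppd \<Omega> v" "\<Omega> \<in> sets lebesgue" "bm m" "bm n" "\<And>x. x \<in> \<Omega> \<Longrightarrow> m x \<le> n x"
  shows "inner (mul m v) v \<le> inner (mul n v) v"
proof (cases v rule: l2_cases)
  fix f assume f: "sqi f" "v = abs_l2 f"
  note bi = bm_indicator[OF assms(2)]
  define g where "g x = indicator \<Omega> x *\<^sub>R f x" for x
  have g: "sqi g" "v = abs_l2 g"
    using assms(1) f sqi_mul[OF bi f(1)] unfolding suppd_def g_def[abs_def] by (simp_all add: mul_abs_l2[OF bi])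
  have "inner (m x *\<^sub>R g x) (g x) \<le> inner (n x *\<^sub>R g x) (g x)" for x
    using assms(5)[of x] by (auto simp: g_def indicator_def mult_right_mono)
  then show ?thesis
    unfolding g(2) mul_abs_l2[OF assms(3) g(1)] mul_abs_l2[OF assms(4) g(1)]
      inner_abs_l2[OF sqi_mul[OF assms(3) g(1)] g(1)] inner_abs_l2[OF sqi_mul[OF assms(4) g(1)] g(1)]
    by (intro integral_mono sqi_integrable_inner sqi_mul assms g)
qed

lemma mul_const: "mul (\<lambda>_. c) v = c *\<^sub>R v"
  by (cases v rule: l2_cases) (simp add: mul_abs_l2 abs_l2_scaleR)

lemma suppd_UNIV: "suppd UNIV v"
  by (simp add: suppd_def mul_const)

lemma mul_lincomb: "bm m \<Longrightarrow> bm n \<Longrightarrow> mul (\<lambda>x. c * m x + d * n x) v = c *\<^sub>R mul m v + d *\<^sub>R mul n v"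
  by (cases v rule: l2_cases)
     (simp add: mul_abs_l2 bm_add bm_mult sqi_mul scaleR_add_left sqi_scaleR abs_l2_scaleR[symmetric] abs_l2_add[symmetric])

text \<open>Each differentiation multiplies by \<open>c\<close> and shifts the phase by a quarter
  turn, which gives all derivatives in one formula.\<close>

lemma nice_sin: "nice (\<lambda>x. sin (c * x))"
proof (rule niceI[of "\<lambda>n x. c ^ n * sin (c * x + real n * (pi / 2))"])
  show "((\<lambda>x. c ^ n * sin (c * x + real n * (pi / 2))) has_real_derivative
      c ^ Suc n * sin (c * x + real (Suc n) * (pi / 2))) (at x)" for n x
  proof -
    have "c * x + real (Suc n) * (pi / 2) = (c * x + real n * (pi / 2)) + pi / 2"
      by (simp add: algebra_simps)
    then have "sin (c * x + real (Suc n) * (pi / 2)) = cos (c * x + real n * (pi / 2))"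
      by (simp only: sin_add) simp
    then show ?thesis by (auto intro!: derivative_eq_intros)
  qed
  show "bounded (range (\<lambda>x. c ^ n * sin (c * x + real n * (pi / 2))))" for n
  proof -
    have "\<bar>c ^ n * sin (c * x + real n * (pi / 2))\<bar> \<le> \<bar>c ^ n\<bar> * 1" for x
      unfolding abs_mult by (intro mult_left_mono) auto
    then show ?thesis by (auto simp: bounded_iff)
  qed
qed simp

text \<open>The integrated form of \<open>2 * v * v' = (v * v)'\<close> against a weight. The zero
  order terms of the multiplier identities come from here.\<close>

lemma H1_parts_weighted:
  assumes \<eta>: "nice \<eta>" "\<And>x. (\<eta> has_real_derivative \<eta>' x) (at x)" and e: "e \<in> Basis"
    and v: "(v, G) \<in> H1 UNIV"
  shows "2 * inner (gcomp G e) (mul (lf \<eta> e) v) = - inner v (mul (lf \<eta>' e) v)"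
proof -
  have "inner (gcomp G e) (mul (lf \<eta> e) v) = - inner v (mul (lf \<eta> e) (gcomp G e) + mul (lf \<eta>' e) v)"
    using H1_parts[OF v H1_mul[OF \<eta> e v] e] e by simp
  moreover have "inner v (mul (lf \<eta> e) (gcomp G e)) = inner (gcomp G e) (mul (lf \<eta> e) v)"
    by (simp only: inner_commute[of "gcomp G e"] inner_mul[OF bm_lf[OF \<eta>(1)]])
  ultimately show ?thesis by (simp add: inner_add_right)
qed

text \<open>A sine that increases across the slab stands in for the usual weight
  \<open>inner x e\<close>, which is unbounded on the whole space.\<close>

lemma poincare:
  assumes \<Omega>: "\<Omega> \<in> sets lebesgue" and e: "e \<in> Basis" and M: "\<And>x. x \<in> \<Omega> \<Longrightarrow> \<bar>inner x e\<bar> \<le> M" "M > 0"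
  shows "\<exists>C>0. \<forall>v G. (v, G) \<in> H1 \<Omega> \<longrightarrow> norm v \<le> C * norm (gcomp G e)"
\<comment> \<open>On the slab \<open>\<eta>'\<close> is at least \<open>cos 1 / M\<close>, while the
  weight itself is at most 1; the factor 2 is that of \<open>H1_parts_weighted\<close>.\<close>
proof (intro exI[of _ "2 * M / cos 1"] conjI allI impI)
  show "2 * M / cos 1 > 0" using M cos_gt_zero_pi[of 1] pi_gt3 by simp
  fix v G assume v: "(v, G) \<in> H1 \<Omega>"
  have c1: "cos 1 > (0::real)" using cos_gt_zero_pi[of 1] pi_gt3 by simp
  define \<eta> \<eta>' where "\<eta> x = sin ((1 / M) * x)" and "\<eta>' x = (1 / M) * cos ((1 / M) * x)" for x
  have n: "nice \<eta>" unfolding \<eta>_def by (rule nice_sin)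
  have d: "(\<eta> has_real_derivative \<eta>' x) (at x)" for x
    unfolding \<eta>_def \<eta>'_def using M(2) by (auto intro!: derivative_eq_intros)
  have vU: "(v, G) \<in> H1 UNIV" using v H1_mono[of \<Omega> UNIV] by auto
  have "(cos 1 / M) * (norm v)\<^sup>2 = inner (mul (\<lambda>_. cos 1 / M) v) v"
    by (simp add: mul_const power2_norm_eq_inner)
  also have "\<dots> \<le> inner (mul (lf \<eta>' e) v) v"
  proof (rule inner_mul_mono[OF H1_suppd[OF \<Omega> v] \<Omega> bm_const bm_lf[OF nice_deriv[OF n d]]])
    fix x assume "x \<in> \<Omega>"
    then have "\<bar>(1 / M) * inner x e\<bar> \<le> 1" using M(1)[of x] M(2) by (simp add: abs_mult)
    then have "cos 1 \<le> cos \<bar>(1 / M) * inner x e\<bar>" using pi_gt3 by (intro cos_monotone_0_pi_le) auto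
    then show "cos 1 / M \<le> \<eta>' (inner x e)"
      unfolding \<eta>'_def cos_abs_real using M(2) by (simp add: field_simps)
  qed
  also have "\<dots> = - (2 * inner (gcomp G e) (mul (lf \<eta> e) v))"
    using H1_parts_weighted[OF n d e vU] by (simp add: inner_commute)
  also have "\<dots> \<le> 2 * (norm (gcomp G e) * norm (mul (lf \<eta> e) v))"
    using Cauchy_Schwarz_ineq2[of "gcomp G e" "mul (lf \<eta> e) v"] by linarith
  also have "\<dots> \<le> 2 * (norm (gcomp G e) * norm v)"
  proof -
    have "norm (mul (lf \<eta> e) v) \<le> 1 * norm v" by (rule norm_mul_le[OF bm_lf[OF n]]) (simp add: \<eta>_def)
    then show ?thesis by (simp add: mult_left_mono)
  qed
  finally have "(cos 1 / M) * norm v * norm v \<le> (2 * norm (gcomp G e)) * norm v"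
    by (simp add: power2_eq_square)
  then have "norm v = 0 \<or> (cos 1 / M) * norm v \<le> 2 * norm (gcomp G e)"
    by (simp only: mult_le_cancel_right) auto
  then show "norm v \<le> 2 * M / cos 1 * norm (gcomp G e)"
    using c1 M(2) by (auto simp: field_simps)
qed

section \<open>A smooth flat function\<close>

text \<open>\<open>u ^ i * exp (- u)\<close> is at most \<open>fact i\<close>, since
  \<open>u ^ i / fact i\<close> is one term of the series of \<open>exp u\<close>.\<close>

lemma poly_exp_bounded:
  fixes p :: "real poly"
  shows "\<exists>K\<ge>0. \<forall>u\<ge>0. \<bar>poly p u * exp (- u)\<bar> \<le> K"
proof (intro exI[of _ "\<Sum>i\<le>degree p. \<bar>coeff p i\<bar> * fact i"] conjI allI impI)
  fix u :: real assume u: "u \<ge> 0"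
  have pw: "u ^ i * exp (- u) \<le> fact i" for i
  proof -
    have "u ^ i / fact i \<le> exp u"
    proof -
      have "(\<Sum>n\<in>{i}. u ^ n /\<^sub>R fact n) \<le> (\<Sum>n. u ^ n /\<^sub>R fact n)"
        using u by (intro sum_le_suminf summable_exp_generic) auto
      then show ?thesis by (simp add: exp_def divide_inverse mult.commute)
    qed
    then have "u ^ i \<le> fact i * exp u" by (simp add: divide_le_eq mult.commute)
    then have "u ^ i * exp (- u) \<le> (fact i * exp u) * exp (- u)" by (rule mult_right_mono) simp
    then show ?thesis by (simp add: mult.assoc exp_add[symmetric])
  qed
  have "\<bar>poly p u * exp (- u)\<bar> = \<bar>\<Sum>i\<le>degree p. coeff p i * (u ^ i * exp (- u))\<bar>"
    by (simp add: poly_altdef sum_distrib_right mult.assoc)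
  also have "\<dots> \<le> (\<Sum>i\<le>degree p. \<bar>coeff p i * (u ^ i * exp (- u))\<bar>)" by (rule sum_abs)
  also have "\<dots> \<le> (\<Sum>i\<le>degree p. \<bar>coeff p i\<bar> * fact i)"
    using u pw by (intro sum_mono) (auto simp: abs_mult intro!: mult_left_mono)
  finally show "\<bar>poly p u * exp (- u)\<bar> \<le> (\<Sum>i\<le>degree p. \<bar>coeff p i\<bar> * fact i)" .
qed (simp add: sum_nonneg)

text \<open>For \<open>p = 1\<close> this is the classical flat function. The polynomial factor
  makes the family closed under differentiation.\<close>

definition flat :: "real poly \<Rightarrow> real \<Rightarrow> real" where
  "flat p y = (if y > 0 then poly p (1 / y) * exp (- (1 / y)) else 0)"

lemma flat_bounded: "\<exists>K\<ge>0. \<forall>y. \<bar>flat p y\<bar> \<le> K"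
  using poly_exp_bounded[of p] by (auto simp: flat_def)

text \<open>With \<open>u = 1 / y\<close> the derivative in \<open>y\<close> is
  \<open>- u\<^sup>2\<close> times the derivative in \<open>u\<close>, which turns the factor
  \<open>p\<close> into \<open>u\<^sup>2 * (p - pderiv p)\<close>.\<close>

lemma flat_derivative: "(flat p has_real_derivative flat ([:0, 0, 1:] * (p - pderiv p)) y) (at y)"
proof -
  consider "y > 0" | "y < 0" | "y = 0" by linarith
  then show ?thesis
  proof cases
    case 1
    have "((\<lambda>y. poly p (1 / y) * exp (- (1 / y))) has_real_derivative flat ([:0, 0, 1:] * (p - pderiv p)) y) (at y)"
      using 1 by (auto intro!: derivative_eq_intros DERIV_chain2[OF poly_DERIV] simp: flat_def field_simps power2_eq_square)
    then show ?thesis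
      by (rule has_field_derivative_transform_within_open[of _ _ _ "{0<..}"]) (use 1 in \<open>auto simp: flat_def\<close>)
  next
    case 2
    have "((\<lambda>_. 0) has_real_derivative flat ([:0, 0, 1:] * (p - pderiv p)) y) (at y)"
      using 2 by (simp add: flat_def)
    then show ?thesis
      by (rule has_field_derivative_transform_within_open[of _ _ _ "{..<0}"]) (use 2 in \<open>auto simp: flat_def\<close>)
  next
    case 3
    \<comment> \<open>Moving two factors \<open>1 / h\<close> into the polynomial leaves one factor
      \<open>h\<close> in the difference quotient, which therefore tends to 0.\<close>
    obtain K where K: "K \<ge> 0" "\<And>y. \<bar>flat ([:0, 0, 1:] * p) y\<bar> \<le> K" using flat_bounded by blast
    have "\<bar>flat p h / h\<bar> \<le> K * \<bar>h\<bar>" if "h \<noteq> 0" for h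
    proof (cases "h > 0")
      case True
      then have "flat p h / h = flat ([:0, 0, 1:] * p) h * h" by (simp add: flat_def field_simps)
      then show ?thesis using K by (simp add: abs_mult mult_right_mono)
    next
      case False
      then show ?thesis using mult_nonneg_nonneg[OF K(1) abs_ge_zero, of h] by (simp add: flat_def)
    qed
    then have "\<forall>\<^sub>F h in at 0. norm (flat p h / h) \<le> K * \<bar>h\<bar>"
      unfolding eventually_at_filter real_norm_def by (intro always_eventually allI impI)
    moreover have "((\<lambda>h. K * \<bar>h\<bar>) \<longlongrightarrow> K * \<bar>0\<bar>) (at 0)" by (intro tendsto_intros)
    ultimately have "((\<lambda>h. flat p h / h) \<longlongrightarrow> 0) (at 0)"
      using Lim_null_comparison[of "\<lambda>h. flat p h / h" "\<lambda>h. K * \<bar>h\<bar>" "at 0"] by simp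
    then show ?thesis unfolding 3 by (simp add: DERIV_def flat_def)
  qed
qed

lemma nice_flat: "nice (flat p)"
proof -
  define P where "P n = ((\<lambda>p. [:0, 0, 1:] * (p - pderiv p)) ^^ n) p" for n
  show ?thesis
  proof (rule niceI[of "\<lambda>n. flat (P n)"])
    show "(flat (P n) has_real_derivative flat (P (Suc n)) x) (at x)" for n x
      using flat_derivative[of "P n" x] by (simp add: P_def)
    show "bounded (range (flat (P n)))" for n
      using flat_bounded[of "P n"] by (auto simp: bounded_iff)
  qed (simp add: P_def)
qed

lemma nice_affine:
  assumes "nice \<eta>"
  shows "nice (\<lambda>x. \<eta> (c * x + d))"
proof -
  obtain D where D: "D 0 = \<eta>" "\<And>n x. (D n has_real_derivative D (Suc n) x) (at x)" "\<And>n. bounded (range (D n))"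
    using assms unfolding nice_def by blast
  show ?thesis
  proof (rule niceI[of "\<lambda>n x. c ^ n * D n (c * x + d)"])
    show "((\<lambda>x. c ^ n * D n (c * x + d)) has_real_derivative c ^ Suc n * D (Suc n) (c * x + d)) (at x)" for n x
      by (auto intro!: derivative_eq_intros DERIV_chain2[OF D(2)])
    show "bounded (range (\<lambda>x. c ^ n * D n (c * x + d)))" for n
    proof -
      obtain K where "\<And>x. \<bar>D n x\<bar> \<le> K" using D(3)[of n] by (auto simp: bounded_iff)
      then have "\<bar>c ^ n * D n (c * x + d)\<bar> \<le> \<bar>c ^ n\<bar> * K" for x
        unfolding abs_mult by (intro mult_left_mono) auto
      then show ?thesis by (auto simp: bounded_iff)
    qed
  qed (simp add: D)
qed

lemma flat_1_pos: "y > 0 \<Longrightarrow> flat 1 y > 0"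
  and flat_1_nonneg: "flat 1 y \<ge> 0" and flat_1_le_1: "flat 1 y \<le> 1"
  by (auto simp: flat_def)

lemma flat_1_mono: "x \<le> y \<Longrightarrow> flat 1 x \<le> flat 1 y"
  by (auto simp: flat_def frac_le)

text \<open>The sum of two flat functions starting at \<open>R\<close> and \<open>- R\<close>.
  Instead of a plateau it has the lower bound \<open>flat 1 R\<close> beyond \<open>2 * R\<close>,
  by monotonicity.\<close>

lemma cutoff_exists:
  fixes R :: real
  assumes "R > 0"
  obtains \<theta> \<theta>' \<theta>'' m where "nice \<theta>" "\<And>x. (\<theta> has_real_derivative \<theta>' x) (at x)" "\<And>x. (\<theta>' has_real_derivative \<theta>'' x) (at x)"
    "\<And>x. \<theta> x \<ge> 0" "\<And>x. \<bar>x\<bar> \<le> R \<Longrightarrow> \<theta> x = 0" "\<And>x. \<bar>x\<bar> \<le> R \<Longrightarrow> \<theta>'' x = 0"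
    "m > 0" "\<And>x. \<bar>x\<bar> \<ge> 2 * R \<Longrightarrow> \<theta> x \<ge> m"
proof -
  define q where "q p = [:0, 0, 1:] * (p - pderiv p)" for p :: "real poly"
  \<comment> \<open>\<open>s\<close> is the sign that the reflection gives to derivatives; it flips
    with every differentiation.\<close>
  define F where "F p s x = flat p (x - R) + s * flat p (- x - R)" for p s x
  have d: "(F p s has_real_derivative F (q p) (- s) x) (at x)" for p s x
    unfolding F_def q_def
    by (auto intro!: derivative_eq_intros DERIV_chain2[OF flat_derivative])
  have z: "F p s x = 0" if "\<bar>x\<bar> \<le> R" for p s x
    using that by (auto simp: F_def flat_def abs_le_iff)
  have n: "nice (F 1 1)"
    using nice_lincomb[OF nice_affine[OF nice_flat, of 1 1 "- R"] nice_affine[OF nice_flat, of 1 "-1" "- R"], of 1 1]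
    by (simp add: F_def[abs_def])
  have l: "F 1 1 x \<ge> flat 1 R" if "\<bar>x\<bar> \<ge> 2 * R" for x
  proof (cases "x \<ge> 0")
    case True
    then have "flat 1 R \<le> flat 1 (x - R)" using that by (intro flat_1_mono) simp
    then show ?thesis using flat_1_nonneg[of "- x - R"] by (simp add: F_def)
  next
    case False
    then have "flat 1 R \<le> flat 1 (- x - R)" using that by (intro flat_1_mono) simp
    then show ?thesis using flat_1_nonneg[of "x - R"] by (simp add: F_def)
  qed
  show ?thesis
    by (rule that[OF n d d _ z z flat_1_pos[OF assms] l]) (simp_all add: F_def flat_1_nonneg)
qed

section \<open>Multiplier estimate\<close>

text \<open>The mean of two quotients: the forward one of \<open>v\<close>, multiplied by the
  weight, and the backward one of the product. The derivative of the weight enters through the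
  second only, hence the factor 1/2.\<close>

lemma translation_commutator_limit:
  assumes \<eta>: "nice \<eta>" "\<And>x. (\<eta> has_real_derivative \<eta>' x) (at x)" and e: "e \<in> Basis"
    and v: "(v, G) \<in> H1 UNIV"
  shows "((\<lambda>s. (1 / (2 * s)) *\<^sub>R (mul (lf \<eta> e) (tr (s *\<^sub>R e) v) - tr (- (s *\<^sub>R e)) (mul (lf \<eta> e) v)))
     \<longlongrightarrow> mul (lf \<eta> e) (gcomp G e) + (1 / 2) *\<^sub>R mul (lf \<eta>' e) v) (at 0)"
proof -
  let ?m = "mul (lf \<eta> e)"
  note bl = bounded_linear_mul[OF bm_lf[OF \<eta>(1), of e]]
  have a: "((\<lambda>s. ?m ((1 / s) *\<^sub>R (tr (s *\<^sub>R e) v - v))) \<longlongrightarrow> ?m (gcomp G e)) (at 0)"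
    by (rule bounded_linear.tendsto[OF bl H1_diff_quotient[OF v e]])
  have "((\<lambda>s. (1 / s) *\<^sub>R (tr (s *\<^sub>R e) (?m v) - ?m v)) \<longlongrightarrow> ?m (gcomp G e) + mul (lf \<eta>' e) v) (at 0)"
    using H1_diff_quotient[OF H1_mul[OF \<eta> e v] e] e by simp
  moreover have "filterlim uminus (at (0::real)) (at 0)"
    by (rule filterlim_atI) (auto intro!: tendsto_eq_intros simp: eventually_at_filter)
  ultimately have b: "((\<lambda>s. (1 / (- s)) *\<^sub>R (tr ((- s) *\<^sub>R e) (?m v) - ?m v)) \<longlongrightarrow> ?m (gcomp G e) + mul (lf \<eta>' e) v) (at 0)"
    by (rule filterlim_compose)
  have eq: "(1 / (2 * s)) *\<^sub>R (?m (tr (s *\<^sub>R e) v) - tr (- (s *\<^sub>R e)) (?m v)) =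
      (1 / 2) *\<^sub>R (?m ((1 / s) *\<^sub>R (tr (s *\<^sub>R e) v - v)) + (1 / (- s)) *\<^sub>R (tr ((- s) *\<^sub>R e) (?m v) - ?m v))" for s
    by (simp add: linear_diff[OF bounded_linear.linear[OF bl]] linear_scale[OF bounded_linear.linear[OF bl]] scaleR_diff_right)
  have "((\<lambda>s. (1 / 2) *\<^sub>R (?m ((1 / s) *\<^sub>R (tr (s *\<^sub>R e) v - v)) + (1 / (- s)) *\<^sub>R (tr ((- s) *\<^sub>R e) (?m v) - ?m v)))
     \<longlongrightarrow> (1 / 2) *\<^sub>R (?m (gcomp G e) + (?m (gcomp G e) + mul (lf \<eta>' e) v))) (at 0)"
    by (intro tendsto_intros a b)
  moreover have "(1 / 2) *\<^sub>R (?m (gcomp G e) + (?m (gcomp G e) + mul (lf \<eta>' e) v)) = ?m (gcomp G e) + (1 / 2) *\<^sub>R mul (lf \<eta>' e) v"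
    by (simp add: scaleR_add_right scaleR_left.add[symmetric] flip: add.assoc)
  ultimately show ?thesis unfolding eq by simp
qed

text \<open>\<open>r\<close> is the divergence of \<open>G\<close>, hence the Laplacian of
  \<open>v\<close> when \<open>G\<close> is its gradient; testing against all of
  \<open>H1 \<Omega>\<close> makes \<open>v\<close> and its multiples by weights admissible.\<close>

definition weak_laplace :: "'a::euclidean_space set \<Rightarrow> 'a gl2 \<Rightarrow> 'a l2 \<Rightarrow> bool" where
  "weak_laplace \<Omega> G r \<longleftrightarrow> (\<forall>(\<phi>, \<Phi>)\<in>H1 \<Omega>. inner r \<phi> = - inner G \<Phi>)"

lemma weak_laplaceD: "weak_laplace \<Omega> G r \<Longrightarrow> (\<phi>, \<Phi>) \<in> H1 \<Omega> \<Longrightarrow> inner r \<phi> = - inner G \<Phi>"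
  unfolding weak_laplace_def by auto

lemma H1_UNIV: "z \<in> H1 \<Omega> \<Longrightarrow> z \<in> H1 UNIV"
  using H1_mono[of \<Omega> UNIV] by auto

text \<open>The finite difference multiplier \<^term>\<open>\<lambda>w. mul \<eta> (tr s w) - tr (- s) (mul \<eta> w)\<close> preserves \<^const>\<open>H1\<close>
  and is skew-symmetric, so that the classical multiplier, its limit, needs no second derivatives of \<^term>\<open>v\<close>.\<close>

lemma multiplier_identity:
  assumes \<eta>: "nice \<eta>" "\<And>x. (\<eta> has_real_derivative \<eta>1 x) (at x)" "\<And>x. (\<eta>1 has_real_derivative \<eta>2 x) (at x)"
      "\<And>x. (\<eta>2 has_real_derivative \<eta>3 x) (at x)"
    and e: "e \<in> Basis" and \<Omega>: "\<And>s. (\<lambda>x. x + s *\<^sub>R e) ` \<Omega> = \<Omega>"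
    and v: "(v, G) \<in> H1 \<Omega>" and r: "weak_laplace \<Omega> G r"
  shows "inner r (mul (lf \<eta> e) (gcomp G e) + (1 / 2) *\<^sub>R mul (lf \<eta>1 e) v) =
     - inner (mul (lf \<eta>1 e) (gcomp G e)) (gcomp G e) + (1 / 4) * inner (mul (lf \<eta>3 e) v) v"
proof -
  note n1 = nice_deriv[OF \<eta>(1,2)]
  note n2 = nice_deriv[OF n1 \<eta>(3)]
  note vU = H1_UNIV[OF v]
  \<comment> \<open>The discrete multiplier, normalised so that
    \<open>translation_commutator_limit\<close> applies.\<close>
  define B where "B \<theta> s w = (1 / (2 * s)) *\<^sub>R (mul (lf \<theta> e) (tr (s *\<^sub>R e) w) - tr (- (s *\<^sub>R e)) (mul (lf \<theta> e) w))"
    for \<theta> s and w :: "'a l2"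
  have skew: "inner w (B \<theta> s w) = 0" if "nice \<theta>" for \<theta> s w
  proof -
    have "inner w (tr (- (s *\<^sub>R e)) (mul (lf \<theta> e) w)) = inner w (mul (lf \<theta> e) (tr (s *\<^sub>R e) w))"
      using inner_tr[of "s *\<^sub>R e" w "mul (lf \<theta> e) w"] inner_mul[OF bm_lf[OF that], of e w "tr (s *\<^sub>R e) w"]
      by (metis inner_commute)
    then show ?thesis by (simp add: B_def inner_diff_right)
  qed
  have id: "inner r (B \<eta> s v) = - inner (gcomp G e) (B \<eta>1 s v)" for s
  proof -
    define W1 where "W1 = gmk (\<lambda>b. mul (lf \<eta> e) (gcomp (gtr (s *\<^sub>R e) G) b) + (if b = e then mul (lf \<eta>1 e) (tr (s *\<^sub>R e) v) else 0))"
    define W2 where "W2 = gtr (- (s *\<^sub>R e)) (gmk (\<lambda>b. mul (lf \<eta> e) (gcomp G b) + (if b = e then mul (lf \<eta>1 e) v else 0)))"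
    have "(mul (lf \<eta> e) (tr (s *\<^sub>R e) v), W1) \<in> H1 \<Omega>"
      unfolding W1_def by (rule H1_mul[OF \<eta>(1,2) e H1_tr[OF \<Omega> v]])
    moreover have "(tr (- (s *\<^sub>R e)) (mul (lf \<eta> e) v), W2) \<in> H1 \<Omega>"
      unfolding W2_def using \<Omega>[of "- s"] by (intro H1_tr H1_mul \<eta> e v) simp
    ultimately have "(1 / (2 * s)) *\<^sub>R ((mul (lf \<eta> e) (tr (s *\<^sub>R e) v), W1) - (tr (- (s *\<^sub>R e)) (mul (lf \<eta> e) v), W2)) \<in> H1 \<Omega>"
      by (intro subspace_scale subspace_diff subspace_H1)
    then have "(B \<eta> s v, (1 / (2 * s)) *\<^sub>R (W1 - W2)) \<in> H1 \<Omega>"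
      by (simp add: B_def)
    then have "inner r (B \<eta> s v) = - inner G ((1 / (2 * s)) *\<^sub>R (W1 - W2))"
      by (rule weak_laplaceD[OF r])
    \<comment> \<open>\<open>B\<close> commutes with the gradient up to derivatives of the weight.
      Each component thus contributes \<open>B \<eta> s (gcomp G b)\<close>, orthogonal to
      \<open>gcomp G b\<close> by skewness, and only \<open>B \<eta>1 s v\<close> along
      \<open>e\<close> is left.\<close>
    also have "inner G ((1 / (2 * s)) *\<^sub>R (W1 - W2)) = (\<Sum>b\<in>Basis. if b = e then inner (gcomp G e) (B \<eta>1 s v) else 0)"
      unfolding inner_gl2_def
    proof (rule sum.cong[OF refl])
      fix b :: 'a assume b: "b \<in> Basis"
      have "gcomp ((1 / (2 * s)) *\<^sub>R (W1 - W2)) b = B \<eta> s (gcomp G b) + (if b = e then B \<eta>1 s v else 0)"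
        using b by (simp add: W1_def W2_def gtr_def B_def tr_add scaleR_diff_right scaleR_add_right linear_0[OF bounded_linear.linear[OF bounded_linear_tr]])
      then show "inner (gcomp G b) (gcomp ((1 / (2 * s)) *\<^sub>R (W1 - W2)) b) = (if b = e then inner (gcomp G e) (B \<eta>1 s v) else 0)"
        by (simp add: inner_add_right skew[OF \<eta>(1)])
    qed
    also have "\<dots> = inner (gcomp G e) (B \<eta>1 s v)" using e by simp
    finally show ?thesis .
  qed
  have "((\<lambda>s. inner r (B \<eta> s v)) \<longlongrightarrow> inner r (mul (lf \<eta> e) (gcomp G e) + (1 / 2) *\<^sub>R mul (lf \<eta>1 e) v)) (at 0)"
    unfolding B_def by (intro tendsto_inner tendsto_const translation_commutator_limit[OF \<eta>(1,2) e vU])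
  moreover have "((\<lambda>s. - inner (gcomp G e) (B \<eta>1 s v)) \<longlongrightarrow>
      - inner (gcomp G e) (mul (lf \<eta>1 e) (gcomp G e) + (1 / 2) *\<^sub>R mul (lf \<eta>2 e) v)) (at 0)"
    unfolding B_def by (intro tendsto_minus tendsto_inner tendsto_const translation_commutator_limit[OF n1 \<eta>(3) e vU])
  ultimately have "inner r (mul (lf \<eta> e) (gcomp G e) + (1 / 2) *\<^sub>R mul (lf \<eta>1 e) v) =
      - inner (gcomp G e) (mul (lf \<eta>1 e) (gcomp G e) + (1 / 2) *\<^sub>R mul (lf \<eta>2 e) v)"
    unfolding id by (rule tendsto_unique[rotated]) simp
  \<comment> \<open>The mixed term with \<open>\<eta>2\<close> is half of a weighted total
    derivative; this produces \<open>1 / 4\<close> and the third derivative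
    \<open>\<eta>3\<close>.\<close>
  then show ?thesis
    using H1_parts_weighted[OF n2 \<eta>(4) e vU] by (simp add: inner_add_right inner_commute)
qed

text \<open>The equation is tested with \<open>\<theta> * v\<close>. This supplies the gradient term
  needed where the derivative of the sine is negative, at the price of a zero order term with weight
  \<open>\<theta>2\<close>.\<close>

lemma localized_identity:
  assumes \<theta>: "nice \<theta>" "\<And>x. (\<theta> has_real_derivative \<theta>1 x) (at x)" "\<And>x. (\<theta>1 has_real_derivative \<theta>2 x) (at x)"
    and e: "e \<in> Basis" and v: "(v, G) \<in> H1 \<Omega>" and r: "weak_laplace \<Omega> G r"
  shows "inner r (mul (lf \<theta> e) v) =
     - (\<Sum>b\<in>Basis. inner (mul (lf \<theta> e) (gcomp G b)) (gcomp G b)) + (1 / 2) * inner (mul (lf \<theta>2 e) v) v"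
proof -
  have "inner r (mul (lf \<theta> e) v) = - (\<Sum>b\<in>Basis. inner (gcomp G b) (mul (lf \<theta> e) (gcomp G b) + (if b = e then mul (lf \<theta>1 e) v else 0)))"
    by (subst weak_laplaceD[OF r H1_mul[OF \<theta>(1,2) e v]]) (simp add: inner_gl2_def)
  also have "(\<Sum>b\<in>Basis. inner (gcomp G b) (mul (lf \<theta> e) (gcomp G b) + (if b = e then mul (lf \<theta>1 e) v else 0))) =
     (\<Sum>b\<in>Basis. inner (mul (lf \<theta> e) (gcomp G b)) (gcomp G b) + (if b = e then inner (gcomp G e) (mul (lf \<theta>1 e) v) else 0))"
    by (rule sum.cong) (auto simp: inner_add_right inner_commute)
  also have "\<dots> = (\<Sum>b\<in>Basis. inner (mul (lf \<theta> e) (gcomp G b)) (gcomp G b)) + inner (gcomp G e) (mul (lf \<theta>1 e) v)"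
    using e by (simp add: sum.distrib)
  finally show ?thesis
    using H1_parts_weighted[OF nice_deriv[OF \<theta>(1,2)] \<theta>(3) e H1_UNIV[OF v]] by (simp add: inner_commute)
qed

text \<open>\<open>e\<close> is one direction of the unbounded factor and \<open>e'\<close> one of
  the cross section. Of the compact exceptional set only its extent along \<open>e\<close> is
  retained, as the slab \<open>\<bar>inner x e\<bar> \<le> R\<close>. \<open>\<alpha>\<close> is an
  extension of the absorption index to the whole space.\<close>

locale waveguide =
  fixes \<Omega> :: "'a::euclidean_space set" and \<alpha> :: "'a \<Rightarrow> real" and e e' :: 'a and R M c0 :: real
  assumes \<Omega>_sets: "\<Omega> \<in> sets lebesgue"
    and \<Omega>_tr: "\<And>s. (\<lambda>x. x + s *\<^sub>R e) ` \<Omega> = \<Omega>"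
    and e: "e \<in> Basis" and e': "e' \<in> Basis"
    and M: "\<And>x. x \<in> \<Omega> \<Longrightarrow> \<bar>inner x e'\<bar> \<le> M" "M > 0"
    and bm_\<alpha>: "bm \<alpha>" and \<alpha>_nonneg: "\<And>x. x \<in> \<Omega> \<Longrightarrow> \<alpha> x \<ge> 0"
    and R: "R > 0" and c0: "c0 > 0" and \<alpha>_c0: "\<And>x. x \<in> \<Omega> \<Longrightarrow> \<bar>inner x e\<bar> > R \<Longrightarrow> c0 \<le> \<alpha> x"
begin

abbreviation dmp :: "'a l2 \<Rightarrow> real" where
  "dmp v \<equiv> inner (mul \<alpha> v) v"

lemma suppd_H1: "(v, G) \<in> H1 \<Omega> \<Longrightarrow> suppd \<Omega> v"
  by (rule H1_suppd[OF \<Omega>_sets])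

lemma damping_nonneg: "suppd \<Omega> v \<Longrightarrow> 0 \<le> dmp v"
  using inner_mul_mono[OF _ \<Omega>_sets bm_const[of 0] bm_\<alpha>, of v] \<alpha>_nonneg by (simp add: mul_const)

text \<open>The second bound comes from \<open>\<alpha> x * \<alpha> x \<le> A * \<alpha> x\<close>
  on \<open>\<Omega>\<close>. With it the friction term of the equation is controlled by the
  dissipation.\<close>

lemma damping_bound: "\<exists>A>0. (\<forall>v. norm (mul \<alpha> v) \<le> A * norm v) \<and> (\<forall>v. suppd \<Omega> v \<longrightarrow> (norm (mul \<alpha> v))\<^sup>2 \<le> A * dmp v)"
proof -
  obtain A where A: "A > 0" "\<And>x. \<bar>\<alpha> x\<bar> \<le> A" using bmE[OF bm_\<alpha>] by metis
  have "(norm (mul \<alpha> v))\<^sup>2 \<le> A * dmp v" if "suppd \<Omega> v" for v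
  proof -
    have "(norm (mul \<alpha> v))\<^sup>2 = inner (mul (\<lambda>x. \<alpha> x * \<alpha> x) v) v"
      using inner_mul[OF bm_\<alpha>, of "mul \<alpha> v" v] by (simp add: power2_norm_eq_inner mul_mul bm_\<alpha>)
    also have "\<dots> \<le> inner (mul (\<lambda>x. A * \<alpha> x + 0 * \<alpha> x) v) v"
      using A \<alpha>_nonneg abs_ge_self order_trans
      by (intro inner_mul_mono[OF that \<Omega>_sets] bm_mult bm_add bm_const bm_\<alpha>) (auto intro!: mult_right_mono; blast)
    also have "\<dots> = A * dmp v"
      by (subst mul_lincomb) (simp_all add: bm_\<alpha>)
    finally show ?thesis .
  qed
  then show ?thesis using A norm_mul_le[OF bm_\<alpha> A(2)] by blast
qed

text \<open>For a solution with displacement \<open>v\<close>, velocity \<open>p\<close> and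
  acceleration \<open>q\<close> the left-hand side is the time derivative of
  \<open>inner p (N (v, G))\<close>. The square of \<open>norm (gcomp G e)\<close> is gained from
  the sine and the localized weight together, and then spent on the friction term.\<close>

theorem multiplier_estimate:
  obtains N :: "'a l2 \<times> 'a gl2 \<Rightarrow> 'a l2" and c C where "bounded_linear N" "c > 0" "C \<ge> 0"
    "\<And>v G p P q. (v, G) \<in> H1 \<Omega> \<Longrightarrow> (p, P) \<in> H1 \<Omega> \<Longrightarrow> weak_laplace \<Omega> G (q + mul \<alpha> p) \<Longrightarrow>
       inner q (N (v, G)) + inner p (N (p, P)) \<le> - c * (norm v)\<^sup>2 + C * dmp v + C * dmp p"
proof -
  \<comment> \<open>With this frequency \<open>\<bar>\<kappa> * x\<bar> \<le> 1\<close> for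
    \<open>\<bar>x\<bar> \<le> 2 * R\<close>, so the cosine stays above \<open>cos 1\<close> up to
    where \<open>\<theta>\<close> has its lower bound \<open>m\<close>.\<close>
  define \<kappa> where "\<kappa> = 1 / (2 * R)"
  have \<kappa>: "\<kappa> > 0" using R by (simp add: \<kappa>_def)
  have c1: "cos 1 > (0::real)" using cos_gt_zero_pi[of 1] pi_gt3 by simp
  define \<eta> \<eta>1 \<eta>2 \<eta>3 where "\<eta> x = sin (\<kappa> * x)" and "\<eta>1 x = \<kappa> * cos (\<kappa> * x)" and "\<eta>2 x = - (\<kappa>\<^sup>2) * sin (\<kappa> * x)"
    and "\<eta>3 x = - (\<kappa> ^ 3) * cos (\<kappa> * x)" for x
  have \<eta>: "nice \<eta>" "(\<eta> has_real_derivative \<eta>1 x) (at x)" "(\<eta>1 has_real_derivative \<eta>2 x) (at x)"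
      "(\<eta>2 has_real_derivative \<eta>3 x) (at x)" for x
    unfolding \<eta>_def[abs_def] \<eta>1_def[abs_def] \<eta>2_def[abs_def] \<eta>3_def
    by (rule nice_sin) (auto intro!: derivative_eq_intros simp: power2_eq_square power3_eq_cube)
  note n1 = nice_deriv[OF \<eta>(1,2)]
  note n2 = nice_deriv[OF n1 \<eta>(3)]
  note n3 = nice_deriv[OF n2 \<eta>(4)]
  obtain \<theta> \<theta>1 \<theta>2 m where \<theta>: "nice \<theta>" "\<And>x. (\<theta> has_real_derivative \<theta>1 x) (at x)" "\<And>x. (\<theta>1 has_real_derivative \<theta>2 x) (at x)"
    and \<theta>p: "\<And>x. \<theta> x \<ge> 0" "\<And>x. \<bar>x\<bar> \<le> R \<Longrightarrow> \<theta> x = 0" "\<And>x. \<bar>x\<bar> \<le> R \<Longrightarrow> \<theta>2 x = 0"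
    "m > 0" "\<And>x. \<bar>x\<bar> \<ge> 2 * R \<Longrightarrow> \<theta> x \<ge> m"
    using cutoff_exists[OF R] by blast
  note n\<theta>2 = nice_deriv[OF nice_deriv[OF \<theta>(1,2)] \<theta>(3)]
  \<comment> \<open>Beyond \<open>2 * R\<close> this gives
    \<open>\<mu> * \<theta> x \<ge> 2 * \<kappa>\<close>, which outweighs
    \<open>\<eta>1 x \<ge> - \<kappa>\<close>.\<close>
  define \<mu> where "\<mu> = 2 * \<kappa> / m"
  have \<mu>: "\<mu> > 0" using \<kappa> \<theta>p(4) by (simp add: \<mu>_def)
  define \<kappa>1 where "\<kappa>1 = \<kappa> * cos 1"
  have \<kappa>1: "\<kappa>1 > 0" using \<kappa> c1 by (simp add: \<kappa>1_def)
  have cosb: "cos 1 \<le> cos (\<kappa> * x)" if "\<bar>x\<bar> \<le> 2 * R" for x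
  proof -
    have "\<bar>\<kappa> * x\<bar> \<le> 1" using that R by (simp add: \<kappa>_def abs_mult)
    then have "cos 1 \<le> cos \<bar>\<kappa> * x\<bar>" using pi_gt3 by (intro cos_monotone_0_pi_le) auto
    then show ?thesis by simp
  qed
  have w1: "\<kappa>1 \<le> 1 * \<eta>1 x + \<mu> * \<theta> x" for x
  proof (cases "\<bar>x\<bar> \<le> 2 * R")
    case True
    then have "\<kappa>1 \<le> \<eta>1 x" using cosb[OF True] \<kappa> by (simp add: \<kappa>1_def \<eta>1_def)
    moreover have "0 \<le> \<mu> * \<theta> x" using \<mu> \<theta>p(1)[of x] by simp
    ultimately show ?thesis by simp
  next
    case False
    then have "\<theta> x \<ge> m" using \<theta>p(5)[of x] by simp
    then have "\<mu> * m \<le> \<mu> * \<theta> x" using \<mu> by simp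
    moreover have "\<mu> * m = 2 * \<kappa>" using \<theta>p(4) by (simp add: \<mu>_def)
    moreover have "\<eta>1 x \<ge> - \<kappa>" using \<kappa> mult_left_mono[of "-1" "cos (\<kappa> * x)" \<kappa>] by (simp add: \<eta>1_def)
    moreover have "\<kappa>1 \<le> \<kappa>" using \<kappa> by (simp add: \<kappa>1_def)
    ultimately show ?thesis by linarith
  qed
  obtain B2 where B2: "\<And>x. \<bar>\<theta>2 x\<bar> \<le> B2" using nice_bounded[OF n\<theta>2] by (auto simp: bounded_iff)
  obtain B0 where B0: "\<And>x. \<bar>\<theta> x\<bar> \<le> B0" using nice_bounded[OF \<theta>(1)] by (auto simp: bounded_iff)
  have B20: "B2 \<ge> 0" "B0 \<ge> 0" using B2[of 0] B0[of 0] by linarith+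
  \<comment> \<open>\<open>\<kappa> ^ 3 * cos 1\<close> bounds \<open>- \<eta>3\<close> from below
    inside the slab; the quarter is that of \<open>multiplier_identity\<close>.\<close>
  define c where "c = \<kappa> ^ 3 * cos 1 / 4"
  have c: "c > 0" using \<kappa> c1 by (simp add: c_def)
  \<comment> \<open>Outside the slab the zero order weights have no sign; there
    \<open>C2 * \<alpha>\<close> dominates their worst case with \<open>c\<close> to spare.\<close>
  define C2 where "C2 = (c + \<kappa> ^ 3 / 4 + \<mu> / 2 * B2) / c0"
  have C2: "C2 \<ge> 0" using c \<kappa> \<mu> B20 c0 by (simp add: C2_def)
  have w2: "(1 / 4) * \<eta>3 x' + (\<mu> / 2) * \<theta>2 x' \<le> (- c) * 1 + C2 * \<alpha> x" if x: "x \<in> \<Omega>" and x': "x' = inner x e" for x x'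
  proof (cases "\<bar>x'\<bar> \<le> R")
    case True
    have "cos 1 \<le> cos (\<kappa> * x')" using True R by (intro cosb) simp
    then have "\<kappa> ^ 3 * cos 1 \<le> \<kappa> ^ 3 * cos (\<kappa> * x')" using \<kappa> by simp
    then have "(1 / 4) * \<eta>3 x' \<le> - c" by (simp add: \<eta>3_def c_def)
    moreover have "0 \<le> C2 * \<alpha> x" using C2 \<alpha>_nonneg[OF x] by simp
    ultimately show ?thesis using \<theta>p(3)[OF True] by simp
  next
    case False
    then have a: "c0 \<le> \<alpha> x" using \<alpha>_c0[OF x] x' by simp
    have "\<kappa> ^ 3 * (- 1) \<le> \<kappa> ^ 3 * cos (\<kappa> * x')" using \<kappa> by (intro mult_left_mono) auto
    then have "(1 / 4) * \<eta>3 x' \<le> \<kappa> ^ 3 / 4" by (simp add: \<eta>3_def)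
    moreover have "(\<mu> / 2) * \<theta>2 x' \<le> \<mu> / 2 * B2" using B2[of x'] \<mu> by (intro mult_left_mono) auto
    moreover have "C2 * c0 \<le> C2 * \<alpha> x" using C2 a by (intro mult_left_mono)
    moreover have "C2 * c0 = c + \<kappa> ^ 3 / 4 + \<mu> / 2 * B2" using c0 by (simp add: C2_def)
    ultimately show ?thesis by linarith
  qed
  have w3: "\<theta> (inner x e) \<le> (B0 / c0) * \<alpha> x + 0 * \<alpha> x" if x: "x \<in> \<Omega>" for x
  proof (cases "\<bar>inner x e\<bar> \<le> R")
    case True
    then show ?thesis using \<theta>p(2)[OF True] B20 c0 \<alpha>_nonneg[OF x] by simp
  next
    case False
    then have a: "c0 \<le> \<alpha> x" using \<alpha>_c0[OF x] by simp
    have "B0 / c0 * c0 \<le> B0 / c0 * \<alpha> x" using B20 c0 a by (intro mult_left_mono) auto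
    then show ?thesis using B0[of "inner x e"] c0 by simp
  qed
  note bm\<eta> = bm_lf[OF \<eta>(1), of e] bm_lf[OF n1, of e] bm_lf[OF n3, of e]
  note bm\<theta> = bm_lf[OF \<theta>(1), of e] bm_lf[OF n\<theta>2, of e]
  define N where "N z = (mul (lf \<eta> e) (gcomp (snd z) e) + (1 / 2) *\<^sub>R mul (lf \<eta>1 e) (fst z)) + \<mu> *\<^sub>R mul (lf \<theta> e) (fst z)"
    for z :: "'a l2 \<times> 'a gl2"
  have N: "bounded_linear N"
    unfolding N_def
    by (intro bounded_linear_add bounded_linear_compose[OF bounded_linear_scaleR_right]
        bounded_linear_compose[OF bounded_linear_mul] bm\<eta> bm\<theta> bounded_linear_fst
        bounded_linear_compose[OF bounded_linear_gcomp bounded_linear_snd])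
  define K where "K = \<kappa> / 2 + \<mu> * B0"
  have K: "K \<ge> 0" using \<kappa> \<mu> B20 by (simp add: K_def)
  have normN: "norm (N (v, G)) \<le> norm (gcomp G e) + K * norm v" for v G
  proof -
    have "norm (mul (lf \<eta> e) (gcomp G e)) \<le> 1 * norm (gcomp G e)"
      by (rule norm_mul_le[OF bm\<eta>(1)]) (simp add: \<eta>_def)
    moreover have "norm ((1 / 2) *\<^sub>R mul (lf \<eta>1 e) v) \<le> (1 / 2) * (\<kappa> * norm v)"
    proof -
      have "norm (mul (lf \<eta>1 e) v) \<le> \<kappa> * norm v"
        using \<kappa> by (intro norm_mul_le[OF bm\<eta>(2)]) (simp add: \<eta>1_def abs_mult)
      then show ?thesis by simp
    qed
    moreover have "norm (\<mu> *\<^sub>R mul (lf \<theta> e) v) \<le> \<mu> * (B0 * norm v)"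
    proof -
      have "norm (mul (lf \<theta> e) v) \<le> B0 * norm v"
        by (rule norm_mul_le[OF bm\<theta>(1)]) (rule B0)
      then show ?thesis using \<mu> by simp
    qed
    moreover have "norm (N (v, G)) \<le> norm (mul (lf \<eta> e) (gcomp G e)) + norm ((1 / 2) *\<^sub>R mul (lf \<eta>1 e) v) + norm (\<mu> *\<^sub>R mul (lf \<theta> e) v)"
      unfolding N_def fst_conv snd_conv by (intro order_trans[OF norm_triangle_ineq] add_mono norm_triangle_ineq order_refl)
    ultimately have "norm (N (v, G)) \<le> norm (gcomp G e) + (1 / 2) * (\<kappa> * norm v) + \<mu> * (B0 * norm v)" by linarith
    then show ?thesis by (simp add: K_def algebra_simps)
  qed
  obtain A where A: "A > 0" "\<And>v. suppd \<Omega> v \<Longrightarrow> (norm (mul \<alpha> v))\<^sup>2 \<le> A * dmp v" using damping_bound by blast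
  \<comment> \<open>The first two summands come from Young's inequality in \<open>E4\<close>, the
    third from \<open>I3\<close> and \<open>E3\<close>.\<close>
  define C4 where "C4 = A / (4 * \<kappa>1) + K\<^sup>2 * A / (2 * c) + \<mu> * (B0 / c0)"
  have C4: "C4 \<ge> 0" using A \<kappa>1 c \<mu> B20 c0 by (simp add: C4_def)
  show thesis
  proof (rule that[OF N, of "c / 2" "C2 + C4"])
    show "c / 2 > 0" "C2 + C4 \<ge> 0" using c C2 C4 by auto
    fix v G p P q assume v: "(v, G) \<in> H1 \<Omega>" and p: "(p, P) \<in> H1 \<Omega>" and q: "weak_laplace \<Omega> G (q + mul \<alpha> p)"
    let ?G = "gcomp G e"
    have I1: "inner (q + mul \<alpha> p) (mul (lf \<eta> e) ?G + (1 / 2) *\<^sub>R mul (lf \<eta>1 e) v) =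
        - inner (mul (lf \<eta>1 e) ?G) ?G + (1 / 4) * inner (mul (lf \<eta>3 e) v) v"
      by (rule multiplier_identity[OF \<eta> e \<Omega>_tr v q])
    have I2: "inner (q + mul \<alpha> p) (mul (lf \<theta> e) v) =
        - (\<Sum>b\<in>Basis. inner (mul (lf \<theta> e) (gcomp G b)) (gcomp G b)) + (1 / 2) * inner (mul (lf \<theta>2 e) v) v"
      by (rule localized_identity[OF \<theta> e v q])
    \<comment> \<open>The part of \<open>N\<close> built from the sine is skew and drops out; only
      the localized weight is left.\<close>
    have I3: "inner p (N (p, P)) = \<mu> * inner (mul (lf \<theta> e) p) p"
      using H1_parts_weighted[OF \<eta>(1,2) e H1_UNIV[OF p]] inner_mul[OF bm\<eta>(1), of p "gcomp P e"]
      by (simp add: N_def inner_add_right inner_commute)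
    have S: "inner (mul (lf \<theta> e) ?G) ?G \<le> (\<Sum>b\<in>Basis. inner (mul (lf \<theta> e) (gcomp G b)) (gcomp G b))"
    proof (rule member_le_sum[OF e])
      show "0 \<le> inner (mul (lf \<theta> e) (gcomp G b)) (gcomp G b)" for b
        using inner_mul_mono[OF suppd_UNIV _ bm_const bm\<theta>(1), of 0 "gcomp G b"] \<theta>p(1) by (simp add: mul_const)
    qed simp
    have E1: "\<kappa>1 * (norm ?G)\<^sup>2 \<le> inner (mul (lf \<eta>1 e) ?G) ?G + \<mu> * inner (mul (lf \<theta> e) ?G) ?G"
    proof -
      have "inner (mul (\<lambda>_. \<kappa>1) ?G) ?G \<le> inner (mul (\<lambda>x. 1 * lf \<eta>1 e x + \<mu> * lf \<theta> e x) ?G) ?G"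
        using w1 by (intro inner_mul_mono[OF suppd_UNIV] bm_add bm_mult bm_const bm\<eta> bm\<theta>) auto
      then show ?thesis
        unfolding mul_lincomb[OF bm\<eta>(2) bm\<theta>(1)] by (simp add: mul_const power2_norm_eq_inner inner_add_left)
    qed
    have E2: "(1 / 4) * inner (mul (lf \<eta>3 e) v) v + (\<mu> / 2) * inner (mul (lf \<theta>2 e) v) v \<le> - c * (norm v)\<^sup>2 + C2 * dmp v"
    proof -
      have "inner (mul (\<lambda>x. (1 / 4) * lf \<eta>3 e x + (\<mu> / 2) * lf \<theta>2 e x) v) v \<le> inner (mul (\<lambda>x. (- c) * 1 + C2 * \<alpha> x) v) v"
        using w2 by (intro inner_mul_mono[OF suppd_H1[OF v] \<Omega>_sets] bm_add bm_mult bm_const bm\<eta> bm\<theta> bm_\<alpha>) auto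
      then show ?thesis
        unfolding mul_lincomb[OF bm\<eta>(3) bm\<theta>(2)] mul_lincomb[OF bm_const bm_\<alpha>]
        by (simp add: mul_const power2_norm_eq_inner inner_add_left inner_diff_left)
    qed
    have E3: "inner (mul (lf \<theta> e) p) p \<le> (B0 / c0) * dmp p"
    proof -
      have "inner (mul (lf \<theta> e) p) p \<le> inner (mul (\<lambda>x. (B0 / c0) * \<alpha> x + 0 * \<alpha> x) p) p"
        using w3 by (intro inner_mul_mono[OF suppd_H1[OF p] \<Omega>_sets] bm_add bm_mult bm_const bm\<theta> bm_\<alpha>) auto
      then show ?thesis unfolding mul_lincomb[OF bm_\<alpha> bm_\<alpha>] by simp
    qed
    \<comment> \<open>Young's inequality, balanced so that the gradient term equals what
      \<open>E1\<close> provides and the zero order term costs half of \<open>c\<close>.\<close>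
    have E4: "\<bar>inner (mul \<alpha> p) (N (v, G))\<bar> \<le> \<kappa>1 * (norm ?G)\<^sup>2 + (c / 2) * (norm v)\<^sup>2 + (A / (4 * \<kappa>1) + K\<^sup>2 * A / (2 * c)) * dmp p"
    proof -
      let ?y = "norm (mul \<alpha> p)"
      have "\<bar>inner (mul \<alpha> p) (N (v, G))\<bar> \<le> ?y * (norm ?G + K * norm v)"
        by (rule order_trans[OF Cauchy_Schwarz_ineq2 mult_left_mono[OF normN]]) simp
      moreover have "?y * norm ?G \<le> \<kappa>1 * (norm ?G)\<^sup>2 + ?y\<^sup>2 / (4 * \<kappa>1)"
      proof -
        have "0 \<le> (2 * \<kappa>1 * norm ?G - ?y)\<^sup>2 / (4 * \<kappa>1)" using \<kappa>1 by simp
        then show ?thesis using \<kappa>1 by (simp add: power2_eq_square field_simps)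
      qed
      moreover have "?y * (K * norm v) \<le> (c / 2) * (norm v)\<^sup>2 + K\<^sup>2 * ?y\<^sup>2 / (2 * c)"
      proof -
        have "0 \<le> (c * norm v - K * ?y)\<^sup>2 / (2 * c)" using c by simp
        then show ?thesis using c by (simp add: power2_eq_square field_simps)
      qed
      moreover have "?y\<^sup>2 / (4 * \<kappa>1) \<le> A / (4 * \<kappa>1) * dmp p"
        using A(2)[OF suppd_H1[OF p]] \<kappa>1 by (simp add: field_simps)
      moreover have "K\<^sup>2 * ?y\<^sup>2 / (2 * c) \<le> K\<^sup>2 * A / (2 * c) * dmp p"
        using mult_left_mono[OF A(2)[OF suppd_H1[OF p]], of "K\<^sup>2"] c by (simp add: field_simps)
      ultimately show ?thesis by (simp add: distrib_left distrib_right)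
    qed
    have "inner q (N (v, G)) = inner (q + mul \<alpha> p) (mul (lf \<eta> e) ?G + (1 / 2) *\<^sub>R mul (lf \<eta>1 e) v)
       + \<mu> * inner (q + mul \<alpha> p) (mul (lf \<theta> e) v) - inner (mul \<alpha> p) (N (v, G))"
      by (simp add: N_def inner_add_left inner_add_right algebra_simps)
    also have "\<dots> = - inner (mul (lf \<eta>1 e) ?G) ?G + (1 / 4) * inner (mul (lf \<eta>3 e) v) v
       - \<mu> * (\<Sum>b\<in>Basis. inner (mul (lf \<theta> e) (gcomp G b)) (gcomp G b)) + (\<mu> / 2) * inner (mul (lf \<theta>2 e) v) v
       - inner (mul \<alpha> p) (N (v, G))"
      unfolding I1 I2 by (simp add: algebra_simps)
    also have "\<dots> \<le> - inner (mul (lf \<eta>1 e) ?G) ?G - \<mu> * inner (mul (lf \<theta> e) ?G) ?G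
       + (- c * (norm v)\<^sup>2 + C2 * dmp v) + \<bar>inner (mul \<alpha> p) (N (v, G))\<bar>"
      using E2 mult_left_mono[OF S, of \<mu>] \<mu> by linarith
    also have "\<dots> \<le> - (\<kappa>1 * (norm ?G)\<^sup>2) + (- c * (norm v)\<^sup>2 + C2 * dmp v) +
       (\<kappa>1 * (norm ?G)\<^sup>2 + (c / 2) * (norm v)\<^sup>2 + (A / (4 * \<kappa>1) + K\<^sup>2 * A / (2 * c)) * dmp p)"
      using E1 E4 by linarith
    finally have Q: "inner q (N (v, G)) \<le> - (c / 2) * (norm v)\<^sup>2 + C2 * dmp v + (A / (4 * \<kappa>1) + K\<^sup>2 * A / (2 * c)) * dmp p"
      by linarith
    have "inner p (N (p, P)) \<le> \<mu> * (B0 / c0) * dmp p"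
      unfolding I3 using mult_left_mono[OF E3, of \<mu>] \<mu> by (simp add: mult.assoc)
    with Q have "inner q (N (v, G)) + inner p (N (p, P)) \<le> - (c / 2) * (norm v)\<^sup>2 + C2 * dmp v + C4 * dmp p"
      unfolding C4_def distrib_right[of _ "\<mu> * (B0 / c0)"] by linarith
    also have "\<dots> \<le> - (c / 2) * (norm v)\<^sup>2 + (C2 + C4) * dmp v + (C2 + C4) * dmp p"
      using C2 C4 damping_nonneg[OF suppd_H1[OF v]] damping_nonneg[OF suppd_H1[OF p]]
      by (simp add: distrib_right)
    finally show "inner q (N (v, G)) + inner p (N (p, P)) \<le>
       - (c / 2) * (norm v)\<^sup>2 + (C2 + C4) * dmp v + (C2 + C4) * dmp p" .
  qed
qed

end

section \<open>Decay of orbits\<close>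

context waveguide
begin

text \<open>A state is \<open>(\<nabla>v, v\<^sub>t)\<close>; the displacement \<open>v\<close> itself is determined by its gradient.\<close>

definition gen :: "(('a gl2 \<times> 'a l2) \<times> ('a gl2 \<times> 'a l2)) set" where
  "gen = {((G, p), (P, q)) | G p P q. (p, P) \<in> H1 \<Omega> \<and> (\<exists>v. (v, G) \<in> H1 \<Omega>) \<and> weak_laplace \<Omega> G (q + mul \<alpha> p)}"

lemma mul_\<alpha>_add: "mul \<alpha> (v + w) = mul \<alpha> v + mul \<alpha> w"
  and mul_\<alpha>_scaleR: "mul \<alpha> (c *\<^sub>R v) = c *\<^sub>R mul \<alpha> v"
  by (rule mul_add[OF bm_\<alpha>], rule mul_scaleR[OF bm_\<alpha>])

lemma genI: "(p, P) \<in> H1 \<Omega> \<Longrightarrow> (v, G) \<in> H1 \<Omega> \<Longrightarrow> weak_laplace \<Omega> G (q + mul \<alpha> p) \<Longrightarrow> ((G, p), (P, q)) \<in> gen"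
  unfolding gen_def by blast

lemma genD:
  assumes "(x, y) \<in> gen"
  shows "(snd x, fst y) \<in> H1 \<Omega>" "\<exists>v. (v, fst x) \<in> H1 \<Omega>" "weak_laplace \<Omega> (fst x) (snd y + mul \<alpha> (snd x))"
  using assms unfolding gen_def by auto

lemma subspace_gen: "subspace gen"
  unfolding subspace_def
proof (intro conjI ballI allI)
  have "(0, 0) \<in> H1 \<Omega>" using subspace_0[OF subspace_H1[of \<Omega>]] by (simp add: zero_prod_def)
  then show "0 \<in> gen"
    using genI[of 0 0 0 0 0] mul_\<alpha>_scaleR[of 0 0] by (simp add: weak_laplace_def zero_prod_def)
  fix x y assume x: "x \<in> gen" and y: "y \<in> gen"
  obtain G p P q v where X: "x = ((G, p), (P, q))" "(p, P) \<in> H1 \<Omega>" "(v, G) \<in> H1 \<Omega>" "weak_laplace \<Omega> G (q + mul \<alpha> p)"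
    using x unfolding gen_def by blast
  obtain G' p' P' q' v' where Y: "y = ((G', p'), (P', q'))" "(p', P') \<in> H1 \<Omega>" "(v', G') \<in> H1 \<Omega>" "weak_laplace \<Omega> G' (q' + mul \<alpha> p')"
    using y unfolding gen_def by blast
  have "weak_laplace \<Omega> (G + G') ((q + q') + mul \<alpha> (p + p'))"
    using X(4) Y(4) unfolding weak_laplace_def by (fastforce simp: inner_add_left mul_\<alpha>_add)
  then show "x + y \<in> gen"
    using subspace_add[OF subspace_H1 X(2) Y(2)] subspace_add[OF subspace_H1 X(3) Y(3)] unfolding X(1) Y(1)
    by (simp add: genI)
next
  fix x and c :: real assume x: "x \<in> gen"
  obtain G p P q v where X: "x = ((G, p), (P, q))" "(p, P) \<in> H1 \<Omega>" "(v, G) \<in> H1 \<Omega>" "weak_laplace \<Omega> G (q + mul \<alpha> p)"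
    using x unfolding gen_def by blast
  have "weak_laplace \<Omega> (c *\<^sub>R G) (c *\<^sub>R q + mul \<alpha> (c *\<^sub>R p))"
    using X(4) unfolding weak_laplace_def by (fastforce simp: mul_\<alpha>_scaleR simp flip: scaleR_add_right)
  then show "c *\<^sub>R x \<in> gen"
    using subspace_scale[OF subspace_H1 X(2), of c] subspace_scale[OF subspace_H1 X(3), of c] unfolding X(1)
    by (simp add: genI)
qed

text \<open>Testing the equation with the velocity cancels the pairing of the gradients; only
  friction remains.\<close>

lemma gen_dissipation:
  assumes "(x, y) \<in> gen"
  shows "inner x y = - dmp (snd x)"
  using weak_laplaceD[OF genD(3)[OF assms] genD(1)[OF assms]]
  by (simp add: inner_prod_def inner_add_left inner_add_right inner_commute)

lemma dissipative_gen: "dissipative gen"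
  unfolding dissipative_def
proof clarify
  fix x y assume xy: "(x, y) \<in> gen"
  show "inner x y \<le> 0" using gen_dissipation[OF xy] damping_nonneg[OF suppd_H1[OF genD(1)[OF xy]]] by simp
qed

section \<open>The displacement recovered from its gradient\<close>

lemma poincare_H1: "\<exists>Cp>0. \<forall>v G. (v, G) \<in> H1 \<Omega> \<longrightarrow> norm v \<le> Cp * norm G"
proof -
  obtain Cp where Cp: "Cp > 0" "\<And>v G. (v, G) \<in> H1 \<Omega> \<Longrightarrow> norm v \<le> Cp * norm (gcomp G e')"
    using poincare[OF \<Omega>_sets e' M] by blast
  have "norm v \<le> Cp * norm G" if "(v, G) \<in> H1 \<Omega>" for v G
    using Cp(2)[OF that] mult_left_mono[OF norm_gcomp_le[of G e'], of Cp] Cp(1) by linarith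
  then show ?thesis using Cp(1) by blast
qed

definition potential :: "(real \<Rightarrow> 'a gl2 \<times> 'a l2) \<Rightarrow> (real \<Rightarrow> 'a l2) \<Rightarrow> bool" where
  "potential x v \<longleftrightarrow> (\<forall>t\<ge>0. (v t, fst (x t)) \<in> H1 \<Omega>)"

lemma potential_exists: "orbit gen x y \<Longrightarrow> \<exists>v. potential x v"
  unfolding potential_def using genD(2)[OF orbit_mem] by metis

lemma potential_dq:
  assumes "potential x v" "h \<ge> 0"
  shows "potential (dq h x) (dq h v)"
  unfolding potential_def
proof (intro allI impI)
  fix t :: real assume "t \<ge> 0"
  then have "(1 / h) *\<^sub>R ((v (t + h), fst (x (t + h))) - (v t, fst (x t))) \<in> H1 \<Omega>"
    using assms unfolding potential_def by (intro subspace_scale subspace_diff subspace_H1) auto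
  then show "(dq h v t, fst (dq h x t)) \<in> H1 \<Omega>" by (simp add: dq_def)
qed

text \<open>\<open>v\<close> is chosen at each time separately, so its regularity has to be derived.
  Poincare's inequality, applied to the quotient of \<open>v\<close> minus the velocity, bounds the
  error by that of the gradient component, which tends to 0.\<close>

lemma potential_derivative:
  assumes x: "orbit gen x y" and v: "potential x v" and t: "t \<ge> 0"
  shows "(v has_vector_derivative snd (x t)) (at t within {0..})"
proof -
  obtain Cp where Cp: "\<forall>v G. (v, G) \<in> H1 \<Omega> \<longrightarrow> norm v \<le> Cp * norm G" using poincare_H1 by blast
  have "(x has_vector_derivative y t) (at t within {0..})" by (rule orbit_derivative[OF x t])
  then have "((\<lambda>s. (1 / (s - t)) *\<^sub>R (x s - x t)) \<longlongrightarrow> y t) (at t within {0..})"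
    by (simp add: has_vector_derivative_tendsto)
  then have a: "((\<lambda>s. fst ((1 / (s - t)) *\<^sub>R (x s - x t))) \<longlongrightarrow> fst (y t)) (at t within {0..})"
    by (rule tendsto_fst)
  have lim: "((\<lambda>s. Cp * norm (fst ((1 / (s - t)) *\<^sub>R (x s - x t)) - fst (y t))) \<longlongrightarrow> 0) (at t within {0..})"
    using tendsto_mult_left[OF tendsto_norm[OF tendsto_diff[OF a tendsto_const[of "fst (y t)"]]], of Cp] by simp
  have "norm ((1 / (s - t)) *\<^sub>R (v s - v t) - snd (x t)) \<le> Cp * norm (fst ((1 / (s - t)) *\<^sub>R (x s - x t)) - fst (y t))"
    if s: "s \<ge> 0" for s
  proof (rule Cp[rule_format])
    have "(1 / (s - t)) *\<^sub>R ((v s, fst (x s)) - (v t, fst (x t))) - (snd (x t), fst (y t)) \<in> H1 \<Omega>"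
      using v s t genD(1)[OF orbit_mem[OF x t]] unfolding potential_def
      by (intro subspace_diff subspace_scale subspace_H1) auto
    then show "((1 / (s - t)) *\<^sub>R (v s - v t) - snd (x t), fst ((1 / (s - t)) *\<^sub>R (x s - x t)) - fst (y t)) \<in> H1 \<Omega>"
      by simp
  qed
  then have ev: "\<forall>\<^sub>F s in at t within {0..}. norm ((1 / (s - t)) *\<^sub>R (v s - v t) - snd (x t)) \<le> Cp * norm (fst ((1 / (s - t)) *\<^sub>R (x s - x t)) - fst (y t))"
    unfolding eventually_at_filter by (intro always_eventually) auto
  have "((\<lambda>s. (1 / (s - t)) *\<^sub>R (v s - v t) - snd (x t)) \<longlongrightarrow> 0) (at t within {0..})"
    by (rule Lim_null_comparison[OF ev lim])
  then show ?thesis unfolding has_vector_derivative_tendsto by (rule LIM_zero_cancel)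
qed

lemma orbit_components:
  assumes "orbit gen x y" "t \<ge> 0"
  shows "((\<lambda>t. fst (x t)) has_vector_derivative fst (y t)) (at t within {0..})"
    "((\<lambda>t. snd (x t)) has_vector_derivative snd (y t)) (at t within {0..})"
  using bounded_linear.has_vector_derivative[OF bounded_linear_fst orbit_derivative[OF assms]]
    bounded_linear.has_vector_derivative[OF bounded_linear_snd orbit_derivative[OF assms]] .

lemma orbit_energy_derivative:
  assumes "orbit gen x y" "t \<ge> 0"
  shows "((\<lambda>t. (norm (x t))\<^sup>2) has_vector_derivative - 2 * dmp (snd (x t))) (at t within {0..})"
  using bounded_bilinear.has_vector_derivative[OF bounded_bilinear_inner orbit_derivative[OF assms] orbit_derivative[OF assms]]
    gen_dissipation[OF orbit_mem[OF assms]]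
  by (simp add: power2_norm_eq_inner inner_commute)

lemma ftc_half_line:
  fixes f :: "real \<Rightarrow> real"
  assumes "\<And>t. t \<ge> 0 \<Longrightarrow> (f has_vector_derivative f' t) (at t within {0..})" "T \<ge> 0"
  shows "(f' has_integral (f T - f 0)) {0..T}"
  by (rule fundamental_theorem_of_calculus[OF assms(2)])
     (auto intro: has_vector_derivative_within_subset[OF assms(1)])

lemma continuous_half_line:
  fixes f :: "real \<Rightarrow> 'x::real_normed_vector"
  assumes "\<And>t. t \<ge> 0 \<Longrightarrow> (f has_vector_derivative f' t) (at t within {0..})"
  shows "continuous_on {0..T} f"
  unfolding continuous_on_eq_continuous_within
  by (auto intro!: has_vector_derivative_continuous has_vector_derivative_within_subset[OF assms])

lemma continuous_damping: "continuous_on S f \<Longrightarrow> continuous_on S (\<lambda>t. dmp (f t))"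
  by (intro continuous_on_inner bounded_linear.continuous_on[OF bounded_linear_mul[OF bm_\<alpha>]])

lemma dissipation_integral:
  assumes x: "orbit gen x y" and T: "T \<ge> 0"
  shows "2 * integral {0..T} (\<lambda>t. dmp (snd (x t))) \<le> (norm (x 0))\<^sup>2"
proof -
  have "((\<lambda>t. - 2 * dmp (snd (x t))) has_integral ((norm (x T))\<^sup>2 - (norm (x 0))\<^sup>2)) {0..T}"
    by (rule ftc_half_line[OF orbit_energy_derivative[OF x] T])
  then have "integral {0..T} (\<lambda>t. - 2 * dmp (snd (x t))) = (norm (x T))\<^sup>2 - (norm (x 0))\<^sup>2"
    by (rule integral_unique)
  moreover have "integral {0..T} (\<lambda>t. - 2 * dmp (snd (x t))) =
      - 2 * integral {0..T} (\<lambda>t. dmp (snd (x t)))"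
    by (rule integral_mult_right)
  ultimately show ?thesis by (smt (verit) zero_le_power2)
qed

text \<open>The multiplier estimate integrated in time, with boundary terms bounded by the initial
  energy. Friction of the displacement stays on the right, since dissipation controls only the
  friction of the velocity.\<close>

lemma lyapunov_integral:
  "\<exists>c>0. \<exists>C\<ge>0. \<forall>x y v T. orbit gen x y \<longrightarrow> potential x v \<longrightarrow> T \<ge> 0 \<longrightarrow>
    c * integral {0..T} (\<lambda>t. (norm (v t))\<^sup>2) \<le> C * integral {0..T} (\<lambda>t. dmp (v t)) + C * (norm (x 0))\<^sup>2"
proof -
  obtain N :: "'a l2 \<times> 'a gl2 \<Rightarrow> 'a l2" and c C where N: "bounded_linear N" and c: "c > 0" and C: "C \<ge> 0"
    and est: "\<And>v G p P q. (v, G) \<in> H1 \<Omega> \<Longrightarrow> (p, P) \<in> H1 \<Omega> \<Longrightarrow> weak_laplace \<Omega> G (q + mul \<alpha> p) \<Longrightarrow>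
       inner q (N (v, G)) + inner p (N (p, P)) \<le> - c * (norm v)\<^sup>2 + C * dmp v + C * dmp p"
    using multiplier_estimate by blast
  obtain Cp where Cp: "Cp > 0" "\<And>v G. (v, G) \<in> H1 \<Omega> \<Longrightarrow> norm v \<le> Cp * norm G" using poincare_H1 by blast
  obtain B where B: "B > 0" "\<And>z. norm (N z) \<le> norm z * B" using bounded_linear.pos_bounded[OF N] by blast
  \<comment> \<open>\<open>Cp + 1\<close> bounds the pair of displacement and gradient by the
    gradient, and \<open>B\<close> bounds \<open>N\<close>.\<close>
  define D where "D = (Cp + 1) * B"
  have D: "D > 0" using Cp B by (simp add: D_def)
  show ?thesis
  \<comment> \<open>\<open>C\<close> covers the friction terms and \<open>2 * D\<close> the values
    of \<open>J\<close> at both ends.\<close>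
  proof (rule exI[of _ c], rule conjI[OF c], rule exI[of _ "C + 2 * D"], intro conjI allI impI)
    show "C + 2 * D \<ge> 0" using C D by simp
    fix x y v and T :: real
    assume x: "orbit gen x y" and v: "potential x v" and T: "T \<ge> 0"
    have vG: "(v t, fst (x t)) \<in> H1 \<Omega>" if "t \<ge> 0" for t using v that by (simp add: potential_def)
    define J where "J t = inner (snd (x t)) (N (v t, fst (x t)))" for t
    have J: "\<bar>J t\<bar> \<le> D * (norm (x 0))\<^sup>2" if t: "t \<ge> 0" for t
    proof -
      have nx: "norm (snd (x t)) \<le> norm (x 0)" "norm (fst (x t)) \<le> norm (x 0)"
        using orbit_norm_mono[OF x dissipative_gen order_refl t] norm_snd_le[of "snd (x t)" "fst (x t)"] norm_fst_le[of "fst (x t)" "snd (x t)"] by auto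
      have "norm (v t, fst (x t)) \<le> norm (v t) + norm (fst (x t))"
        by (rule norm_Pair_le)
      also have "\<dots> \<le> (Cp + 1) * norm (fst (x t))" using Cp(2)[OF vG[OF t]] by (simp add: algebra_simps)
      also have "\<dots> \<le> (Cp + 1) * norm (x 0)" using nx Cp by (intro mult_left_mono) auto
      finally have "norm (N (v t, fst (x t))) \<le> ((Cp + 1) * norm (x 0)) * B"
        using B(1) by (intro order_trans[OF B(2)] mult_right_mono) auto
      then have "norm (snd (x t)) * norm (N (v t, fst (x t))) \<le> norm (x 0) * (((Cp + 1) * norm (x 0)) * B)"
        using nx by (intro mult_mono) auto
      then show ?thesis
        unfolding J_def D_def using Cauchy_Schwarz_ineq2[of "snd (x t)" "N (v t, fst (x t))"]
        by (simp add: power2_eq_square ac_simps)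
    qed
    define J' where "J' t = inner (snd (x t)) (N (snd (x t), fst (y t))) + inner (snd (y t)) (N (v t, fst (x t)))" for t
    have dJ: "(J has_vector_derivative J' t) (at t within {0..})" if t: "t \<ge> 0" for t
    proof -
      have "((\<lambda>t. (v t, fst (x t))) has_vector_derivative (snd (x t), fst (y t))) (at t within {0..})"
        by (intro has_vector_derivative_Pair potential_derivative[OF x v t] orbit_components[OF x t])
      from bounded_linear.has_vector_derivative[OF N this]
      show ?thesis unfolding J_def[abs_def] J'_def
        by (rule bounded_bilinear.has_vector_derivative[OF bounded_bilinear_inner orbit_components(2)[OF x t]])
    qed
    have cv: "continuous_on {0..T} v" by (rule continuous_half_line[OF potential_derivative[OF x v]])
    have cp: "continuous_on {0..T} (\<lambda>t. snd (x t))" by (rule continuous_half_line[OF orbit_components(2)[OF x]])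
    have i1: "(\<lambda>t. (norm (v t))\<^sup>2) integrable_on {0..T}"
      by (intro integrable_continuous_real continuous_intros cv)
    have i2: "(\<lambda>t. dmp (v t)) integrable_on {0..T}"
      by (intro integrable_continuous_real continuous_damping cv)
    have i3: "(\<lambda>t. dmp (snd (x t))) integrable_on {0..T}"
      by (intro integrable_continuous_real continuous_damping cp)
    let ?I1 = "integral {0..T} (\<lambda>t. (norm (v t))\<^sup>2)"
    let ?I2 = "integral {0..T} (\<lambda>t. dmp (v t))"
    let ?I3 = "integral {0..T} (\<lambda>t. dmp (snd (x t)))"
    have "J T - J 0 \<le> - c * ?I1 + C * ?I2 + C * ?I3"
    proof (rule has_integral_le[OF ftc_half_line[OF dJ T]])
      show "((\<lambda>t. - c * (norm (v t))\<^sup>2 + C * dmp (v t) + C * dmp (snd (x t)))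
          has_integral (- c * ?I1 + C * ?I2 + C * ?I3)) {0..T}"
        by (intro has_integral_add has_integral_mult_right integrable_integral i1 i2 i3)
      fix t assume "t \<in> {0..T}"
      then have t: "t \<ge> 0" by simp
      show "J' t \<le> - c * (norm (v t))\<^sup>2 + C * dmp (v t) + C * dmp (snd (x t))"
        unfolding J'_def using est[OF vG[OF t] genD(1,3)[OF orbit_mem[OF x t]]] by simp
    qed
    moreover have "C * ?I3 \<le> C * ((norm (x 0))\<^sup>2 / 2)"
      using dissipation_integral[OF x T] C by (intro mult_left_mono) auto
    moreover have "C * ((norm (x 0))\<^sup>2 / 2) \<le> C * (norm (x 0))\<^sup>2" using C by (intro mult_left_mono) auto
    moreover have "J 0 - J T \<le> 2 * D * (norm (x 0))\<^sup>2" using J[OF order_refl] J[OF T] by linarith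
    moreover have "C * ?I2 \<le> (C + 2 * D) * ?I2"
    proof -
      have "?I2 \<ge> 0" using damping_nonneg[OF suppd_H1[OF vG]] by (intro integral_nonneg i2) auto
      then show ?thesis using D by (simp add: distrib_right)
    qed
    ultimately show "c * ?I1 \<le> (C + 2 * D) * ?I2 + (C + 2 * D) * (norm (x 0))\<^sup>2"
      by (simp add: distrib_right)
  qed
qed

text \<open>The orbit \<open>dq h x\<close> has displacement \<open>dq h v\<close>, which tends to
  the velocity of \<open>x\<close>. In the limit the friction left over in
  \<open>lyapunov_integral\<close> becomes that of the velocity, and the initial energy becomes that
  of \<open>y 0\<close>.\<close>

lemma velocity_integral:
  "\<exists>C\<ge>0. \<forall>x y T. orbit gen x y \<longrightarrow> T \<ge> 0 \<longrightarrow>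
    integral {0..T} (\<lambda>t. (norm (snd (x t)))\<^sup>2) \<le> C * ((norm (x 0))\<^sup>2 + (norm (y 0))\<^sup>2)"
proof -
  obtain c C where c: "c > 0" and C: "C \<ge> 0" and est: "\<forall>x y v T. orbit gen x y \<longrightarrow> potential x v \<longrightarrow> T \<ge> 0 \<longrightarrow>
    c * integral {0..T} (\<lambda>t. (norm (v t))\<^sup>2) \<le> C * integral {0..T} (\<lambda>t. dmp (v t)) + C * (norm (x 0))\<^sup>2"
    using lyapunov_integral by blast
  obtain A where A: "A > 0" "\<And>v. norm (mul \<alpha> v) \<le> A * norm v" using damping_bound by blast
  show ?thesis
  proof (intro exI[of _ "C / c"] conjI allI impI)
    show "C / c \<ge> 0" using c C by simp
    fix x y and T :: real assume x: "orbit gen x y" and T: "T \<ge> 0"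
    obtain v where v: "potential x v" using potential_exists[OF x] by blast
    define h where "h n = (1/2 :: real) ^ n" for n :: nat
    have hpos: "h n > 0" for n by (simp add: h_def)
    have h0: "h \<longlonglongrightarrow> 0" unfolding h_def[abs_def] by (rule LIMSEQ_power_zero) simp
    let ?M = "norm (x 0)"
    have quot: "(\<lambda>n. dq (h n) f t) \<longlonglongrightarrow> d" if d: "(f has_vector_derivative d) (at t within {0..})" and t: "t \<ge> 0"
      for f :: "real \<Rightarrow> 'x::real_normed_vector" and d t
    proof -
      have "((\<lambda>s. (1 / (s - t)) *\<^sub>R (f s - f t)) \<longlongrightarrow> d) (at t within {0..})"
        using d by (simp add: has_vector_derivative_tendsto)
      moreover have "(\<lambda>n. t + h n) \<longlonglongrightarrow> t" using tendsto_add[OF tendsto_const h0, of t] by simp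
      ultimately have "((\<lambda>s. (1 / (s - t)) *\<^sub>R (f s - f t)) \<circ> (\<lambda>n. t + h n)) \<longlonglongrightarrow> d"
        unfolding tendsto_at_iff_sequentially using hpos t by (auto simp: less_imp_le less_imp_neq[symmetric])
      then show ?thesis by (simp add: o_def dq_def)
    qed
    \<comment> \<open>The velocity is bounded by the initial norm, so the mean value inequality
      gives a majorant for dominated convergence independent of \<open>n\<close>.\<close>
    have vb: "norm (dq (h n) v t) \<le> ?M" if t: "t \<ge> 0" for n t
    proof -
      have "norm (v (t + h n) - v t) \<le> ?M * norm (t + h n - t)"
      proof (rule differentiable_bound[of "{0..}" v "\<lambda>r k. k *\<^sub>R snd (x r)"])
        show "(v has_derivative (\<lambda>k. k *\<^sub>R snd (x r))) (at r within {0..})" if "r \<in> {0..}" for r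
          using potential_derivative[OF x v, of r] that by (simp add: has_vector_derivative_def)
        show "onorm (\<lambda>k. k *\<^sub>R snd (x r)) \<le> ?M" if "r \<in> {0..}" for r
        proof (rule onorm_le)
          have "norm (snd (x r)) \<le> norm (x r)" by (metis norm_snd_le prod.collapse)
          also have "\<dots> \<le> ?M" using that by (intro orbit_norm_mono[OF x dissipative_gen]) auto
          finally show "norm (k *\<^sub>R snd (x r)) \<le> ?M * norm k" for k :: real
            by (simp add: mult.commute[of ?M] mult_left_mono)
        qed
      qed (use t hpos[of n] in auto)
      then show ?thesis using hpos[of n] by (simp add: dq_def divide_le_eq)
    qed
    have cv: "continuous_on {0..T} (dq (h n) v)" for n
      using hpos[of n]
      by (intro continuous_half_line[OF potential_derivative[OF orbit_dq[OF subspace_gen x] potential_dq[OF v]]]) auto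
    have lim: "(\<lambda>n. dq (h n) v t) \<longlonglongrightarrow> snd (x t)" if "t \<ge> 0" for t
      by (rule quot[OF potential_derivative[OF x v that] that])
    have l1: "(\<lambda>n. integral {0..T} (\<lambda>t. (norm (dq (h n) v t))\<^sup>2)) \<longlonglongrightarrow> integral {0..T} (\<lambda>t. (norm (snd (x t)))\<^sup>2)"
    proof (rule dominated_convergence(2)[where h="\<lambda>_. ?M\<^sup>2"])
      show "(\<lambda>t. (norm (dq (h n) v t))\<^sup>2) integrable_on {0..T}" for n
        by (intro integrable_continuous_real continuous_intros cv)
      show "norm ((norm (dq (h n) v t))\<^sup>2) \<le> ?M\<^sup>2" if "t \<in> {0..T}" for n t
        using vb[of t n] that by (simp add: power_mono)
      show "(\<lambda>n. (norm (dq (h n) v t))\<^sup>2) \<longlonglongrightarrow> (norm (snd (x t)))\<^sup>2" if "t \<in> {0..T}" for t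
        using that by (intro tendsto_intros lim) simp
    qed auto
    have l2: "(\<lambda>n. integral {0..T} (\<lambda>t. dmp (dq (h n) v t)))
       \<longlonglongrightarrow> integral {0..T} (\<lambda>t. dmp (snd (x t)))"
    proof (rule dominated_convergence(2)[where h="\<lambda>_. (A * ?M) * ?M"])
      show "(\<lambda>t. dmp (dq (h n) v t)) integrable_on {0..T}" for n
        by (intro integrable_continuous_real continuous_damping cv)
      show "norm (dmp (dq (h n) v t)) \<le> (A * ?M) * ?M" if "t \<in> {0..T}" for n t
      proof -
        have b: "norm (dq (h n) v t) \<le> ?M" using vb that by simp
        then have "norm (mul \<alpha> (dq (h n) v t)) \<le> A * ?M"
          using A by (intro order_trans[OF A(2)] mult_left_mono) auto
        then have "norm (mul \<alpha> (dq (h n) v t)) * norm (dq (h n) v t) \<le> (A * ?M) * ?M"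
          using b A(1) by (intro mult_mono) auto
        then show ?thesis using Cauchy_Schwarz_ineq2[of "mul \<alpha> (dq (h n) v t)" "dq (h n) v t"] by simp
      qed
      show "(\<lambda>n. dmp (dq (h n) v t)) \<longlonglongrightarrow> dmp (snd (x t))" if "t \<in> {0..T}" for t
        using that by (intro tendsto_inner bounded_linear.tendsto[OF bounded_linear_mul[OF bm_\<alpha>]] lim) auto
    qed auto
    have l3: "(\<lambda>n. (norm (dq (h n) x 0))\<^sup>2) \<longlonglongrightarrow> (norm (y 0))\<^sup>2"
      by (intro tendsto_intros quot[OF orbit_derivative[OF x]]) auto
    have "c * integral {0..T} (\<lambda>t. (norm (snd (x t)))\<^sup>2) \<le>
        C * integral {0..T} (\<lambda>t. dmp (snd (x t))) + C * (norm (y 0))\<^sup>2"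
    proof (rule LIMSEQ_le[OF tendsto_mult_left[OF l1] tendsto_add[OF tendsto_mult_left[OF l2] tendsto_mult_left[OF l3]]], intro exI allI impI)
      show "c * integral {0..T} (\<lambda>t. (norm (dq (h n) v t))\<^sup>2) \<le>
         C * integral {0..T} (\<lambda>t. dmp (dq (h n) v t)) + C * (norm (dq (h n) x 0))\<^sup>2" for n
        using hpos[of n] by (intro est[rule_format, OF orbit_dq[OF subspace_gen x] potential_dq[OF v] T]) auto
    qed
    also have "\<dots> \<le> C * (norm (x 0))\<^sup>2 + C * (norm (y 0))\<^sup>2"
      using dissipation_integral[OF x T] C zero_le_power2[of ?M] by (intro add_right_mono mult_left_mono) linarith+
    finally show "integral {0..T} (\<lambda>t. (norm (snd (x t)))\<^sup>2) \<le> C / c * ((norm (x 0))\<^sup>2 + (norm (y 0))\<^sup>2)"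
      using c by (simp add: field_simps)
  qed
qed

lemma weak_laplace_self: "(v, G) \<in> H1 \<Omega> \<Longrightarrow> weak_laplace \<Omega> G r \<Longrightarrow> inner r v = - (norm G)\<^sup>2"
  by (simp add: weak_laplaceD power2_norm_eq_inner)

lemma norm_Pair_power2: "(norm x)\<^sup>2 = (norm (fst x))\<^sup>2 + (norm (snd x))\<^sup>2"
  by (simp add: norm_prod_def)

text \<open>By equipartition the integrated energy is twice the integrated square of the velocity,
  up to the increment of \<open>J\<close>. Monotonicity bounds the integral below by
  \<open>T\<close> times the final value.\<close>

lemma energy_integral:
  "\<exists>C\<ge>0. \<forall>x y T. orbit gen x y \<longrightarrow> T \<ge> 0 \<longrightarrow>
    T * (norm (x T))\<^sup>2 \<le> C * ((norm (x 0))\<^sup>2 + (norm (y 0))\<^sup>2)"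
proof -
  obtain C where C: "C \<ge> 0" and est: "\<forall>x y T. orbit gen x y \<longrightarrow> T \<ge> 0 \<longrightarrow>
    integral {0..T} (\<lambda>t. (norm (snd (x t)))\<^sup>2) \<le> C * ((norm (x 0))\<^sup>2 + (norm (y 0))\<^sup>2)"
    using velocity_integral by blast
  obtain A where A: "A > 0" "\<And>v. norm (mul \<alpha> v) \<le> A * norm v" using damping_bound by blast
  obtain Cp where Cp: "Cp > 0" "\<And>v G. (v, G) \<in> H1 \<Omega> \<Longrightarrow> norm v \<le> Cp * norm G" using poincare_H1 by blast
  \<comment> \<open>A bound for \<open>J\<close> by Poincare's inequality: \<open>Cp\<close> for
    velocity times displacement, the rest for the friction summand.\<close>
  define D where "D = Cp + (A * Cp) * Cp / 2"
  have D: "D > 0" using A Cp by (simp add: D_def add_pos_nonneg)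
  show ?thesis
  proof (intro exI[of _ "2 * C + 2 * D"] conjI allI impI)
    show "2 * C + 2 * D \<ge> 0" using C D by simp
    fix x y and T :: real assume x: "orbit gen x y" and T: "T \<ge> 0"
    obtain v where v: "potential x v" using potential_exists[OF x] by blast
    have vG: "(v t, fst (x t)) \<in> H1 \<Omega>" if "t \<ge> 0" for t using v that by (simp add: potential_def)
    \<comment> \<open>The derivative of the second summand supplies the friction term of the
      equation, so that the equation tested with \<open>v\<close> turns the rest into minus the
      square of the gradient.\<close>
    define J where "J t = inner (snd (x t)) (v t) + (1/2) * dmp (v t)" for t
    have dJ: "(J has_vector_derivative ((norm (snd (x t)))\<^sup>2 - (norm (fst (x t)))\<^sup>2)) (at t within {0..})" if t: "t \<ge> 0" for t
    proof -
      note dv = potential_derivative[OF x v t]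
      have sym: "inner (mul \<alpha> (snd (x t))) (v t) = inner (mul \<alpha> (v t)) (snd (x t))"
        using inner_mul[OF bm_\<alpha>] by (metis inner_commute)
      have "(J has_vector_derivative (inner (snd (x t)) (snd (x t)) + inner (snd (y t)) (v t)) +
          (1/2) * (inner (mul \<alpha> (v t)) (snd (x t)) + inner (mul \<alpha> (snd (x t))) (v t))) (at t within {0..})"
        unfolding J_def[abs_def]
        by (intro has_vector_derivative_add has_vector_derivative_mult_right
            bounded_bilinear.has_vector_derivative[OF bounded_bilinear_inner] orbit_components[OF x t] dv
            bounded_linear.has_vector_derivative[OF bounded_linear_mul[OF bm_\<alpha>] dv])
      moreover have "inner (snd (y t)) (v t) + inner (mul \<alpha> (snd (x t))) (v t) = - (norm (fst (x t)))\<^sup>2"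
        using weak_laplace_self[OF vG[OF t] genD(3)[OF orbit_mem[OF x t]]] by (simp add: inner_add_left)
      moreover from this have "(inner (snd (x t)) (snd (x t)) + inner (snd (y t)) (v t)) +
          (1/2) * (inner (mul \<alpha> (v t)) (snd (x t)) + inner (mul \<alpha> (snd (x t))) (v t)) = (norm (snd (x t)))\<^sup>2 - (norm (fst (x t)))\<^sup>2"
      proof -
        have "(1/2) * (inner (mul \<alpha> (v t)) (snd (x t)) + inner (mul \<alpha> (snd (x t))) (v t)) = inner (mul \<alpha> (snd (x t))) (v t)"
          by (simp add: sym)
        with calculation(2) show ?thesis by (simp add: power2_norm_eq_inner[of "snd (x t)"])
      qed
      ultimately show ?thesis by simp
    qed
    have Jb: "\<bar>J t\<bar> \<le> D * (norm (x 0))\<^sup>2" if t: "t \<ge> 0" for t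
    proof -
      have nx: "norm (snd (x t)) \<le> norm (x 0)" "norm (fst (x t)) \<le> norm (x 0)"
        using orbit_norm_mono[OF x dissipative_gen order_refl t] norm_snd_le[of "snd (x t)" "fst (x t)"] norm_fst_le[of "fst (x t)" "snd (x t)"] by auto
      have nv: "norm (v t) \<le> Cp * norm (x 0)"
        using Cp nx by (intro order_trans[OF Cp(2)[OF vG[OF t]]] mult_left_mono) auto
      have "norm (mul \<alpha> (v t)) \<le> A * (Cp * norm (x 0))"
        using A nv by (intro order_trans[OF A(2)] mult_left_mono) auto
      then have "norm (mul \<alpha> (v t)) * norm (v t) \<le> (A * (Cp * norm (x 0))) * (Cp * norm (x 0))"
        using nv A Cp by (intro mult_mono) auto
      moreover have "norm (snd (x t)) * norm (v t) \<le> norm (x 0) * (Cp * norm (x 0))"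
        using nv nx by (intro mult_mono) auto
      moreover have "D * (norm (x 0))\<^sup>2 = norm (x 0) * (Cp * norm (x 0)) + (1/2) * ((A * (Cp * norm (x 0))) * (Cp * norm (x 0)))"
        by (simp add: D_def power2_eq_square algebra_simps)
      ultimately show ?thesis
        unfolding J_def using Cauchy_Schwarz_ineq2[of "snd (x t)" "v t"] Cauchy_Schwarz_ineq2[of "mul \<alpha> (v t)" "v t"]
        by linarith
    qed
    have cx: "continuous_on {0..T} x" by (rule continuous_half_line[OF orbit_derivative[OF x]])
    have i1: "(\<lambda>t. (norm (snd (x t)))\<^sup>2) integrable_on {0..T}"
      by (intro integrable_continuous_real continuous_intros cx)
    have i2: "((\<lambda>t. 2 * (norm (snd (x t)))\<^sup>2 - ((norm (snd (x t)))\<^sup>2 - (norm (fst (x t)))\<^sup>2)) has_integral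
       (2 * integral {0..T} (\<lambda>t. (norm (snd (x t)))\<^sup>2) - (J T - J 0))) {0..T}"
      by (intro has_integral_diff has_integral_mult_right integrable_integral i1 ftc_half_line[OF dJ T])
    have i3: "((\<lambda>t. (norm (x T))\<^sup>2) has_integral (T * (norm (x T))\<^sup>2)) {0..T}"
      using has_integral_const_real[of "(norm (x T))\<^sup>2" 0 T] T by simp
    have "T * (norm (x T))\<^sup>2 \<le> 2 * integral {0..T} (\<lambda>t. (norm (snd (x t)))\<^sup>2) - (J T - J 0)"
    proof (rule has_integral_le[OF i3 i2])
      fix t assume t: "t \<in> {0..T}"
      have "norm (x T) \<le> norm (x t)" using t by (intro orbit_norm_mono[OF x dissipative_gen]) auto
      then have "(norm (x T))\<^sup>2 \<le> (norm (x t))\<^sup>2" by (simp add: power_mono)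
      then show "(norm (x T))\<^sup>2 \<le> 2 * (norm (snd (x t)))\<^sup>2 - ((norm (snd (x t)))\<^sup>2 - (norm (fst (x t)))\<^sup>2)"
        unfolding norm_Pair_power2[of "x t"] by linarith
    qed
    also have "\<dots> \<le> 2 * (C * ((norm (x 0))\<^sup>2 + (norm (y 0))\<^sup>2)) + 2 * (D * (norm (x 0))\<^sup>2)"
      using est[rule_format, OF x T] Jb[OF order_refl] Jb[OF T] by linarith
    also have "\<dots> \<le> (2 * C + 2 * D) * ((norm (x 0))\<^sup>2 + (norm (y 0))\<^sup>2)"
      using D by (simp add: algebra_simps)
    finally show "T * (norm (x T))\<^sup>2 \<le> (2 * C + 2 * D) * ((norm (x 0))\<^sup>2 + (norm (y 0))\<^sup>2)" .
  qed
qed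

text \<open>The velocity is controlled by its gradient \<open>fst y\<close> through Poincare's
  inequality, then \<open>fst x\<close> by testing the equation with the displacement. This removes
  the initial energy from \<open>energy_integral\<close>.\<close>

lemma gen_lower_bound: "\<exists>C\<ge>0. \<forall>(x, y)\<in>gen. norm x \<le> C * norm y"
proof -
  obtain A where A: "A > 0" "\<And>v. norm (mul \<alpha> v) \<le> A * norm v" using damping_bound by blast
  obtain Cp where Cp: "Cp > 0" "\<And>v G. (v, G) \<in> H1 \<Omega> \<Longrightarrow> norm v \<le> Cp * norm G" using poincare_H1 by blast
  have "norm x \<le> ((1 + A * Cp) * Cp + Cp) * norm y" if xy: "(x, y) \<in> gen" for x y
  proof -
    obtain v where v: "(v, fst x) \<in> H1 \<Omega>" using genD(2)[OF xy] by blast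
    have ny: "norm (fst y) \<le> norm y" "norm (snd y) \<le> norm y"
      using norm_snd_le[of "snd y" "fst y"] norm_fst_le[of "fst y" "snd y"] by auto
    have p: "norm (snd x) \<le> Cp * norm y"
      using Cp ny by (intro order_trans[OF Cp(2)[OF genD(1)[OF xy]]] mult_left_mono) auto
    have r: "norm (snd y + mul \<alpha> (snd x)) \<le> (1 + A * Cp) * norm y"
    proof -
      have "norm (mul \<alpha> (snd x)) \<le> A * (Cp * norm y)"
        using A p by (intro order_trans[OF A(2)] mult_left_mono) auto
      then show ?thesis using ny norm_triangle_ineq[of "snd y" "mul \<alpha> (snd x)"] by (simp add: algebra_simps)
    qed
    have "(norm (fst x))\<^sup>2 \<le> \<bar>inner (snd y + mul \<alpha> (snd x)) v\<bar>"
      using weak_laplace_self[OF v genD(3)[OF xy]] by simp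
    also have "\<dots> \<le> norm (snd y + mul \<alpha> (snd x)) * norm v" by (rule Cauchy_Schwarz_ineq2)
    also have "\<dots> \<le> ((1 + A * Cp) * norm y) * (Cp * norm (fst x))"
      using r Cp(2)[OF v] A Cp by (intro mult_mono) auto
    finally have "norm (fst x) * norm (fst x) \<le> ((1 + A * Cp) * Cp * norm y) * norm (fst x)"
      by (simp add: power2_eq_square ac_simps)
    then have "norm (fst x) = 0 \<or> norm (fst x) \<le> (1 + A * Cp) * Cp * norm y"
      by (simp only: mult_le_cancel_right) auto
    then have "norm (fst x) \<le> (1 + A * Cp) * Cp * norm y" using A Cp by auto
    moreover have "norm x \<le> norm (fst x) + norm (snd x)" by (metis norm_Pair_le prod.collapse)
    ultimately show ?thesis using p by (simp add: distrib_right)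
  qed
  moreover have "(1 + A * Cp) * Cp + Cp \<ge> 0" using A Cp by simp
  ultimately show ?thesis by blast
qed

theorem one_step_decay:
  "\<exists>C\<ge>0. \<forall>x y T. orbit gen x y \<longrightarrow> T > 0 \<longrightarrow> norm (x T) \<le> C * T powr (-1/2) * norm (y 0)"
proof -
  obtain C where C: "C \<ge> 0" and est: "\<forall>x y T. orbit gen x y \<longrightarrow> T \<ge> 0 \<longrightarrow>
    T * (norm (x T))\<^sup>2 \<le> C * ((norm (x 0))\<^sup>2 + (norm (y 0))\<^sup>2)"
    using energy_integral by blast
  obtain D where D: "D \<ge> 0" "\<And>x y. (x, y) \<in> gen \<Longrightarrow> norm x \<le> D * norm y" using gen_lower_bound by blast
  define K where "K = C * (D\<^sup>2 + 1)"
  have K: "K \<ge> 0" using C by (simp add: K_def)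
  have "norm (x T) \<le> sqrt K * T powr (-1/2) * norm (y 0)" if x: "orbit gen x y" and T: "T > 0" for x y T
  proof -
    have "norm (x 0) \<le> D * norm (y 0)" by (rule D(2)[OF orbit_mem[OF x]]) simp
    then have "(norm (x 0))\<^sup>2 \<le> D\<^sup>2 * (norm (y 0))\<^sup>2" by (metis norm_ge_zero power_mono power_mult_distrib)
    then have "C * ((norm (x 0))\<^sup>2 + (norm (y 0))\<^sup>2) \<le> K * (norm (y 0))\<^sup>2"
      unfolding K_def mult.assoc using C by (intro mult_left_mono) (auto simp: distrib_right)
    then have "T * (norm (x T))\<^sup>2 \<le> K * (norm (y 0))\<^sup>2" using est[rule_format, OF x, of T] T by simp
    then have "(norm (x T))\<^sup>2 \<le> K * (norm (y 0))\<^sup>2 / T" using T by (simp add: field_simps)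
    then have "norm (x T) \<le> sqrt (K * (norm (y 0))\<^sup>2 / T)" by (rule real_le_rsqrt)
    also have "\<dots> = sqrt K * (1 / sqrt T) * norm (y 0)"
      by (simp add: real_sqrt_mult real_sqrt_divide)
    also have "1 / sqrt T = T powr (-1/2)"
      using T by (simp add: powr_minus_divide powr_half_sqrt)
    finally show ?thesis .
  qed
  then show ?thesis using K by (intro exI[of _ "sqrt K"]) auto
qed

end

section \<open>Uniqueness of weak gradients\<close>

lemma smooth_prod:
  fixes f :: "'i \<Rightarrow> 'a::euclidean_space \<Rightarrow> complex"
  shows "finite I \<Longrightarrow> (\<And>i. i \<in> I \<Longrightarrow> smooth_fun (f i)) \<Longrightarrow> smooth_fun (\<lambda>x. \<Prod>i\<in>I. f i x)"
  by (induction rule: finite_induct) (auto intro: smooth_const smooth_mult)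

lemma flat_1_scaled_tendsto:
  assumes "t > 0"
  shows "(\<lambda>n. flat 1 (real (Suc n) * t)) \<longlonglongrightarrow> 1"
proof -
  have "(\<lambda>n. exp (- ((1 / t) * inverse (real (Suc n))))) \<longlonglongrightarrow> exp (- ((1 / t) * 0))"
    by (intro tendsto_intros LIMSEQ_inverse_real_of_nat)
  moreover have "flat 1 (real (Suc n) * t) = exp (- ((1 / t) * inverse (real (Suc n))))" for n
  proof -
    have "real (Suc n) * t > 0" using assms by simp
    then show ?thesis by (simp add: flat_def divide_inverse del: of_nat_Suc)
  qed
  ultimately show ?thesis by simp
qed

text \<open>\<open>flat 1 (n * t)\<close> vanishes for \<open>t \<le> 0\<close> and tends to 1 for
  \<open>t > 0\<close>; products over the coordinates give smooth functions below the indicator of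
  the open box. The supports may fill the closed box, which therefore has to lie in
  \<open>\<Omega>\<close>.\<close>

lemma box_approximation:
  fixes a b :: "'a::euclidean_space"
  assumes "cbox a b \<subseteq> \<Omega>"
  obtains \<phi> :: "nat \<Rightarrow> 'a \<Rightarrow> real" where "\<And>n. test_fun \<Omega> (\<lambda>x. complex_of_real (\<phi> n x))"
    "\<And>n x. \<bar>\<phi> n x\<bar> \<le> indicator (box a b) x" "\<And>x. (\<lambda>n. \<phi> n x) \<longlonglongrightarrow> indicator (box a b) x"
proof -
  define F where "F n i x = flat 1 (real (Suc n) * (inner x i - inner a i)) * flat 1 (real (Suc n) * (inner b i - inner x i))"
    for n :: nat and i x :: 'a
  define \<phi> where "\<phi> n x = (\<Prod>i\<in>Basis. F n i x)" for n x
  have F: "0 \<le> F n i x" "F n i x \<le> 1" for n i x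
    unfolding F_def by (intro mult_nonneg_nonneg mult_le_one flat_1_nonneg flat_1_le_1)+
  have zero: "\<phi> n x = 0" if "x \<notin> box a b" for n x
  proof -
    obtain i where i: "i \<in> Basis" "inner x i \<le> inner a i \<or> inner b i \<le> inner x i"
      using \<open>x \<notin> box a b\<close> by (auto simp: mem_box not_less)
    then have "F n i x = 0"
      by (auto simp: F_def flat_def zero_less_mult_iff)
    then show ?thesis using i(1) by (auto simp: \<phi>_def)
  qed
  have bound: "\<bar>\<phi> n x\<bar> \<le> indicator (box a b) x" for n x
  proof (cases "x \<in> box a b")
    case True
    have "\<bar>\<phi> n x\<bar> = \<phi> n x" using F(1) by (simp add: \<phi>_def prod_nonneg)
    also have "\<dots> \<le> 1" unfolding \<phi>_def by (rule prod_le_1) (use F in auto)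
    finally show ?thesis using True by simp
  qed (simp add: zero)
  have lim: "(\<lambda>n. \<phi> n x) \<longlonglongrightarrow> indicator (box a b) x" for x
  proof (cases "x \<in> box a b")
    case True
    have "(\<lambda>n. F n i x) \<longlonglongrightarrow> 1 * 1" if "i \<in> Basis" for i
      unfolding F_def using True that by (intro tendsto_mult flat_1_scaled_tendsto) (auto simp: mem_box)
    then have "(\<lambda>n. \<phi> n x) \<longlonglongrightarrow> (\<Prod>i\<in>(Basis::'a set). 1 * 1)"
      unfolding \<phi>_def by (intro tendsto_prod) auto
    then show ?thesis using True by simp
  qed (simp add: zero)
  have test: "test_fun \<Omega> (\<lambda>x. complex_of_real (\<phi> n x))" for n
    unfolding test_fun_def
  proof (intro conjI)
    have n1: "nice (\<lambda>y. flat 1 (real (Suc n) * (y - c)))" for c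
      using nice_affine[OF nice_flat[of 1], of "real (Suc n)" "- real (Suc n) * c"] by (simp add: algebra_simps)
    have n2: "nice (\<lambda>y. flat 1 (real (Suc n) * (c - y)))" for c
      using nice_affine[OF nice_flat[of 1], of "- real (Suc n)" "real (Suc n) * c"] by (simp add: algebra_simps)
    have "smooth_fun (\<lambda>x. \<Prod>i\<in>(Basis::'a set). complex_of_real (flat 1 (real (Suc n) * (inner x i - inner a i))) *
        complex_of_real (flat 1 (real (Suc n) * (inner b i - inner x i))))"
      by (intro smooth_prod smooth_mult smooth_lift[OF n1] smooth_lift[OF n2]) simp
    then show "smooth_fun (\<lambda>x. complex_of_real (\<phi> n x))"
      by (simp add: \<phi>_def F_def)
    have "{x. complex_of_real (\<phi> n x) \<noteq> 0} \<subseteq> cbox a b"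
      using zero[of _ n] box_subset_cbox[of a b] by auto
    then have c: "closure {x. complex_of_real (\<phi> n x) \<noteq> 0} \<subseteq> cbox a b"
      by (rule closure_minimal) (rule closed_cbox)
    then show "closure {x. complex_of_real (\<phi> n x) \<noteq> 0} \<subseteq> \<Omega>" using assms by blast
    show "compact (closure {x. complex_of_real (\<phi> n x) \<noteq> 0})"
      using bounded_subset[OF bounded_cbox c] by (simp add: compact_eq_bounded_closed)
  qed
  show thesis by (rule that[OF test bound lim])
qed

lemma sqi_indicator_cbox: "sqi (indicator (cbox a b))"
proof (rule sqi_dominated[where g="indicator (cbox a b)"])
  show "integrable lebesgue (indicator (cbox a b) :: 'a \<Rightarrow> real)"
    by (intro integrable_real_indicator) (use lmeasurable_compact[OF compact_cbox[of a b]] in \<open>auto simp: fmeasurable_def\<close>)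
  show "(cmod (indicator (cbox a b) x))\<^sup>2 \<le> indicator (cbox a b) x" for x
    by (auto simp: indicator_def)
qed (rule borel_measurable_indicator, rule fmeasurableD[OF lmeasurable_cbox])

text \<open>Approximating indicators shows that \<open>f\<close> has integral zero over every closed
  box in \<open>\<Omega>\<close>; Lebesgue differentiation along shrinking cubes then gives zero
  almost everywhere.\<close>

lemma test_functions_total:
  fixes f :: "'a::euclidean_space \<Rightarrow> complex"
  assumes f: "sqi f" and \<Omega>: "open \<Omega>"
    and orth: "\<And>\<phi>. test_fun \<Omega> \<phi> \<Longrightarrow> (\<integral>x. f x * \<phi> x \<partial>lebesgue) = 0"
  shows "AE x in lebesgue. x \<in> \<Omega> \<longrightarrow> f x = 0"
proof -
  have loc: "set_integrable lebesgue (cbox a b) f" for a b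
  proof -
    have "(\<lambda>x. indicator (cbox a b) x * f x) = (\<lambda>x. indicator (cbox a b) x *\<^sub>R f x)"
      by (rule ext) (simp add: indicator_def)
    then show ?thesis
      using sqi_integrable_mult[OF sqi_indicator_cbox[of a b] f] by (simp add: set_integrable_def)
  qed
  have box0: "integral (cbox a b) f = 0" if ab: "cbox a b \<subseteq> \<Omega>" for a b
  proof -
    obtain \<phi> :: "nat \<Rightarrow> 'a \<Rightarrow> real" where \<phi>: "\<And>n. test_fun \<Omega> (\<lambda>x. complex_of_real (\<phi> n x))"
      "\<And>n x. \<bar>\<phi> n x\<bar> \<le> indicator (box a b) x" "\<And>x. (\<lambda>n. \<phi> n x) \<longlonglongrightarrow> indicator (box a b) x"
      using box_approximation[OF ab] by metis
    have lb: "set_integrable lebesgue (box a b) f"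
      by (rule set_integrable_subset[OF loc[of a b]]) (auto simp: box_subset_cbox)
    have "(\<lambda>n. \<integral>x. f x * complex_of_real (\<phi> n x) \<partial>lebesgue) \<longlonglongrightarrow> (\<integral>x. f x * indicator (box a b) x \<partial>lebesgue)"
    proof (rule integral_dominated_convergence[where w="\<lambda>x. norm (indicator (box a b) x *\<^sub>R f x)"])
      show "(\<lambda>x. f x * indicator (box a b) x) \<in> borel_measurable lebesgue"
        by (intro borel_measurable_times sqi_measurable[OF f] borel_measurable_indicator fmeasurableD[OF lmeasurable_box])
      show "(\<lambda>x. f x * complex_of_real (\<phi> n x)) \<in> borel_measurable lebesgue" for n
        by (intro borel_measurable_times sqi_measurable[OF f] sqi_measurable[OF test_sqi[OF \<phi>(1)]])
      show "integrable lebesgue (\<lambda>x. norm (indicator (box a b) x *\<^sub>R f x))"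
        using lb unfolding set_integrable_def by (rule integrable_norm)
      show "AE x in lebesgue. (\<lambda>n. f x * complex_of_real (\<phi> n x)) \<longlonglongrightarrow> f x * indicator (box a b) x"
      proof (rule AE_I2)
        fix x :: 'a
        have "(\<lambda>n. f x * complex_of_real (\<phi> n x)) \<longlonglongrightarrow> f x * complex_of_real (indicator (box a b) x)"
          by (intro tendsto_intros \<phi>(3))
        then show "(\<lambda>n. f x * complex_of_real (\<phi> n x)) \<longlonglongrightarrow> f x * indicator (box a b) x"
          by (cases "x \<in> box a b") auto
      qed
      show "AE x in lebesgue. norm (f x * complex_of_real (\<phi> n x)) \<le> norm (indicator (box a b) x *\<^sub>R f x)" for n
      proof (rule AE_I2)
        fix x :: 'a
        have "norm (f x) * \<bar>\<phi> n x\<bar> \<le> norm (f x) * indicator (box a b) x"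
          by (intro mult_left_mono \<phi>(2)) simp
        then show "norm (f x * complex_of_real (\<phi> n x)) \<le> norm (indicator (box a b) x *\<^sub>R f x)"
          by (simp add: norm_mult mult.commute)
      qed
    qed
    then have "(\<integral>x. f x * indicator (box a b) x \<partial>lebesgue) = 0"
      using orth[OF \<phi>(1)] by (simp add: LIMSEQ_const_iff)
    moreover have "(\<lambda>x. f x * indicator (box a b) x) = (\<lambda>x. indicator (box a b) x *\<^sub>R f x)"
      by (auto simp: indicator_def)
    ultimately have "(LINT x:box a b|lebesgue. f x) = 0" by (simp add: set_lebesgue_integral_def)
    then show ?thesis using set_lebesgue_integral_eq_integral(2)[OF lb] by (simp add: integral_open_interval)
  qed
  have "f integrable_on cbox a b" for a b
    by (rule set_lebesgue_integral_eq_integral(1)[OF loc])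
  then obtain N where N: "negligible N" "\<And>x e. \<lbrakk>x \<notin> N; 0 < e\<rbrakk> \<Longrightarrow>
      \<exists>d>0. \<forall>h. 0 < h \<and> h < d \<longrightarrow> norm (integral (cbox x (x + h *\<^sub>R One)) f /\<^sub>R h ^ DIM('a) - f x) < e"
    using integrable_ccontinuous_explicit[of f] by metis
  have "f x = 0" if x: "x \<in> \<Omega>" "x \<notin> N" for x
  proof (rule ccontr)
    assume "f x \<noteq> 0"
    then obtain d where d: "d > 0" "\<And>h. 0 < h \<Longrightarrow> h < d \<Longrightarrow>
        norm (integral (cbox x (x + h *\<^sub>R One)) f /\<^sub>R h ^ DIM('a) - f x) < norm (f x)"
      using N(2)[OF x(2), of "norm (f x)"] by auto
    obtain r where r: "r > 0" "ball x r \<subseteq> \<Omega>" using \<Omega> x(1) openE by blast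
    \<comment> \<open>More than the diagonal of the unit cube, so that \<open>h * k < r\<close>
      keeps the cube of side \<open>h\<close> in the ball.\<close>
    define k where "k = norm (One::'a) + 1"
    define h where "h = min (d / 2) (r / (2 * k))"
    have n1: "k > 0" by (simp add: k_def add_nonneg_pos)
    have h: "h > 0" "h < d" "h * k < r"
    proof -
      show "h > 0" "h < d" using d(1) r(1) n1 by (auto simp: h_def)
      have "h * k \<le> r / (2 * k) * k"
        using n1 by (intro mult_right_mono) (auto simp: h_def)
      also have "\<dots> < r" using n1 r(1) by simp
      finally show "h * k < r" .
    qed
    have "cbox x (x + h *\<^sub>R One) \<subseteq> \<Omega>"
    proof
      fix y assume y: "y \<in> cbox x (x + h *\<^sub>R One)"
      have "norm (y - x) \<le> norm (h *\<^sub>R One :: 'a)"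
      proof (rule norm_le_componentwise)
        fix b :: 'a assume b: "b \<in> Basis"
        then show "\<bar>inner (y - x) b\<bar> \<le> \<bar>inner (h *\<^sub>R One) b\<bar>"
          using y h(1) by (auto simp: mem_box inner_diff_left inner_add_left)
      qed
      also have "\<dots> \<le> h * k" using h(1) by (simp add: k_def)
      also have "\<dots> < r" by (rule h(3))
      finally show "y \<in> \<Omega>" using r(2) by (auto simp: dist_norm norm_minus_commute)
    qed
    from box0[OF this] d(2)[OF h(1,2)] show False by simp
  qed
  moreover have "N \<in> null_sets lebesgue" using N(1) by (simp add: negligible_iff_null_sets)
  ultimately show ?thesis by (intro AE_I'[of N]) auto
qed

section \<open>Functions on the domain as classes on the whole space\<close>

definition cls :: "'a::euclidean_space set \<Rightarrow> ('a \<Rightarrow> complex) \<Rightarrow> 'a l2" where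
  "cls \<Omega> u = abs_l2 (\<lambda>x. indicator \<Omega> x *\<^sub>R u x)"

definition gcl :: "'a::euclidean_space set \<Rightarrow> ('a \<Rightarrow> complex) \<Rightarrow> 'a gl2" where
  "gcl \<Omega> u = gmk (\<lambda>b. cls \<Omega> (grad \<Omega> u b))"

lemma L2_iff_sqi:
  assumes "\<Omega> \<in> sets lebesgue"
  shows "L2 \<Omega> u \<longleftrightarrow> sqi (\<lambda>x. indicator \<Omega> x *\<^sub>R u x)"
proof -
  have "(\<lambda>x. (cmod (indicator \<Omega> x *\<^sub>R u x))\<^sup>2) = (\<lambda>x. indicator \<Omega> x *\<^sub>R (cmod (u x))\<^sup>2)"
    by (auto simp: indicator_def)
  then show ?thesis
    using assms unfolding L2_def sqi_def
    by (simp add: borel_measurable_restrict_space_iff integrable_restrict_space)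
qed

lemma L2norm_cls:
  assumes "\<Omega> \<in> sets lebesgue" "L2 \<Omega> u"
  shows "L2norm \<Omega> u = norm (cls \<Omega> u)"
proof -
  have "(\<lambda>x. (cmod (indicator \<Omega> x *\<^sub>R u x))\<^sup>2) = (\<lambda>x. indicator \<Omega> x *\<^sub>R (cmod (u x))\<^sup>2)"
    by (auto simp: indicator_def)
  then show ?thesis
    using assms L2_iff_sqi[OF assms(1), of u] unfolding L2norm_def cls_def
    by (simp add: norm_abs_l2 integral_restrict_space)
qed

lemma L2_lincomb:
  assumes \<Omega>: "\<Omega> \<in> sets lebesgue" and u: "L2 \<Omega> u" and v: "L2 \<Omega> v"
  shows "L2 \<Omega> (\<lambda>x. c * u x + d * v x)"
proof -
  have "(\<lambda>x. indicator \<Omega> x *\<^sub>R (c * u x + d * v x)) = (\<lambda>x. c * (indicator \<Omega> x *\<^sub>R u x) + d * (indicator \<Omega> x *\<^sub>R v x))"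
    by (auto simp: indicator_def)
  then show ?thesis using u v unfolding L2_iff_sqi[OF \<Omega>] by (simp only: sqi_add sqi_cmult)
qed

lemma test_restrict:
  assumes "test_fun \<Omega> \<phi>" "\<Omega> \<in> sets lebesgue"
  shows "indicator \<Omega> x *\<^sub>R \<phi> x = \<phi> x" "L2 \<Omega> \<phi>" "cls \<Omega> \<phi> = abs_l2 \<phi>"
proof -
  have "indicator \<Omega> x *\<^sub>R \<phi> x = \<phi> x" for x
    using assms(1) closure_subset[of "{x. \<phi> x \<noteq> 0}"] by (auto simp: test_fun_def indicator_def)
  then show "indicator \<Omega> x *\<^sub>R \<phi> x = \<phi> x" "L2 \<Omega> \<phi>" "cls \<Omega> \<phi> = abs_l2 \<phi>"
    using test_sqi[OF assms(1)] by (simp_all add: cls_def L2_iff_sqi[OF assms(2)])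
qed

lemma L2_test_integrable:
  assumes \<Omega>: "\<Omega> \<in> sets lebesgue" and u: "L2 \<Omega> u" and \<phi>: "test_fun \<Omega> \<phi>"
  shows "integrable (lebesgue_on \<Omega>) (\<lambda>x. u x * \<phi> x)"
    and "(\<integral>x. u x * \<phi> x \<partial>lebesgue_on \<Omega>) = (\<integral>x. (indicator \<Omega> x *\<^sub>R u x) * \<phi> x \<partial>lebesgue)"
proof -
  have eq: "(\<lambda>x. indicator \<Omega> x *\<^sub>R (u x * \<phi> x)) = (\<lambda>x. (indicator \<Omega> x *\<^sub>R u x) * \<phi> x)" by (auto simp: indicator_def)
  have "integrable lebesgue (\<lambda>x. (indicator \<Omega> x *\<^sub>R u x) * \<phi> x)"
    using u unfolding L2_iff_sqi[OF \<Omega>] by (intro sqi_integrable_mult test_sqi[OF \<phi>])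
  moreover have "\<Omega> \<inter> space lebesgue \<in> sets lebesgue" using \<Omega> by simp
  ultimately show "integrable (lebesgue_on \<Omega>) (\<lambda>x. u x * \<phi> x)"
    "(\<integral>x. u x * \<phi> x \<partial>lebesgue_on \<Omega>) = (\<integral>x. (indicator \<Omega> x *\<^sub>R u x) * \<phi> x \<partial>lebesgue)"
    by (simp_all only: integrable_restrict_space integral_restrict_space eq)
qed

lemma L2_test_unique:
  assumes \<Omega>: "open \<Omega>" and u: "L2 \<Omega> u" and v: "L2 \<Omega> v"
    and eq: "\<And>\<phi>. test_fun \<Omega> \<phi> \<Longrightarrow> (\<integral>x. u x * \<phi> x \<partial>lebesgue_on \<Omega>) = (\<integral>x. v x * \<phi> x \<partial>lebesgue_on \<Omega>)"
  shows "cls \<Omega> u = cls \<Omega> v"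
proof -
  have S: "\<Omega> \<in> sets lebesgue" using \<Omega> by auto
  let ?u = "\<lambda>x. indicator \<Omega> x *\<^sub>R u x" and ?v = "\<lambda>x. indicator \<Omega> x *\<^sub>R v x"
  have s: "sqi ?u" "sqi ?v" using u v by (simp_all add: L2_iff_sqi[OF S])
  have "AE x in lebesgue. x \<in> \<Omega> \<longrightarrow> ?u x - ?v x = 0"
  proof (rule test_functions_total[OF sqi_diff[OF s] \<Omega>])
    fix \<phi> assume \<phi>: "test_fun \<Omega> \<phi>"
    have "(\<integral>x. (?u x - ?v x) * \<phi> x \<partial>lebesgue) = (\<integral>x. ?u x * \<phi> x - ?v x * \<phi> x \<partial>lebesgue)"
      by (simp add: left_diff_distrib)
    also have "\<dots> = (\<integral>x. ?u x * \<phi> x \<partial>lebesgue) - (\<integral>x. ?v x * \<phi> x \<partial>lebesgue)"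
      by (intro Bochner_Integration.integral_diff sqi_integrable_mult s test_sqi[OF \<phi>])
    also have "\<dots> = 0"
      using eq[OF \<phi>] L2_test_integrable(2)[OF S u \<phi>] L2_test_integrable(2)[OF S v \<phi>] by simp
    finally show "(\<integral>x. (?u x - ?v x) * \<phi> x \<partial>lebesgue) = 0" .
  qed
  then have "AE x in lebesgue. ?u x = ?v x"
    by eventually_elim (auto simp: indicator_def)
  then show ?thesis unfolding cls_def by (simp add: abs_l2_eq_iff s)
qed

lemma L2_grad_lincomb:
  assumes \<Omega>: "\<Omega> \<in> sets lebesgue" and u: "L2 \<Omega> u" "L2_grad \<Omega> u G" and v: "L2 \<Omega> v" "L2_grad \<Omega> v H"
  shows "L2_grad \<Omega> (\<lambda>x. c * u x + d * v x) (\<lambda>b x. c * G b x + d * H b x)"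
  unfolding L2_grad_def weak_grad_def
proof (intro conjI ballI allI impI)
  fix b :: 'a assume b: "b \<in> Basis"
  have GH: "L2 \<Omega> (G b)" "L2 \<Omega> (H b)" using u v b by (auto simp: L2_grad_def)
  show "L2 \<Omega> (\<lambda>x. c * G b x + d * H b x)" by (rule L2_lincomb[OF \<Omega> GH])
  fix \<phi> assume \<phi>: "test_fun \<Omega> \<phi>"
  have lin: "(\<integral>x. (c * f x + d * g x) * \<psi> x \<partial>lebesgue_on \<Omega>) =
      c * (\<integral>x. f x * \<psi> x \<partial>lebesgue_on \<Omega>) + d * (\<integral>x. g x * \<psi> x \<partial>lebesgue_on \<Omega>)"
    if "L2 \<Omega> f" "L2 \<Omega> g" "test_fun \<Omega> \<psi>" for f g \<psi>
  proof -
    have "(\<integral>x. (c * f x + d * g x) * \<psi> x \<partial>lebesgue_on \<Omega>) = (\<integral>x. c * (f x * \<psi> x) + d * (g x * \<psi> x) \<partial>lebesgue_on \<Omega>)"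
      by (simp add: algebra_simps)
    also have "\<dots> = c * (\<integral>x. f x * \<psi> x \<partial>lebesgue_on \<Omega>) + d * (\<integral>x. g x * \<psi> x \<partial>lebesgue_on \<Omega>)"
      using L2_test_integrable(1)[OF \<Omega> that(1,3)] L2_test_integrable(1)[OF \<Omega> that(2,3)] by simp
    finally show ?thesis .
  qed
  have "(\<integral>x. u x * pd \<phi> b x \<partial>lebesgue_on \<Omega>) = - (\<integral>x. G b x * \<phi> x \<partial>lebesgue_on \<Omega>)"
    "(\<integral>x. v x * pd \<phi> b x \<partial>lebesgue_on \<Omega>) = - (\<integral>x. H b x * \<phi> x \<partial>lebesgue_on \<Omega>)"
    using u v b \<phi> by (auto simp: L2_grad_def weak_grad_def)
  then show "(\<integral>x. (c * u x + d * v x) * pd \<phi> b x \<partial>lebesgue_on \<Omega>) = - (\<integral>x. (c * G b x + d * H b x) * \<phi> x \<partial>lebesgue_on \<Omega>)"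
    by (simp add: lin[OF u(1) v(1) test_pd[OF \<phi> b]] lin[OF GH \<phi>])
qed

lemma L2_grad_grad: "L2_grad \<Omega> u G \<Longrightarrow> L2_grad \<Omega> u (grad \<Omega> u)"
  unfolding grad_def by (rule someI[of "L2_grad \<Omega> u"])

text \<open>\<open>grad\<close> picks one weak gradient by \<open>SOME\<close>; only its class is
  determined, and through this class the gradient becomes linear.\<close>

lemma L2_grad_unique:
  assumes "open \<Omega>" "L2_grad \<Omega> u G" "b \<in> Basis"
  shows "cls \<Omega> (grad \<Omega> u b) = cls \<Omega> (G b)"
  by (rule L2_test_unique[OF assms(1)])
     (use L2_grad_grad[OF assms(2)] assms in \<open>auto simp: L2_grad_def weak_grad_def\<close>)

lemma cls_lincomb:
  assumes \<Omega>: "\<Omega> \<in> sets lebesgue" and u: "L2 \<Omega> u" and v: "L2 \<Omega> v"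
  shows "cls \<Omega> (\<lambda>x. of_real r * u x + of_real s * v x) = r *\<^sub>R cls \<Omega> u + s *\<^sub>R cls \<Omega> v"
proof -
  have s: "sqi (\<lambda>x. indicator \<Omega> x *\<^sub>R u x)" "sqi (\<lambda>x. indicator \<Omega> x *\<^sub>R v x)" using u v by (simp_all add: L2_iff_sqi[OF \<Omega>])
  have "(\<lambda>x. indicator \<Omega> x *\<^sub>R (of_real r * u x + of_real s * v x)) =
      (\<lambda>x. r *\<^sub>R (indicator \<Omega> x *\<^sub>R u x) + s *\<^sub>R (indicator \<Omega> x *\<^sub>R v x))"
    by (auto simp: indicator_def scaleR_conv_of_real)
  then show ?thesis
    unfolding cls_def
    by (simp only: abs_l2_add[OF sqi_scaleR[OF s(1)] sqi_scaleR[OF s(2)]] abs_l2_scaleR[OF s(1)] abs_l2_scaleR[OF s(2)])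
qed

lemma norm_cls_cmult:
  assumes \<Omega>: "\<Omega> \<in> sets lebesgue" and u: "L2 \<Omega> u"
  shows "norm (cls \<Omega> (\<lambda>x. c * u x)) = cmod c * norm (cls \<Omega> u)"
proof -
  have s: "sqi (\<lambda>x. indicator \<Omega> x *\<^sub>R u x)" using u by (simp add: L2_iff_sqi[OF \<Omega>])
  have e: "(\<lambda>x. indicator \<Omega> x *\<^sub>R (c * u x)) = (\<lambda>x. c * (indicator \<Omega> x *\<^sub>R u x))" by auto
  have "(norm (cls \<Omega> (\<lambda>x. c * u x)))\<^sup>2 = (cmod c * norm (cls \<Omega> u))\<^sup>2"
    unfolding cls_def e power_mult_distrib norm_abs_l2_power2[OF s] norm_abs_l2_power2[OF sqi_cmult[OF s]]
    by (simp only: norm_mult power_mult_distrib integral_mult_right_zero)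
  then show ?thesis by (simp add: power2_eq_iff_nonneg)
qed

lemma cls_cong_AE:
  assumes \<Omega>: "\<Omega> \<in> sets lebesgue" and u: "L2 \<Omega> u" and v: "L2 \<Omega> v" and ae: "AE x in lebesgue_on \<Omega>. u x = v x"
  shows "cls \<Omega> u = cls \<Omega> v"
proof -
  have "AE x in lebesgue. x \<in> \<Omega> \<longrightarrow> u x = v x" using ae \<Omega> by (simp add: AE_restrict_space_iff)
  then have "AE x in lebesgue. indicator \<Omega> x *\<^sub>R u x = indicator \<Omega> x *\<^sub>R v x"
    by eventually_elim (auto simp: indicator_def)
  then show ?thesis using u v unfolding cls_def by (simp add: abs_l2_eq_iff L2_iff_sqi[OF \<Omega>])
qed

lemma inner_cls_test:
  assumes \<Omega>: "\<Omega> \<in> sets lebesgue" and u: "L2 \<Omega> u" and \<phi>: "test_fun \<Omega> \<phi>"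
  shows "inner (cls \<Omega> u) (abs_l2 \<phi>) = Re (\<integral>x. u x * cnj (\<phi> x) \<partial>lebesgue_on \<Omega>)"
proof -
  have s: "sqi (\<lambda>x. indicator \<Omega> x *\<^sub>R u x)" using u by (simp add: L2_iff_sqi[OF \<Omega>])
  have t: "test_fun \<Omega> (\<lambda>x. cnj (\<phi> x))" by (rule test_bounded_linear[OF \<phi> bounded_linear_cnj])
  show ?thesis
    unfolding cls_def inner_abs_l2[OF s test_sqi[OF \<phi>]] L2_test_integrable(2)[OF \<Omega> u t] inner_eq_Re_mult_cnj
    by (intro integral_Re sqi_integrable_mult s test_sqi[OF t])
qed

section \<open>The damped wave equation\<close>

text \<open>The second component of a \<^typ>\<open>'a state\<close> is \<open>\<i> u\<^sub>t\<close>, hence the factor \<open>-\<i>\<close>.\<close>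

definition conv :: "'a::euclidean_space set \<Rightarrow> 'a state \<Rightarrow> 'a gl2 \<times> 'a l2" where
  "conv \<Omega> U = (gcl \<Omega> (fst U), cls \<Omega> (\<lambda>x. - \<i> * snd U x))"

text \<open>What the energy norm requires of a state. Unlike \<open>ED\<close> it asks for no
  approximation by test functions, so it passes to difference quotients directly.\<close>

definition pre_state :: "'a::euclidean_space set \<Rightarrow> 'a state \<Rightarrow> bool" where
  "pre_state \<Omega> U \<longleftrightarrow> L2 \<Omega> (fst U) \<and> (\<exists>G. L2_grad \<Omega> (fst U) G) \<and> L2 \<Omega> (snd U)"

lemma ED_pre_state: "ED \<Omega> U \<Longrightarrow> pre_state \<Omega> U"
  by (auto simp: ED_def H01_def pre_state_def)

lemma L2_cmult: "\<Omega> \<in> sets lebesgue \<Longrightarrow> L2 \<Omega> u \<Longrightarrow> L2 \<Omega> (\<lambda>x. c * u x)"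
  using L2_lincomb[of \<Omega> u u c 0] by simp

lemma EDnorm_conv:
  assumes \<Omega>: "open \<Omega>" and U: "pre_state \<Omega> U"
  shows "EDnorm \<Omega> U = norm (conv \<Omega> U)"
proof -
  have S: "\<Omega> \<in> sets lebesgue" using \<Omega> by auto
  obtain G where G: "L2_grad \<Omega> (fst U) G" using U by (auto simp: pre_state_def)
  have g: "L2_grad \<Omega> (fst U) (grad \<Omega> (fst U))" by (rule L2_grad_grad[OF G])
  have "(norm (gcl \<Omega> (fst U)))\<^sup>2 = (\<Sum>b\<in>Basis. (L2norm \<Omega> (grad \<Omega> (fst U) b))\<^sup>2)"
    unfolding norm_gl2_power2 using g by (intro sum.cong) (auto simp: gcl_def L2_grad_def L2norm_cls[OF S])
  moreover have "norm (cls \<Omega> (\<lambda>x. - \<i> * snd U x)) = L2norm \<Omega> (snd U)"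
    using U norm_cls_cmult[OF S, of "snd U" "- \<i>"] by (simp add: pre_state_def L2norm_cls[OF S])
  ultimately show ?thesis by (simp add: EDnorm_def conv_def norm_prod_def)
qed

text \<open>Differences and real multiples of states are both instances, so linearity is proved
  once.\<close>

definition lc :: "real \<Rightarrow> 'a state \<Rightarrow> real \<Rightarrow> 'a state \<Rightarrow> 'a state" where
  "lc r U s V = ((\<lambda>x. of_real r * fst U x + of_real s * fst V x), (\<lambda>x. of_real r * snd U x + of_real s * snd V x))"

lemma st_diff_lc: "st_diff U V = lc 1 U (-1) V"
  by (simp add: st_diff_def lc_def)

lemma st_scale_lc: "st_scale (of_real r) U = lc r U 0 U"
  by (simp add: st_scale_def lc_def)

lemma conv_lc:
  assumes \<Omega>: "open \<Omega>" and U: "pre_state \<Omega> U" and V: "pre_state \<Omega> V"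
  shows "pre_state \<Omega> (lc r U s V)" "conv \<Omega> (lc r U s V) = r *\<^sub>R conv \<Omega> U + s *\<^sub>R conv \<Omega> V"
proof -
  have S: "\<Omega> \<in> sets lebesgue" using \<Omega> by auto
  obtain G where G: "L2_grad \<Omega> (fst U) G" using U by (auto simp: pre_state_def)
  obtain H where H: "L2_grad \<Omega> (fst V) H" using V by (auto simp: pre_state_def)
  have UV: "L2 \<Omega> (fst U)" "L2 \<Omega> (snd U)" "L2 \<Omega> (fst V)" "L2 \<Omega> (snd V)" using U V by (auto simp: pre_state_def)
  have gU: "L2_grad \<Omega> (fst U) (grad \<Omega> (fst U))" by (rule L2_grad_grad[OF G])
  have gV: "L2_grad \<Omega> (fst V) (grad \<Omega> (fst V))" by (rule L2_grad_grad[OF H])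
  note gl = L2_grad_lincomb[OF S UV(1) gU UV(3) gV, of "of_real r" "of_real s"]
  show "pre_state \<Omega> (lc r U s V)"
    unfolding pre_state_def lc_def using gl UV by (auto intro: L2_lincomb[OF S])
  have "gcl \<Omega> (fst (lc r U s V)) = r *\<^sub>R gcl \<Omega> (fst U) + s *\<^sub>R gcl \<Omega> (fst V)"
  proof (rule gl2_eqI)
    fix b :: 'a assume b: "b \<in> Basis"
    have "cls \<Omega> (grad \<Omega> (fst (lc r U s V)) b) = cls \<Omega> (\<lambda>x. of_real r * grad \<Omega> (fst U) b x + of_real s * grad \<Omega> (fst V) b x)"
      using L2_grad_unique[OF \<Omega> gl b] by (simp add: lc_def)
    also have "\<dots> = r *\<^sub>R cls \<Omega> (grad \<Omega> (fst U) b) + s *\<^sub>R cls \<Omega> (grad \<Omega> (fst V) b)"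
      using gU gV b by (intro cls_lincomb[OF S]) (auto simp: L2_grad_def)
    finally show "gcomp (gcl \<Omega> (fst (lc r U s V))) b = gcomp (r *\<^sub>R gcl \<Omega> (fst U) + s *\<^sub>R gcl \<Omega> (fst V)) b"
      using b by (simp add: gcl_def)
  qed
  moreover have "cls \<Omega> (\<lambda>x. - \<i> * snd (lc r U s V) x) = r *\<^sub>R cls \<Omega> (\<lambda>x. - \<i> * snd U x) + s *\<^sub>R cls \<Omega> (\<lambda>x. - \<i> * snd V x)"
  proof -
    have "(\<lambda>x. - \<i> * snd (lc r U s V) x) = (\<lambda>x. of_real r * (- \<i> * snd U x) + of_real s * (- \<i> * snd V x))"
      by (rule ext) (simp add: lc_def algebra_simps)
    then show ?thesis
      using cls_lincomb[OF S L2_cmult[OF S UV(2), of "- \<i>"] L2_cmult[OF S UV(4), of "- \<i>"], of r s] by simp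
  qed
  ultimately show "conv \<Omega> (lc r U s V) = r *\<^sub>R conv \<Omega> U + s *\<^sub>R conv \<Omega> V"
    by (simp add: conv_def)
qed

lemma gmk_tendsto:
  assumes "\<And>b. b \<in> Basis \<Longrightarrow> (\<lambda>m. f m b) \<longlonglongrightarrow> g b"
  shows "(\<lambda>m. gmk (f m)) \<longlonglongrightarrow> gmk g"
proof -
  have lim: "(\<lambda>m. \<Sum>b\<in>Basis. norm (f m b - g b)) \<longlonglongrightarrow> (\<Sum>b\<in>(Basis::'a set). norm (g b - g b))"
    by (intro tendsto_intros assms)
  have "norm (gmk (f m) - gmk g) \<le> (\<Sum>b\<in>Basis. norm (f m b - g b))" for m
    using norm_gl2_le_sum[of "gmk (f m) - gmk g"] by simp
  then have ev: "\<forall>\<^sub>F m in sequentially. norm (gmk (f m) - gmk g) \<le> (\<Sum>b\<in>Basis. norm (f m b - g b))"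
    by (intro always_eventually allI)
  have "(\<lambda>m. gmk (f m) - gmk g) \<longlonglongrightarrow> 0"
    by (rule Lim_null_comparison[OF ev]) (use lim in simp)
  then show ?thesis by (rule LIM_zero_cancel)
qed

text \<open>The factor \<open>c\<close> is included because \<open>l2\<close> carries real multiples
  only, while phases such as \<open>- \<i>\<close> have to be applied to states.\<close>

lemma H01_H1:
  assumes \<Omega>: "open \<Omega>" and u: "H01 \<Omega> u"
  shows "(cls \<Omega> (\<lambda>x. c * u x), gcl \<Omega> (\<lambda>x. c * u x)) \<in> H1 \<Omega>"
proof -
  have S: "\<Omega> \<in> sets lebesgue" using \<Omega> by auto
  obtain G \<phi> where L: "L2 \<Omega> u" and G: "L2_grad \<Omega> u G" and \<phi>: "\<And>m. test_fun \<Omega> (\<phi> m)"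
    and l0: "(\<lambda>m. L2norm \<Omega> (\<lambda>x. \<phi> m x - u x)) \<longlonglongrightarrow> 0"
    and lb: "\<And>b. b \<in> Basis \<Longrightarrow> (\<lambda>m. L2norm \<Omega> (\<lambda>x. pd (\<phi> m) b x - G b x)) \<longlonglongrightarrow> 0"
    using u unfolding H01_def by auto
  have LG: "L2 \<Omega> (G b)" if "b \<in> Basis" for b using G that by (simp add: L2_grad_def)
  have conv: "(\<lambda>m. abs_l2 (\<lambda>x. c * \<psi> m x)) \<longlonglongrightarrow> cls \<Omega> (\<lambda>x. c * w x)"
    if \<psi>: "\<And>m. test_fun \<Omega> (\<psi> m)" and w: "L2 \<Omega> w" and l: "(\<lambda>m. L2norm \<Omega> (\<lambda>x. \<psi> m x - w x)) \<longlonglongrightarrow> 0" for \<psi> w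
  proof -
    have eq: "norm (abs_l2 (\<lambda>x. c * \<psi> m x) - cls \<Omega> (\<lambda>x. c * w x)) = cmod c * L2norm \<Omega> (\<lambda>x. \<psi> m x - w x)" for m
    proof -
      have t: "test_fun \<Omega> (\<lambda>x. c * \<psi> m x)" by (rule test_bounded_linear[OF \<psi> bounded_linear_mult_right])
      have d: "L2 \<Omega> (\<lambda>x. \<psi> m x - w x)" using L2_lincomb[OF S test_restrict(2)[OF \<psi> S] w, where c=1 and d="-1"] by simp
      have "abs_l2 (\<lambda>x. c * \<psi> m x) - cls \<Omega> (\<lambda>x. c * w x) = cls \<Omega> (\<lambda>x. c * (\<psi> m x - w x))"
        using cls_lincomb[OF S test_restrict(2)[OF t S] L2_cmult[OF S w, of c], where r=1 and s="-1"]
        by (simp add: test_restrict(3)[OF t S] right_diff_distrib)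
      then show ?thesis by (simp add: norm_cls_cmult[OF S d] L2norm_cls[OF S d])
    qed
    have "(\<lambda>m. cmod c * L2norm \<Omega> (\<lambda>x. \<psi> m x - w x)) \<longlonglongrightarrow> cmod c * 0" by (intro tendsto_intros l)
    then have "(\<lambda>m. norm (abs_l2 (\<lambda>x. c * \<psi> m x) - cls \<Omega> (\<lambda>x. c * w x))) \<longlonglongrightarrow> 0"
      unfolding eq by simp
    then show ?thesis by (simp add: tendsto_norm_zero_iff LIM_zero_iff)
  qed
  have t: "test_fun \<Omega> (\<lambda>x. c * \<phi> m x)" for m by (rule test_bounded_linear[OF \<phi> bounded_linear_mult_right])
  have gr: "gcl \<Omega> (\<lambda>x. c * u x) = gmk (\<lambda>b. cls \<Omega> (\<lambda>x. c * G b x))"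
  proof (rule gl2_eqI)
    fix b :: 'a assume b: "b \<in> Basis"
    have "L2_grad \<Omega> (\<lambda>x. c * u x) (\<lambda>b x. c * G b x)"
      using L2_grad_lincomb[OF S L G L G, of c 0] by simp
    from L2_grad_unique[OF \<Omega> this b]
    show "gcomp (gcl \<Omega> (\<lambda>x. c * u x)) b = gcomp (gmk (\<lambda>b. cls \<Omega> (\<lambda>x. c * G b x))) b"
      using b by (simp add: gcl_def)
  qed
  have gphi: "grd (\<lambda>x. c * \<phi> m x) = gmk (\<lambda>b. abs_l2 (\<lambda>x. c * pd (\<phi> m) b x))" for m
  proof -
    have "pd (\<lambda>x. c * \<phi> m x) b = (\<lambda>x. c * pd (\<phi> m) b x)" for b
      by (rule ext, rule pd_bounded_linear[OF bounded_linear_mult_right smooth_differentiable[OF test_smooth[OF \<phi>]]])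
    then show ?thesis by (simp add: grd_def)
  qed
  have lim: "(\<lambda>m. (abs_l2 (\<lambda>x. c * \<phi> m x), grd (\<lambda>x. c * \<phi> m x))) \<longlonglongrightarrow> (cls \<Omega> (\<lambda>x. c * u x), gcl \<Omega> (\<lambda>x. c * u x))"
    unfolding gr gphi
    by (intro tendsto_Pair gmk_tendsto conv \<phi> L l0 test_pd LG lb)
  show ?thesis
    by (rule closed_sequentially[OF closed_H1 _ lim]) (rule H1_test[OF t])
qed

text \<open>\<open>graphA\<close> pairs without conjugation, the inner product with it; testing with
  the conjugate function reconciles the two.\<close>

lemma grd_cnj_sum:
  assumes \<Omega>: "\<Omega> \<in> sets lebesgue" and G: "\<And>b. b \<in> Basis \<Longrightarrow> L2 \<Omega> (G b)" and \<phi>: "test_fun \<Omega> \<phi>"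
  shows "inner (gmk (\<lambda>b. cls \<Omega> (\<lambda>x. c * G b x))) (grd \<phi>) =
    Re (c * (\<integral>x. (\<Sum>b\<in>Basis. G b x * pd (\<lambda>x. cnj (\<phi> x)) b x) \<partial>lebesgue_on \<Omega>))"
proof -
  have pdc: "pd (\<lambda>x. cnj (\<phi> x)) b = (\<lambda>x. cnj (pd \<phi> b x))" for b
    by (rule ext, rule pd_bounded_linear[OF bounded_linear_cnj smooth_differentiable[OF test_smooth[OF \<phi>]]])
  have t: "test_fun \<Omega> (\<lambda>x. cnj (pd \<phi> b x))" if "b \<in> Basis" for b
    by (rule test_bounded_linear[OF test_pd[OF \<phi> that] bounded_linear_cnj])
  have "inner (gmk (\<lambda>b. cls \<Omega> (\<lambda>x. c * G b x))) (grd \<phi>) = (\<Sum>b\<in>Basis. Re (c * (\<integral>x. G b x * cnj (pd \<phi> b x) \<partial>lebesgue_on \<Omega>)))"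
    unfolding inner_gl2_def
  proof (rule sum.cong[OF refl])
    fix b :: 'a assume b: "b \<in> Basis"
    have "inner (cls \<Omega> (\<lambda>x. c * G b x)) (abs_l2 (pd \<phi> b)) = Re (\<integral>x. c * G b x * cnj (pd \<phi> b x) \<partial>lebesgue_on \<Omega>)"
      by (rule inner_cls_test[OF \<Omega> L2_cmult[OF \<Omega> G[OF b]] test_pd[OF \<phi> b]])
    also have "(\<integral>x. c * G b x * cnj (pd \<phi> b x) \<partial>lebesgue_on \<Omega>) = c * (\<integral>x. G b x * cnj (pd \<phi> b x) \<partial>lebesgue_on \<Omega>)"
      by (simp add: mult.assoc)
    finally show "inner (gcomp (gmk (\<lambda>b. cls \<Omega> (\<lambda>x. c * G b x))) b) (gcomp (grd \<phi>) b) = Re (c * (\<integral>x. G b x * cnj (pd \<phi> b x) \<partial>lebesgue_on \<Omega>))"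
      using b by (simp add: grd_def)
  qed
  also have "\<dots> = Re (c * (\<Sum>b\<in>Basis. (\<integral>x. G b x * cnj (pd \<phi> b x) \<partial>lebesgue_on \<Omega>)))"
    by (simp only: sum_distrib_left Re_sum)
  also have "(\<Sum>b\<in>Basis. (\<integral>x. G b x * cnj (pd \<phi> b x) \<partial>lebesgue_on \<Omega>)) = (\<integral>x. (\<Sum>b\<in>Basis. G b x * cnj (pd \<phi> b x)) \<partial>lebesgue_on \<Omega>)"
    by (rule Bochner_Integration.integral_sum[symmetric]) (rule L2_test_integrable(1)[OF \<Omega> G t])
  finally show ?thesis by (simp add: pdc)
qed

context waveguide
begin

lemma mul_\<alpha>_cls:
  assumes a: "\<And>x. x \<in> \<Omega> \<Longrightarrow> \<alpha> x = a x" and u: "L2 \<Omega> u"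
  shows "L2 \<Omega> (\<lambda>x. of_real (a x) * u x)" "mul \<alpha> (cls \<Omega> u) = cls \<Omega> (\<lambda>x. of_real (a x) * u x)"
proof -
  have s: "sqi (\<lambda>x. indicator \<Omega> x *\<^sub>R u x)" using u by (simp only: L2_iff_sqi[OF \<Omega>_sets])
  have e: "(\<lambda>x. indicator \<Omega> x *\<^sub>R (of_real (a x) * u x)) = (\<lambda>x. \<alpha> x *\<^sub>R (indicator \<Omega> x *\<^sub>R u x))"
    using a by (auto simp: indicator_def scaleR_conv_of_real)
  show "L2 \<Omega> (\<lambda>x. of_real (a x) * u x)" unfolding L2_iff_sqi[OF \<Omega>_sets] e by (rule sqi_mul[OF bm_\<alpha> s])
  show "mul \<alpha> (cls \<Omega> u) = cls \<Omega> (\<lambda>x. of_real (a x) * u x)"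
    unfolding cls_def e by (rule mul_abs_l2[OF bm_\<alpha> s])
qed

text \<open>\<open>gen\<close> is the real form of \<open>- \<i>\<close> times the operator, so the
  image \<open>V\<close> has to be multiplied by \<open>- \<i>\<close>. The common phase
  \<open>c\<close> lets the relation be iterated.\<close>

lemma graphA_gen:
  assumes \<Omega>: "open \<Omega>" and a: "\<And>x. x \<in> \<Omega> \<Longrightarrow> \<alpha> x = a x" and A: "graphA \<Omega> a U V"
  shows "(conv \<Omega> (st_scale c U), conv \<Omega> (st_scale (- \<i> * c) V)) \<in> gen"
proof -
  note S = \<Omega>_sets
  have U: "ED \<Omega> U" and V: "ED \<Omega> V" and ae: "AE x in lebesgue_on \<Omega>. fst V x = snd U x"
    and eq: "\<And>\<phi>. test_fun \<Omega> \<phi> \<Longrightarrow> (\<integral>x. (snd V x + \<i> * complex_of_real (a x) * snd U x) * \<phi> x \<partial>lebesgue_on \<Omega>)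
         = (\<integral>x. (\<Sum>b\<in>Basis. grad \<Omega> (fst U) b x * pd \<phi> b x) \<partial>lebesgue_on \<Omega>)"
    using A unfolding graphA_def by blast+
  have H: "H01 \<Omega> (fst U)" "H01 \<Omega> (fst V)" and L: "L2 \<Omega> (snd U)" "L2 \<Omega> (snd V)" "L2 \<Omega> (fst U)" "L2 \<Omega> (fst V)"
    using U V by (auto simp: ED_def H01_def)
  define f where "f x = snd V x + \<i> * complex_of_real (a x) * snd U x" for x
  have Lf: "L2 \<Omega> f"
    using L2_lincomb[OF S L(2) mul_\<alpha>_cls(1)[OF a L(1)], of 1 \<i>] by (simp add: f_def[abs_def] mult.assoc)
  define G p P q where "G = gcl \<Omega> (\<lambda>x. c * fst U x)" and "p = cls \<Omega> (\<lambda>x. - \<i> * (c * snd U x))"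
    and "P = gcl \<Omega> (\<lambda>x. (- \<i> * c) * fst V x)" and "q = cls \<Omega> (\<lambda>x. - \<i> * ((- \<i> * c) * snd V x))"
  have conv: "conv \<Omega> (st_scale c U) = (G, p)" "conv \<Omega> (st_scale (- \<i> * c) V) = (P, q)"
    by (simp_all add: conv_def st_scale_def G_def p_def P_def q_def)
  have p_eq: "p = cls \<Omega> (\<lambda>x. (- \<i> * c) * fst V x)"
    unfolding p_def
  proof (rule cls_cong_AE[OF S])
    show "L2 \<Omega> (\<lambda>x. - \<i> * (c * snd U x))" "L2 \<Omega> (\<lambda>x. (- \<i> * c) * fst V x)" by (intro L2_cmult S L)+
    show "AE x in lebesgue_on \<Omega>. - \<i> * (c * snd U x) = (- \<i> * c) * fst V x"
      using ae by eventually_elim simp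
  qed
  have pP: "(p, P) \<in> H1 \<Omega>" unfolding p_eq P_def by (rule H01_H1[OF \<Omega> H(2)])
  have vG: "(cls \<Omega> (\<lambda>x. c * fst U x), G) \<in> H1 \<Omega>" unfolding G_def by (rule H01_H1[OF \<Omega> H(1)])
  \<comment> \<open>\<open>p\<close> represents \<open>- \<i> * c * snd U\<close> and
    \<open>q\<close> represents \<open>- c * snd V\<close>, so \<open>- c\<close> factors out of the
    second component of the equation.\<close>
  have r: "q + mul \<alpha> p = cls \<Omega> (\<lambda>x. (- c) * f x)"
  proof -
    have l: "L2 \<Omega> (\<lambda>x. - \<i> * (c * snd U x))" "L2 \<Omega> (\<lambda>x. - \<i> * ((- \<i> * c) * snd V x))" by (intro L2_cmult S L)+
    have "q + mul \<alpha> p = 1 *\<^sub>R cls \<Omega> (\<lambda>x. - \<i> * ((- \<i> * c) * snd V x)) + 1 *\<^sub>R cls \<Omega> (\<lambda>x. of_real (a x) * (- \<i> * (c * snd U x)))"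
    proof -
      have "mul \<alpha> p = cls \<Omega> (\<lambda>x. of_real (a x) * (- \<i> * (c * snd U x)))"
        unfolding p_def by (rule mul_\<alpha>_cls(2)[OF a l(1)])
      then show ?thesis by (simp only: q_def scaleR_one)
    qed
    also have "\<dots> = cls \<Omega> (\<lambda>x. of_real 1 * (- \<i> * ((- \<i> * c) * snd V x)) + of_real 1 * (of_real (a x) * (- \<i> * (c * snd U x))))"
      by (rule cls_lincomb[OF S l(2) mul_\<alpha>_cls(1)[OF a l(1)], symmetric])
    also have "(\<lambda>x. of_real 1 * (- \<i> * ((- \<i> * c) * snd V x)) + of_real 1 * (of_real (a x) * (- \<i> * (c * snd U x)))) = (\<lambda>x. (- c) * f x)"
      by (rule ext) (simp add: f_def complex_eq_iff algebra_simps)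
    finally show ?thesis .
  qed
  obtain H0 where H0: "L2_grad \<Omega> (fst U) H0" using H(1) by (auto simp: H01_def)
  have g: "L2_grad \<Omega> (fst U) (grad \<Omega> (fst U))" by (rule L2_grad_grad[OF H0])
  have G_eq: "G = gmk (\<lambda>b. cls \<Omega> (\<lambda>x. c * grad \<Omega> (fst U) b x))"
  proof (rule gl2_eqI)
    fix b :: 'a assume b: "b \<in> Basis"
    have "L2_grad \<Omega> (\<lambda>x. c * fst U x) (\<lambda>b x. c * grad \<Omega> (fst U) b x)"
      using L2_grad_lincomb[OF S L(3) g L(3) g, of c 0] by simp
    from L2_grad_unique[OF \<Omega> this b]
    show "gcomp G b = gcomp (gmk (\<lambda>b. cls \<Omega> (\<lambda>x. c * grad \<Omega> (fst U) b x))) b"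
      using b by (simp add: gcl_def G_def)
  qed
  have "weak_laplace \<Omega> G (q + mul \<alpha> p)"
    unfolding weak_laplace_def
  proof clarify
    fix \<phi> \<Phi> assume z: "(\<phi>, \<Phi>) \<in> H1 \<Omega>"
    \<comment> \<open>\<open>graphA\<close> tests with smooth functions only; both sides are
      continuous, so the identity extends to \<open>H1 \<Omega>\<close>.\<close>
    have "inner (q + mul \<alpha> p) (fst z) = - inner G (snd z)" if z: "z \<in> H1 \<Omega>" for z
    proof (rule H1_closed_induct[OF _ _ z])
      show "closed {z. inner (q + mul \<alpha> p) (fst z) = - inner G (snd z)}"
        by (intro closed_Collect_eq continuous_intros)
      fix \<phi> assume \<phi>: "test_fun \<Omega> \<phi>"
      have t: "test_fun \<Omega> (\<lambda>x. cnj (\<phi> x))" by (rule test_bounded_linear[OF \<phi> bounded_linear_cnj])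
      have "inner (q + mul \<alpha> p) (abs_l2 \<phi>) = Re (\<integral>x. (- c) * f x * cnj (\<phi> x) \<partial>lebesgue_on \<Omega>)"
        unfolding r by (rule inner_cls_test[OF S L2_cmult[OF S Lf] \<phi>])
      also have "(\<integral>x. (- c) * f x * cnj (\<phi> x) \<partial>lebesgue_on \<Omega>) = (- c) * (\<integral>x. f x * cnj (\<phi> x) \<partial>lebesgue_on \<Omega>)"
        by (simp only: mult.assoc integral_mult_right_zero)
      also have "(\<integral>x. f x * cnj (\<phi> x) \<partial>lebesgue_on \<Omega>) = (\<integral>x. (\<Sum>b\<in>Basis. grad \<Omega> (fst U) b x * pd (\<lambda>x. cnj (\<phi> x)) b x) \<partial>lebesgue_on \<Omega>)"
        unfolding f_def by (rule eq[OF t])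
      also have "Re ((- c) * \<dots>) = - inner G (grd \<phi>)"
        unfolding G_eq using g by (subst grd_cnj_sum[OF S _ \<phi>]) (auto simp: L2_grad_def)
      finally show "inner (q + mul \<alpha> p) (fst (abs_l2 \<phi>, grd \<phi>)) = - inner G (snd (abs_l2 \<phi>, grd \<phi>))" by simp
    qed
    from this[OF z] show "inner (q + mul \<alpha> p) \<phi> = - inner G \<Phi>" by simp
  qed
  then show ?thesis unfolding conv by (rule genI[OF pP vG])
qed

text \<open>In \<open>damped_solution\<close> initial value and derivative are taken in the energy
  seminorm; \<open>conv\<close> passes to classes, where this is equality and an ordinary
  derivative.\<close>

lemma damped_solution_orbit:
  assumes \<Omega>: "open \<Omega>" and a: "\<And>x. x \<in> \<Omega> \<Longrightarrow> \<alpha> x = a x"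
    and U: "damped_solution \<Omega> a U0 U" and U0: "ED \<Omega> U0"
  shows "conv \<Omega> (U 0) = conv \<Omega> U0" "\<exists>y. orbit gen (\<lambda>t. conv \<Omega> (U t)) y"
proof -
  note S = \<Omega>_sets
  have ED: "\<And>t. t \<ge> 0 \<Longrightarrow> ED \<Omega> (U t)" and init: "EDnorm \<Omega> (st_diff (U 0) U0) = 0"
    using U unfolding damped_solution_def by auto
  obtain W where W: "\<And>t. t \<ge> 0 \<Longrightarrow> graphA \<Omega> a (U t) (st_scale \<i> (W t))"
    and lim: "\<And>t. t \<ge> 0 \<Longrightarrow> ((\<lambda>h. EDnorm \<Omega> (st_diff (st_scale (complex_of_real (1/h)) (st_diff (U (t+h)) (U t))) (W t)))
               \<longlongrightarrow> 0) (at 0 within {h. 0 \<le> t + h})"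
    using U unfolding damped_solution_def by blast
  note preU = ED_pre_state[OF ED]
  \<comment> \<open>Only \<open>\<i> * W t\<close> is assumed to lie in the energy space;
    multiplying by \<open>- \<i>\<close> gives back what the norm requires of
    \<open>W t\<close>.\<close>
  have preW: "pre_state \<Omega> (W t)" if t: "t \<ge> 0" for t
  proof -
    have "ED \<Omega> (st_scale \<i> (W t))" using W[OF t] by (simp add: graphA_def)
    then have p: "pre_state \<Omega> (st_scale \<i> (W t))" by (rule ED_pre_state)
    then obtain G where G: "L2_grad \<Omega> (\<lambda>x. \<i> * fst (W t) x) G" and l: "L2 \<Omega> (\<lambda>x. \<i> * fst (W t) x)" "L2 \<Omega> (\<lambda>x. \<i> * snd (W t) x)"
      by (auto simp: pre_state_def st_scale_def)
    have i: "- \<i> * (\<i> * z) = z" for z :: complex by (simp flip: mult.assoc)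
    show ?thesis
      using L2_cmult[OF S l(1), of "- \<i>"] L2_cmult[OF S l(2), of "- \<i>"] L2_grad_lincomb[OF S l(1) G l(1) G, of "- \<i>" 0]
      unfolding pre_state_def i by auto
  qed
  show "conv \<Omega> (U 0) = conv \<Omega> U0"
  proof -
    have "norm (conv \<Omega> (st_diff (U 0) U0)) = 0"
      using init EDnorm_conv[OF \<Omega> conv_lc(1)[OF \<Omega> preU ED_pre_state[OF U0]], of 0 1 "-1"] by (simp add: st_diff_lc)
    then show ?thesis using conv_lc(2)[OF \<Omega> preU ED_pre_state[OF U0], of 0 1 "-1"] by (simp add: st_diff_lc)
  qed
  have "orbit gen (\<lambda>t. conv \<Omega> (U t)) (\<lambda>t. conv \<Omega> (W t))"
    unfolding orbit_def
  proof (intro allI impI conjI)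
    fix t :: real assume t: "t \<ge> 0"
    have "st_scale 1 (U t) = U t" "st_scale (- \<i> * 1) (st_scale \<i> (W t)) = W t"
      by (simp_all add: st_scale_def flip: mult.assoc)
    then show "(conv \<Omega> (U t), conv \<Omega> (W t)) \<in> gen" using graphA_gen[OF \<Omega> a W[OF t], of 1] by simp
    let ?x = "\<lambda>t. conv \<Omega> (U t)"
    have eq: "EDnorm \<Omega> (st_diff (st_scale (complex_of_real (1/h)) (st_diff (U (t+h)) (U t))) (W t)) =
        norm ((1 / h) *\<^sub>R (?x (t + h) - ?x t) - conv \<Omega> (W t))" if h: "t + h \<ge> 0" for h
    proof -
      note d = conv_lc[OF \<Omega> preU[OF h] preU[OF t], of 1 "-1"]
      note e = conv_lc[OF \<Omega> d(1) d(1), of "1/h" 0]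
      note f = conv_lc[OF \<Omega> e(1) preW[OF t], of 1 "-1"]
      show ?thesis
        unfolding st_diff_lc st_scale_lc EDnorm_conv[OF \<Omega> f(1)] f(2) e(2) d(2) by simp
    qed
    have "((\<lambda>s. norm ((1 / (s - t)) *\<^sub>R (?x s - ?x t) - conv \<Omega> (W t))) \<longlongrightarrow> 0) (at t within {0..})"
    proof (rule tendstoI)
      fix \<epsilon> :: real assume "\<epsilon> > 0"
      from tendstoD[OF lim[OF t] this] obtain d where d: "d > 0" "\<And>h. t + h \<ge> 0 \<Longrightarrow> h \<noteq> 0 \<Longrightarrow> \<bar>h\<bar> < d \<Longrightarrow>
          dist (EDnorm \<Omega> (st_diff (st_scale (complex_of_real (1/h)) (st_diff (U (t+h)) (U t))) (W t))) 0 < \<epsilon>"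
        unfolding eventually_at by (auto simp: dist_real_def)
      show "\<forall>\<^sub>F s in at t within {0..}. dist (norm ((1 / (s - t)) *\<^sub>R (?x s - ?x t) - conv \<Omega> (W t))) 0 < \<epsilon>"
        unfolding eventually_at
      proof (intro exI[of _ d] conjI ballI impI d(1))
        fix s assume "s \<in> {0..}" "s \<noteq> t \<and> dist s t < d"
        then show "dist (norm ((1 / (s - t)) *\<^sub>R (?x s - ?x t) - conv \<Omega> (W t))) 0 < \<epsilon>"
          using d(2)[of "s - t"] eq[of "s - t"] by (simp add: dist_real_def)
      qed
    qed
    then show "(?x has_vector_derivative conv \<Omega> (W t)) (at t within {0..})"
      unfolding has_vector_derivative_tendsto by (simp add: tendsto_norm_zero_iff LIM_zero_iff)
  qed
  then show "\<exists>y. orbit gen (\<lambda>t. conv \<Omega> (U t)) y" by blast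
qed

theorem damped_solution_decay:
  assumes \<Omega>: "open \<Omega>" and a: "\<And>x. x \<in> \<Omega> \<Longrightarrow> \<alpha> x = a x" and k: "k \<ge> 1"
  shows "\<exists>C\<ge>0. \<forall>U0 Us U t.
           Us 0 = U0 \<and> (\<forall>j<k. graphA \<Omega> a (Us j) (Us (Suc j)))
           \<and> damped_solution \<Omega> a U0 U \<and> t \<ge> 1
           \<longrightarrow> EDnorm \<Omega> (U t) \<le> C * t powr (- (real k / 2)) * EDnorm \<Omega> (Us k)"
proof -
  obtain C where C: "C \<ge> 0" and one: "\<forall>x y T. orbit gen x y \<longrightarrow> T > 0 \<longrightarrow> norm (x T) \<le> C * T powr (-1/2) * norm (y 0)"
    using one_step_decay by blast
  have "\<exists>D\<ge>0. \<forall>x y X T. orbit gen x y \<longrightarrow> x 0 = X 0 \<longrightarrow> (\<forall>j<k. (X j, X (Suc j)) \<in> gen) \<longrightarrow> T > 0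
           \<longrightarrow> norm (x T) \<le> D * T powr (- (real k / 2)) * norm (X k)"
    by (rule orbit_decay[OF subspace_gen dissipative_gen C]) (use one in blast)
  then obtain D where D: "D \<ge> 0" and dec: "\<forall>x y X T. orbit gen x y \<longrightarrow> x 0 = X 0 \<longrightarrow> (\<forall>j<k. (X j, X (Suc j)) \<in> gen) \<longrightarrow> T > 0
           \<longrightarrow> norm (x T) \<le> D * T powr (- (real k / 2)) * norm (X k)"
    by blast
  show ?thesis
  proof (intro exI[of _ D] conjI allI impI D)
    fix U0 Us U and t :: real
    assume asm: "Us 0 = U0 \<and> (\<forall>j<k. graphA \<Omega> a (Us j) (Us (Suc j))) \<and> damped_solution \<Omega> a U0 U \<and> t \<ge> 1"
    then have chain: "\<And>j. j < k \<Longrightarrow> graphA \<Omega> a (Us j) (Us (Suc j))" and U: "damped_solution \<Omega> a U0 U"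
      and t: "t \<ge> 1" and 0: "Us 0 = U0" by auto
    have U0: "ED \<Omega> U0" using chain[of 0] k 0 by (simp add: graphA_def)
    have Uk: "ED \<Omega> (Us k)" using chain[of "k - 1"] k by (simp add: graphA_def)
    \<comment> \<open>The phases turn powers of the operator into powers of \<open>- \<i>\<close>
      times it. They have modulus 1, so \<open>norm (X k)\<close> is the energy norm of
      \<open>Us k\<close>.\<close>
    define X where "X j = conv \<Omega> (st_scale ((- \<i>) ^ j) (Us j))" for j
    obtain y where y: "orbit gen (\<lambda>t. conv \<Omega> (U t)) y" using damped_solution_orbit(2)[OF \<Omega> a U U0] by blast
    have X0: "conv \<Omega> (U 0) = X 0"
      using damped_solution_orbit(1)[OF \<Omega> a U U0] by (simp add: X_def st_scale_def 0)
    have XX: "\<forall>j<k. (X j, X (Suc j)) \<in> gen"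
      using graphA_gen[OF \<Omega> a chain] by (auto simp: X_def)
    have "norm (conv \<Omega> (U t)) \<le> D * t powr (- (real k / 2)) * norm (X k)"
      using dec[rule_format, of "\<lambda>t. conv \<Omega> (U t)" y X t] y X0 XX t by simp
    moreover have "ED \<Omega> (U t)" using U t unfolding damped_solution_def by auto
    moreover have "norm (X k) = EDnorm \<Omega> (Us k)"
    proof -
      obtain G where G: "L2_grad \<Omega> (fst (Us k)) G" and L: "L2 \<Omega> (fst (Us k))" "L2 \<Omega> (snd (Us k))"
        using ED_pre_state[OF Uk] by (auto simp: pre_state_def)
      have g: "L2_grad \<Omega> (fst (Us k)) (grad \<Omega> (fst (Us k)))" by (rule L2_grad_grad[OF G])
      let ?c = "(- \<i>) ^ k"
      have c: "cmod ?c = 1" by (simp add: norm_power)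
      have "norm (gcl \<Omega> (\<lambda>x. ?c * fst (Us k) x)) = norm (gcl \<Omega> (fst (Us k)))"
      proof -
        have gl: "L2_grad \<Omega> (\<lambda>x. ?c * fst (Us k) x) (\<lambda>b x. ?c * grad \<Omega> (fst (Us k)) b x)"
          using L2_grad_lincomb[OF \<Omega>_sets L(1) g L(1) g, of ?c 0] by simp
        have "norm (gcomp (gcl \<Omega> (\<lambda>x. ?c * fst (Us k) x)) b) = norm (gcomp (gcl \<Omega> (fst (Us k))) b)" if "b \<in> Basis" for b
        proof -
          have l: "L2 \<Omega> (grad \<Omega> (fst (Us k)) b)" using g that unfolding L2_grad_def by blast
          have "norm (gcomp (gcl \<Omega> (\<lambda>x. ?c * fst (Us k) x)) b) = norm (cls \<Omega> (\<lambda>x. ?c * grad \<Omega> (fst (Us k)) b x))"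
            unfolding gcl_def gcomp_gmk[OF that] by (rule arg_cong[OF L2_grad_unique[OF \<Omega> gl that]])
          also have "\<dots> = norm (gcomp (gcl \<Omega> (fst (Us k))) b)"
            unfolding norm_cls_cmult[OF \<Omega>_sets l] gcl_def gcomp_gmk[OF that] c by (rule mult_1_left)
          finally show ?thesis .
        qed
        then have "(norm (gcl \<Omega> (\<lambda>x. ?c * fst (Us k) x)))\<^sup>2 = (norm (gcl \<Omega> (fst (Us k))))\<^sup>2"
          unfolding norm_gl2_power2 by simp
        then show ?thesis by (simp add: power2_eq_iff_nonneg)
      qed
      moreover have "norm (cls \<Omega> (\<lambda>x. - \<i> * (?c * snd (Us k) x))) = norm (cls \<Omega> (\<lambda>x. - \<i> * snd (Us k) x))"
        using norm_cls_cmult[OF \<Omega>_sets L2_cmult[OF \<Omega>_sets L(2)], of "- \<i>" ?c] norm_cls_cmult[OF \<Omega>_sets L(2), of ?c]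
          norm_cls_cmult[OF \<Omega>_sets L(2), of "- \<i>"] c by simp
      ultimately show ?thesis
        unfolding EDnorm_conv[OF \<Omega> ED_pre_state[OF Uk]] by (simp add: X_def conv_def st_scale_def norm_prod_def)
    qed
    ultimately show "EDnorm \<Omega> (U t) \<le> D * t powr (- (real k / 2)) * EDnorm \<Omega> (Us k)"
      using EDnorm_conv[OF \<Omega> ED_pre_state] by simp
  qed
qed

end

theorem theorem4p2:
  fixes \<omega> :: "'n::euclidean_space set" and a :: "'d::euclidean_space \<times> 'n \<Rightarrow> real"
    and K :: "('d \<times> 'n) set" and c0 :: real and k :: nat
  assumes "bounded \<omega>" and "open \<omega>" and "connected \<omega>" and "smooth_boundary \<omega>"
    and "a \<in> borel_measurable (lebesgue_on (UNIV \<times> \<omega>))"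
    and "bounded (a ` (UNIV \<times> \<omega>))" and "\<forall>x\<in>UNIV \<times> \<omega>. 0 \<le> a x"
    and "compact K" and "K \<subseteq> closure (UNIV \<times> \<omega>)" and "c0 > 0"
    and "\<forall>x\<in>(UNIV \<times> \<omega>) - K. c0 \<le> a x"
    and "k \<ge> 1"
  shows "\<exists>C\<ge>0. \<forall>U0 Us U t.
           Us 0 = U0 \<and> (\<forall>j<k. graphA (UNIV \<times> \<omega>) a (Us j) (Us (Suc j)))
           \<and> damped_solution (UNIV \<times> \<omega>) a U0 U \<and> t \<ge> 1
           \<longrightarrow> EDnorm (UNIV \<times> \<omega>) (U t) \<le> C * t powr (- (real k / 2)) * EDnorm (UNIV \<times> \<omega>) (Us k)"
proof -
  let ?\<Omega> = "(UNIV :: 'd set) \<times> \<omega>"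
  have \<Omega>: "open ?\<Omega>" by (intro open_Times assms) simp
  have S: "?\<Omega> \<in> sets lebesgue" using \<Omega> by auto
  \<comment> \<open>Extension by zero, so that the damping acts on classes over the whole
    space.\<close>
  define \<alpha> where "\<alpha> x = indicator ?\<Omega> x *\<^sub>R a x" for x
  \<comment> \<open>Any coordinate of the unbounded factor will do; there is one because its
    dimension is positive.\<close>
  obtain b0 :: 'd where b0: "b0 \<in> Basis" using nonempty_Basis by blast
  obtain b1 :: 'n where b1: "b1 \<in> Basis" using nonempty_Basis by blast
  \<comment> \<open>\<open>K\<close> lies in the ball of radius \<open>R\<close>, so a coordinate of
    modulus larger than \<open>R\<close> puts a point outside \<open>K\<close>.\<close>
  obtain R where R: "R > 0" "\<And>x. x \<in> K \<Longrightarrow> norm x \<le> R"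
    using compact_imp_bounded[OF \<open>compact K\<close>] by (auto simp: bounded_pos)
  obtain M where M: "M > 0" "\<And>x. x \<in> \<omega> \<Longrightarrow> norm x \<le> M"
    using \<open>bounded \<omega>\<close> by (auto simp: bounded_pos)
  obtain B where B: "\<And>x. x \<in> ?\<Omega> \<Longrightarrow> \<bar>a x\<bar> \<le> B"
    using \<open>bounded (a ` ?\<Omega>)\<close> by (auto simp: bounded_iff)
  interpret waveguide ?\<Omega> \<alpha> "(b0, 0)" "(0, b1)" R M c0
  proof
    show "?\<Omega> \<in> sets lebesgue" by (rule S)
    show "(\<lambda>x. x + s *\<^sub>R (b0, 0)) ` ?\<Omega> = ?\<Omega>" for s
    proof
      show "?\<Omega> \<subseteq> (\<lambda>x. x + s *\<^sub>R (b0, 0)) ` ?\<Omega>"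
      proof
        fix x assume "x \<in> ?\<Omega>"
        then show "x \<in> (\<lambda>x. x + s *\<^sub>R (b0, 0)) ` ?\<Omega>"
          by (intro image_eqI[of _ _ "x - s *\<^sub>R (b0, 0)"]) auto
      qed
    qed auto
    show "(b0, 0) \<in> (Basis :: ('d \<times> 'n) set)" "(0, b1) \<in> (Basis :: ('d \<times> 'n) set)"
      using b0 b1 by (auto simp: Basis_prod_def)
    show "\<bar>inner x (0, b1)\<bar> \<le> M" if "x \<in> ?\<Omega>" for x
      using that M(2)[of "snd x"] Basis_le_norm[OF b1, of "snd x"] by (auto simp: inner_prod_def)
    show "M > 0" "R > 0" "c0 > 0" by (rule M R assms)+
    show "bm \<alpha>"
      unfolding bm_def
    proof
      show "\<alpha> \<in> borel_measurable lebesgue"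
        using assms(5) S unfolding \<alpha>_def by (simp add: borel_measurable_restrict_space_iff)
      have "\<bar>\<alpha> x\<bar> \<le> \<bar>B\<bar>" for x
        using B[of x] by (cases "x \<in> ?\<Omega>") (auto simp: \<alpha>_def)
      then show "bounded (range \<alpha>)" by (auto simp: bounded_iff)
    qed
    show "0 \<le> \<alpha> x" if "x \<in> ?\<Omega>" for x using assms(7) that by (auto simp: \<alpha>_def)
    show "c0 \<le> \<alpha> x" if x: "x \<in> ?\<Omega>" "\<bar>inner x (b0, 0)\<bar> > R" for x
    proof -
      have "\<bar>inner x (b0, 0)\<bar> \<le> norm x"
        using Basis_le_norm[of "(b0, 0)" x] b0 by (auto simp: Basis_prod_def)
      then have "x \<notin> K" using R(2)[of x] x(2) by auto
      then show ?thesis using assms(11) x(1) by (auto simp: \<alpha>_def)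
    qed
  qed
  show ?thesis
    by (rule damped_solution_decay[OF \<Omega> _ \<open>k \<ge> 1\<close>]) (simp add: \<alpha>_def)
qed

end
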